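(* (i) The set $\mathbb S(V)$ of all Sheffer operators, equipped with the product (composition) of linear operators, is a group. The set $\mathbb A(V)$ of Appell operators is a normal subgroup of $\mathbb S(V)$, and the set $\mathbb B(V)$ of umbral operators is a subgroup of $\mathbb S(V)$. Furthermore, $\mathbb S(V)$ is the (internal) semidirect product of $\mathbb A(V)$ and $\mathbb B(V)$, i.e., $\mathbb S(V)=\mathbb A(V)\rtimes\mathbb B(V)$. (ii) Define a bijective map $\mathfrak R:\mathbb S(V)\to\mathcal R(V)$ as follows: for each Sheffer operator $S$ whose Sheffer sequence $(S_n(\omega))_{n=0}^\infty$ has generating function $\sum_{n=0}^\infty\frac1{n!}\langle S_n(\omega),v^{\otimes n}\rangle=\exp[\langle\omega,B(v)\rangle]A(v)$, with $B(v)\in\mathcal F_1(V)$ and $A(v)\in\mathcal F_0(V)$, set $\mathfrak R(S):=(A(v),B(v))$. The map $\mathfrak R$ is a group isomorphism between $\mathbb S(V)$ and the Riordan group $\mathcal R(V)$.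
   Context: $\mathbb F=\mathbb R$ or $\mathbb C$; $V$ is a vector space over $\mathbb F$ (of any dimension); $V^*$ is its algebraic dual; $\langle\cdot,\cdot\rangle$ denotes the dual pairing (also between $(V^{\odot n})^*$ and $V^{\odot n}$). $\mathbb N=\{1,2,\dots\}$, $\mathbb N_0=\mathbb N\cup\{0\}$. $\mathcal L(U,W)$ is the space of linear operators, $\mathcal L(U)=\mathcal L(U,U)$. $V^{\odot n}$ is the $n$th algebraic symmetric tensor power of $V$, the linear span of the vectors $v_1\odot\dots\odot v_n=\frac1{n!}\sum_{\pi\in S_n}v_{\pi(1)}\otimes\dots\otimes v_{\pi(n)}$ (equivalently, of the vectors $v^{\otimes n}$); $V^{\odot0}=\mathbb F$, $v^{\otimes0}=1$. For $\omega\in V^*$, $\langle\omega^{\otimes n},v_1\odot\dots\odot v_n\rangle=\prod_i\langle\omega,v_i\rangle$, $\omega^{\otimes 0}=1$. For linear operators (or functionals) $A_i$ on $V^{\odot l_i}$, $m=l_1+\dots+l_n$, $(A_1\odot\dots\odot A_n)v^{\otimes m}=(A_1v^{\otimes l_1})\odot\dots\odot(A_nv^{\otimes l_n})$. Polynomials and operators: $\mathcal P(V^* )$ is the space of functions $p:V^*\to\mathbb F$, $p(\omega)=\sum_{k=0}^n\langle\omega^{\otimes k},f_k\rangle$, $f_k\in V^{\odot k}$. $\mathbb P(V)$ is the set of operators $P\in\mathcal L(\mathcal P(V^* ))$ of the form $(P\langle\cdot^{\otimes n},f_n\rangle)(\omega)=\sum_{k=0}^n\langle\omega^{\otimes k},P_{kn}f_n\rangle$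 for $f_n\in V^{\odot n}$, $n\in\mathbb N_0$, with $P_{kn}\in\mathcal L(V^{\odot n},V^{\odot k})$ and each $P_{nn}$ bijective. The corresponding polynomial sequence, $P_n(\omega)\in(V^{\odot n})^*$, is given by $\langle P_n(\omega),f_n\rangle=(P\langle\cdot^{\otimes n},f_n\rangle)(\omega)$. - $S\in\mathbb P(V)$ is a Sheffer operator (and its polynomial sequence a Sheffer sequence) if $\sum_{n=0}^\infty\frac1{n!}\langle S_n(\omega),v^{\otimes n}\rangle=\exp[\langle\omega,B(v)\rangle]A(v)$ for some $B(v)\in\mathcal F_1(V)$, $A(v)\in\mathcal F_0(V)$. - A Sheffer operator is an Appell operator if $B(v)=v$. - $P\in\mathbb P(V)$ is an umbral operator if $P_0=1$ and $P_n(\omega+\theta)=\sum_{k=0}^n\binom nkP_k(\omega)\odot P_{n-k}(\theta)$ for all $\omega,\theta\in V^*$, $n\in\mathbb N$ (equivalently, a Sheffer operator with $A(v)=1$). Formal tensor power series: $\mathcal F(V,W)$ is the set of formal series $A(v)=A_0+\sum_{n\ge1}A_nv^{\otimes n}$ with $A_0\in W$, $A_n\in\mathcal L(V^{\odot n},W)$, identified with the coefficient sequence; $A(0)=A_0$; for $W=\mathbb F$ one writes $\langle A_n,v^{\otimes n}\rangle$. Products in $\mathcal F(V,\mathbb F)$ have $n$th coefficient $\sum_{k=0}^nA^{(1)}_k\odot A^{(2)}_{n-k}$; $\langle\omega,B(v)\rangle=\sum_n\langle\omega,B_nv^{\otimes n}\rangle$; $\exp[C(v)]=\sum_{k\ge0}\frac1{k!}C(v)^k$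 when $C(0)=0$. For $A(v)\in\mathcal F(V,W)$ and $B(v)\in\mathcal F(V,V)$ with $B(0)=0$, the composition $A(B(v))$ has zeroth coefficient $A_0$ and $n$th coefficient $\sum_{m=1}^nA_m\sum_{i_1,\dots,i_m\ge1,\,i_1+\dots+i_m=n}B_{i_1}\odot\dots\odot B_{i_m}$. $\mathcal F_0(V)=\{A(v)\in\mathcal F(V,\mathbb F):A(0)\ne0\}$, a group under multiplication. $\mathcal F_1(V)$ is the set of $B(v)\in\mathcal F(V,V)$ with $B(0)=0$ and $B_1\in\mathcal L(V)$ invertible, a group under composition with identity $v$. The Riordan group over $V$ is $\mathcal R(V)=\mathcal F_0(V)\times\mathcal F_1(V)$ with product $$(A^{(1)}(v),B^{(1)}(v))\ast(A^{(2)}(v),B^{(2)}(v))=\big(A^{(1)}(B^{(2)}(v))A^{(2)}(v),\,B^{(1)}(B^{(2)}(v))\big).$$ *)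

theory Defs
  imports
    "HOL-Algebra.Algebra"
    "HOL-Combinatorics.Combinatorics"
    "HOL-Library.Function_Algebras"
    "HOL-Library.FuncSet"
    Complex_Main
begin

section \<open>The ground field and linear maps between subspaces\<close>

text \<open>The scalar field is \<open>\<real>\<close> or \<open>\<complex>\<close>, up to isomorphism of fields.\<close>

class real_or_complex = field_char_0 +
  assumes real_or_complex:
    "\<exists>\<phi> :: 'a \<Rightarrow> complex. inj \<phi> \<and> \<phi> 1 = 1 \<and>
       (\<forall>x y. \<phi> (x + y) = \<phi> x + \<phi> y) \<and> (\<forall>x y. \<phi> (x * y) = \<phi> x * \<phi> y) \<and>
       (range \<phi> = \<real> \<or> range \<phi> = UNIV)"

instance real :: real_or_complex
proof
  show "\<exists>\<phi> :: real \<Rightarrow> complex. inj \<phi> \<and> \<phi> 1 = 1 \<and>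
       (\<forall>x y. \<phi> (x + y) = \<phi> x + \<phi> y) \<and> (\<forall>x y. \<phi> (x * y) = \<phi> x * \<phi> y) \<and>
       (range \<phi> = \<real> \<or> range \<phi> = UNIV)"
    by (rule exI[of _ complex_of_real]) (auto simp: inj_on_def Reals_def)
qed

instance complex :: real_or_complex
proof
  show "\<exists>\<phi> :: complex \<Rightarrow> complex. inj \<phi> \<and> \<phi> 1 = 1 \<and>
       (\<forall>x y. \<phi> (x + y) = \<phi> x + \<phi> y) \<and> (\<forall>x y. \<phi> (x * y) = \<phi> x * \<phi> y) \<and>
       (range \<phi> = \<real> \<or> range \<phi> = UNIV)"
    by (rule exI[of _ "\<lambda>x. x"]) auto
qed

text \<open>Scalar-valued functions form a vector space under the pointwise operations (addition is
  the one of \<^theory>\<open>HOL-Library.Function_Algebras\<close>).\<close>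

definition fun_scale :: "'f::field \<Rightarrow> ('x \<Rightarrow> 'f) \<Rightarrow> 'x \<Rightarrow> 'f" where
  "fun_scale c p = (\<lambda>x. c * p x)"

lemma vector_space_fun_scale: "vector_space (fun_scale :: 'f::field \<Rightarrow> ('x \<Rightarrow> 'f) \<Rightarrow> 'x \<Rightarrow> 'f)"
  by unfold_locales (auto simp: fun_scale_def fun_eq_iff algebra_simps)

text \<open>\<open>\<L>(U, W)\<close> for subspaces \<open>U\<close> and \<open>W\<close> of ambient spaces with scalar multiplications \<open>sU\<close>
  and \<open>sW\<close>. A map is extensional (\<open>undefined\<close> outside \<open>U\<close>), so that equality of linear maps on
  \<open>U\<close> is equality in HOL.\<close>

definition lin_maps ::
  "('f::field \<Rightarrow> 'u::ab_group_add \<Rightarrow> 'u) \<Rightarrow> 'u set \<Rightarrow> ('f \<Rightarrow> 'w::ab_group_add \<Rightarrow> 'w) \<Rightarrow> 'w set \<Rightarrow>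
    ('u \<Rightarrow> 'w) set" where
  "lin_maps sU U sW W = {L \<in> U \<rightarrow>\<^sub>E W.
     (\<forall>x\<in>U. \<forall>y\<in>U. L (x + y) = L x + L y) \<and> (\<forall>c. \<forall>x\<in>U. L (sU c x) = sW c (L x))}"

definition dual :: "('f::field \<Rightarrow> 'v::ab_group_add \<Rightarrow> 'v) \<Rightarrow> ('v \<Rightarrow> 'f) set" where
  "dual scale = {\<omega>. Vector_Spaces.linear scale (*) \<omega>}"


section \<open>Tensor powers and symmetric tensor powers\<close>

text \<open>An \<open>n\<close>-linear map on \<open>V\<close> is a function on lists of length \<open>n\<close>, extended by zero to lists of
  other lengths.\<close>

definition multilinear ::
  "('f::field \<Rightarrow> 'v::ab_group_add \<Rightarrow> 'v) \<Rightarrow> ('f \<Rightarrow> 'w::ab_group_add \<Rightarrow> 'w) \<Rightarrow> nat \<Rightarrow>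
    ('v list \<Rightarrow> 'w) \<Rightarrow> bool" where
  "multilinear scale sW n M \<longleftrightarrow>
     (\<forall>xs. length xs \<noteq> n \<longrightarrow> M xs = 0) \<and>
     (\<forall>xs. \<forall>i<n. length xs = n \<longrightarrow> Vector_Spaces.linear scale sW (\<lambda>y. M (xs[i := y])))"

text \<open>The algebraic tensor power is realised inside the dual of the space of multilinear forms:
  \<open>v\<^sub>1 \<otimes> \<dots> \<otimes> v\<^sub>n\<close> is evaluation of \<open>n\<close>-linear forms at \<open>(v\<^sub>1, \<dots>, v\<^sub>n)\<close>. The span of these
  evaluations has the universal property of the tensor power, see \<open>multilinear_tensor\<close> and
  \<open>tensor_power_universal\<close> below.
  In degree zero it is the line spanned by \<open>tensor scale []\<close>, which plays the role of \<open>1 \<in> \<F>\<close>;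
  in degree one it is \<open>V\<close>, with \<open>v\<close> corresponding to \<open>tensor scale [v]\<close>.\<close>

type_synonym ('f, 'v) tensor = "('v list \<Rightarrow> 'f) \<Rightarrow> 'f"

definition tensor :: "('f::field \<Rightarrow> 'v::ab_group_add \<Rightarrow> 'v) \<Rightarrow> 'v list \<Rightarrow> ('f, 'v) tensor" where
  "tensor scale xs = (\<lambda>M. if multilinear scale (*) (length xs) M then M xs else 0)"

definition Tensor :: "('f::field \<Rightarrow> 'v::ab_group_add \<Rightarrow> 'v) \<Rightarrow> nat \<Rightarrow> ('f, 'v) tensor set" where
  "Tensor scale n = module.span fun_scale {tensor scale xs | xs. length xs = n}"

definition symtensor ::
  "('f::field \<Rightarrow> 'v::ab_group_add \<Rightarrow> 'v) \<Rightarrow> 'v list \<Rightarrow> ('f, 'v) tensor" where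
  "symtensor scale xs = fun_scale (1 / of_nat (fact (length xs)))
     (\<Sum>\<pi> | \<pi> permutes {..<length xs}. tensor scale (permute_list \<pi> xs))"

definition Sym :: "('f::field \<Rightarrow> 'v::ab_group_add \<Rightarrow> 'v) \<Rightarrow> nat \<Rightarrow> ('f, 'v) tensor set" where
  "Sym scale n = module.span fun_scale {symtensor scale xs | xs. length xs = n}"

definition tpow :: "('f::field \<Rightarrow> 'v::ab_group_add \<Rightarrow> 'v) \<Rightarrow> nat \<Rightarrow> 'v \<Rightarrow> ('f, 'v) tensor" where
  "tpow scale n v = tensor scale (replicate n v)"

text \<open>The pairing \<open>\<langle>\<omega>\<^bsup>\<otimes>n\<^esup>, t\<rangle>\<close>: the tensor is applied to the \<open>n\<close>-linear form
  \<open>(v\<^sub>1, \<dots>, v\<^sub>n) \<mapsto> \<langle>\<omega>, v\<^sub>1\<rangle> \<dots> \<langle>\<omega>, v\<^sub>n\<rangle>\<close>; see \<open>dual_pair_symtensor\<close> below.\<close>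

definition dual_pair :: "nat \<Rightarrow> ('v \<Rightarrow> 'f::field) \<Rightarrow> ('f, 'v) tensor \<Rightarrow> 'f" where
  "dual_pair n \<omega> t = t (\<lambda>xs. if length xs = n then prod_list (map \<omega> xs) else 0)"

lemma multilinear_form_comp:
  fixes \<phi> :: "'w::ab_group_add \<Rightarrow> 'f::field"
  assumes "multilinear scale sW n M" "Vector_Spaces.linear sW (*) \<phi>"
  shows "multilinear scale (*) n (\<lambda>xs. \<phi> (M xs))"
proof -
  have "Vector_Spaces.linear sW (*) \<phi>" "\<phi> 0 = 0"
    using assms(2) by (auto simp: Vector_Spaces.linear_iff dest: spec[of _ "0::'w"])
  then show ?thesis
    using assms(1) by (simp add: multilinear_def Vector_Spaces.linear_iff)
qed

lemma multilinear_tensor: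
  fixes scale :: "'f::field \<Rightarrow> 'v::ab_group_add \<Rightarrow> 'v"
  assumes "vector_space scale"
  shows "multilinear scale fun_scale n (\<lambda>xs. if length xs = n then tensor scale xs else 0)"
proof -
  have "tensor scale (xs[i := x + y]) = tensor scale (xs[i := x]) + tensor scale (xs[i := y])"
    and "tensor scale (xs[i := scale c x]) = fun_scale c (tensor scale (xs[i := x]))"
    if "i < length xs" for xs i x y c
    using that by (auto simp: tensor_def fun_scale_def fun_eq_iff multilinear_def Vector_Spaces.linear_iff)
  then show ?thesis
    by (simp add: multilinear_def Vector_Spaces.linear_iff assms vector_space_fun_scale)
qed

lemma tensor_power_universal:
  fixes scale :: "'f::field \<Rightarrow> 'v::ab_group_add \<Rightarrow> 'v" and sW :: "'f \<Rightarrow> 'w::ab_group_add \<Rightarrow> 'w"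
  assumes "vector_space sW" and M: "multilinear scale sW n M"
  shows "\<exists>!L. L \<in> lin_maps fun_scale (Tensor scale n) sW UNIV \<and>
           (\<forall>xs. length xs = n \<longrightarrow> L (tensor scale xs) = M xs)"
proof -
  interpret W: vector_space sW by fact
  interpret T: vector_space "fun_scale :: 'f \<Rightarrow> ('f, 'v) tensor \<Rightarrow> ('f, 'v) tensor"
    by (rule vector_space_fun_scale)
  interpret TW: vector_space_pair "fun_scale :: 'f \<Rightarrow> ('f, 'v) tensor \<Rightarrow> ('f, 'v) tensor" sW ..
  interpret WF: vector_space_pair sW "(*) :: 'f \<Rightarrow> 'f \<Rightarrow> 'f"
    by unfold_locales (auto simp: algebra_simps)
  let ?E = "{tensor scale xs | xs. length xs = n}"
  have T: "Tensor scale n = T.span ?E"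
    by (simp add: Tensor_def)
  obtain B where B: "B \<subseteq> ?E" "T.independent B" "?E \<subseteq> T.span B"
    using T.maximal_independent_subset[of ?E] by blast
  have "\<forall>b\<in>B. \<exists>xs. length xs = n \<and> tensor scale xs = b"
    using B(1) by blast
  from bchoice[OF this] obtain r where "\<forall>b\<in>B. length (r b) = n \<and> tensor scale (r b) = b" ..
  then have r: "\<And>b. b \<in> B \<Longrightarrow> length (r b) = n" "\<And>b. b \<in> B \<Longrightarrow> tensor scale (r b) = b"
    by blast+
  obtain g where g: "Vector_Spaces.linear fun_scale sW g" "\<And>b. b \<in> B \<Longrightarrow> g b = M (r b)"
    using TW.linear_independent_extend[OF B(2), of "\<lambda>b. M (r b)"] by blast
  interpret g: Vector_Spaces.linear fun_scale sW g by (rule g)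
  have gM: "g (tensor scale xs) = M xs" if len: "length xs = n" for xs
  proof (rule ccontr)
    assume neq: "g (tensor scale xs) \<noteq> M xs"
    define w where "w = g (tensor scale xs) - M xs"
    have "w \<noteq> 0" using neq by (simp add: w_def)
    then have "W.independent {w}" by simp
    then obtain \<phi> where \<phi>: "Vector_Spaces.linear sW (*) \<phi>" "\<phi> w = (1::'f)"
      using WF.linear_independent_extend[of "{w}" "\<lambda>_. 1"] by auto
    interpret \<phi>: Vector_Spaces.linear sW "(*)" \<phi> by (rule \<phi>)
    define N where "N = (\<lambda>xs. \<phi> (M xs))"
    have N: "multilinear scale (*) n N"
      unfolding N_def by (rule multilinear_form_comp[OF M \<phi>(1)])
    have ev: "t N = \<phi> (g t)" if "t \<in> T.span B" for t
      using that
    proof (induction rule: T.span_induct_alt)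
      case base
      show ?case using g.zero \<phi>.zero by (simp add: zero_fun_def)
    next
      case (step c b t)
      have "b N = \<phi> (g b)"
        using r(1)[OF step(1)] g(2)[OF step(1)] N
        by (subst r(2)[OF step(1), symmetric]) (simp add: tensor_def N_def)
      moreover have "(fun_scale c b + t) N = c * b N + t N"
        by (simp add: fun_scale_def)
      ultimately show ?case
        using step(2) by (simp only: g.add g.scale \<phi>.add \<phi>.scale)
    qed
    have "tensor scale xs \<in> T.span B" using B(3) len by blast
    then have "\<phi> (g (tensor scale xs)) = tensor scale xs N" by (simp add: ev)
    also have "\<dots> = \<phi> (M xs)" using N len by (simp add: tensor_def N_def)
    finally have "\<phi> w = 0" by (simp add: w_def \<phi>.diff)
    with \<phi>(2) show False by simp
  qed
  have inE: "tensor scale xs \<in> Tensor scale n" if "length xs = n" for xs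
    unfolding T using that by (blast intro: T.span_base)
  show ?thesis
  proof (rule ex1I[of _ "restrict g (Tensor scale n)"], intro conjI allI impI)
    show "restrict g (Tensor scale n) \<in> lin_maps fun_scale (Tensor scale n) sW UNIV"
      using T.span_add T.span_scale by (auto simp: lin_maps_def T g.add g.scale)
    show "restrict g (Tensor scale n) (tensor scale xs) = M xs" if "length xs = n" for xs
      using that inE gM by simp
  next
    fix L
    assume L: "L \<in> lin_maps fun_scale (Tensor scale n) sW UNIV \<and>
      (\<forall>xs. length xs = n \<longrightarrow> L (tensor scale xs) = M xs)"
    have ext: "L \<in> extensional (Tensor scale n)"
      using L by (auto simp: lin_maps_def PiE_def)
    have add: "L (s + t) = L s + L t" and scl: "L (fun_scale c t) = sW c (L t)"
      if "s \<in> Tensor scale n" "t \<in> Tensor scale n" for c s t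
      using L that by (auto simp: lin_maps_def)
    have z: "L 0 = 0"
      using scl[of 0 0 0] by (simp add: T T.span_zero)
    have "L t = g t \<and> t \<in> T.span ?E" if "t \<in> T.span ?E" for t
      using that
    proof (induction rule: T.span_induct_alt)
      case base
      show ?case by (intro conjI T.span_zero) (simp only: z g.zero)
    next
      case (step c b t)
      then have "b \<in> Tensor scale n" "fun_scale c b \<in> Tensor scale n" "t \<in> Tensor scale n" "L b = g b"
        using L gM inE by (auto simp: T intro: T.span_scale)
      then show ?case
        using step(2) add[of "fun_scale c b" t] scl[of b b c] T.span_add[of "fun_scale c b" ?E t]
        by (simp only: g.add g.scale T)
    qed
    then show "L = restrict g (Tensor scale n)"
      by (intro extensionalityI[OF ext restrict_extensional]) (auto simp: T)
  qed
qed

lemma multilinear_prod_form: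
  fixes \<omega> :: "'v::ab_group_add \<Rightarrow> 'f::field"
  assumes "\<omega> \<in> dual scale"
  shows "multilinear scale (*) n (\<lambda>xs. if length xs = n then prod_list (map \<omega> xs) else 0)"
proof -
  have lin: "vector_space scale" "vector_space ((*) :: 'f \<Rightarrow> 'f \<Rightarrow> 'f)"
      "\<And>x y. \<omega> (x + y) = \<omega> x + \<omega> y" "\<And>c x. \<omega> (scale c x) = c * \<omega> x"
    using assms by (auto simp: dual_def Vector_Spaces.linear_iff)
  have "prod_list (map \<omega> (xs[i := y])) =
      \<omega> y * (prod_list (map \<omega> (take i xs)) * prod_list (map \<omega> (drop (Suc i) xs)))"
    if "i < length xs" for xs i y
    using that by (simp add: upd_conv_take_nth_drop mult.left_commute)
  then show ?thesis
    by (simp add: multilinear_def Vector_Spaces.linear_iff lin distrib_right mult.assoc)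
qed

lemma dual_pair_symtensor:
  fixes scale :: "'f::field_char_0 \<Rightarrow> 'v::ab_group_add \<Rightarrow> 'v"
  assumes "\<omega> \<in> dual scale"
  shows "dual_pair (length vs) \<omega> (symtensor scale vs) = prod_list (map \<omega> vs)"
proof -
  let ?n = "length vs"
  let ?M = "\<lambda>xs. if length xs = ?n then prod_list (map \<omega> xs) else 0"
  have sum_apply: "(\<Sum>\<pi>\<in>A. F \<pi>) M = (\<Sum>\<pi>\<in>A. F \<pi> M)" for A and F :: "(nat \<Rightarrow> nat) \<Rightarrow> ('f, 'v) tensor" and M
    by (induction A rule: infinite_finite_induct) auto
  have "tensor scale (permute_list \<pi> vs) ?M = prod_list (map \<omega> vs)" if "\<pi> permutes {..<?n}" for \<pi>
  proof -
    have "mset (map \<omega> (permute_list \<pi> vs)) = mset (map \<omega> vs)"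
      using that by simp
    then have "prod_list (map \<omega> (permute_list \<pi> vs)) = prod_list (map \<omega> vs)"
      by (metis prod_mset_prod_list)
    then show ?thesis
      using multilinear_prod_form[OF assms, of ?n] by (simp add: tensor_def)
  qed
  then have "(\<Sum>\<pi> | \<pi> permutes {..<?n}. tensor scale (permute_list \<pi> vs) ?M) =
      (\<Sum>\<pi> | \<pi> permutes {..<?n}. prod_list (map \<omega> vs))"
    by (intro sum.cong) auto
  then have "dual_pair ?n \<omega> (symtensor scale vs) =
      1 / of_nat (fact ?n) * (\<Sum>\<pi> | \<pi> permutes {..<?n}. prod_list (map \<omega> vs))"
    by (simp only: dual_pair_def symtensor_def fun_scale_def sum_apply)
  also have "\<dots> = prod_list (map \<omega> vs)"
    by (simp add: card_permutations[of "{..<?n}"])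
  finally show ?thesis .
qed

text \<open>The linear map on \<open>V\<^bsup>\<odot>n\<^esup>\<close> with prescribed values \<open>g v\<close> on the spanning vectors \<open>v\<^bsup>\<otimes>n\<^esup>\<close>.\<close>

definition sym_lift ::
  "('f::field \<Rightarrow> 'v::ab_group_add \<Rightarrow> 'v) \<Rightarrow> nat \<Rightarrow> ('f \<Rightarrow> 'w::ab_group_add \<Rightarrow> 'w) \<Rightarrow> 'w set \<Rightarrow>
    ('v \<Rightarrow> 'w) \<Rightarrow> ('f, 'v) tensor \<Rightarrow> 'w" where
  "sym_lift scale n sW W g =
     (THE L. L \<in> lin_maps fun_scale (Sym scale n) sW W \<and> (\<forall>v. L (tpow scale n v) = g v))"

text \<open>\<open>\<phi> \<odot> \<psi>\<close> for functionals \<open>\<phi>\<close> on \<open>V\<^bsup>\<odot>k\<^esup>\<close> and \<open>\<psi>\<close> on \<open>V\<^bsup>\<odot>l\<^esup>\<close>.\<close>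

definition odot_fun ::
  "('f::field \<Rightarrow> 'v::ab_group_add \<Rightarrow> 'v) \<Rightarrow> nat \<Rightarrow> nat \<Rightarrow> (('f, 'v) tensor \<Rightarrow> 'f) \<Rightarrow>
    (('f, 'v) tensor \<Rightarrow> 'f) \<Rightarrow> ('f, 'v) tensor \<Rightarrow> 'f" where
  "odot_fun scale k l \<phi> \<psi> =
     sym_lift scale (k + l) (*) UNIV (\<lambda>v. \<phi> (tpow scale k v) * \<psi> (tpow scale l v))"

text \<open>\<open>A\<^sub>1 \<odot> \<dots> \<odot> A\<^sub>n\<close> for operators \<open>A\<^sub>i : V\<^bsup>\<odot>l\<^sub>i\<^esup> \<rightarrow> V\<close>, given as the list of pairs
  \<open>(l\<^sub>i, A\<^sub>i)\<close>.\<close>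

definition odot_ops ::
  "('f::field \<Rightarrow> 'v::ab_group_add \<Rightarrow> 'v) \<Rightarrow> (nat \<times> (('f, 'v) tensor \<Rightarrow> 'v)) list \<Rightarrow>
    ('f, 'v) tensor \<Rightarrow> ('f, 'v) tensor" where
  "odot_ops scale As =
     sym_lift scale (sum_list (map fst As)) fun_scale (Sym scale (length As))
       (\<lambda>v. symtensor scale (map (\<lambda>(l, A). A (tpow scale l v)) As))"


section \<open>Formal tensor power series\<close>

text \<open>A series is its sequence of coefficients. The zeroth coefficient \<open>A\<^sub>0 \<in> W\<close> is uniformly
  treated as the linear map \<open>c \<mapsto> c A\<^sub>0\<close> on \<open>V\<^bsup>\<odot>0\<^esup> = \<F>\<close>; it is recovered by evaluation at
  \<open>tensor scale []\<close>.\<close>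

type_synonym ('f, 'v, 'w) tseries = "nat \<Rightarrow> ('f, 'v) tensor \<Rightarrow> 'w"

definition tseries ::
  "('f::field \<Rightarrow> 'v::ab_group_add \<Rightarrow> 'v) \<Rightarrow> ('f \<Rightarrow> 'w::ab_group_add \<Rightarrow> 'w) \<Rightarrow>
    ('f, 'v, 'w) tseries set" where
  "tseries scale sW = {A. \<forall>n. A n \<in> lin_maps fun_scale (Sym scale n) sW UNIV}"

definition series_at_0 ::
  "('f::field \<Rightarrow> 'v::ab_group_add \<Rightarrow> 'v) \<Rightarrow> ('f, 'v, 'w) tseries \<Rightarrow> 'w" where
  "series_at_0 scale A = A 0 (tensor scale [])"

definition series_one :: "('f::field \<Rightarrow> 'v::ab_group_add \<Rightarrow> 'v) \<Rightarrow> ('f, 'v, 'f) tseries" where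
  "series_one scale n = sym_lift scale n (*) UNIV (\<lambda>v. if n = 0 then 1 else 0)"

definition series_mult ::
  "('f::field \<Rightarrow> 'v::ab_group_add \<Rightarrow> 'v) \<Rightarrow> ('f, 'v, 'f) tseries \<Rightarrow> ('f, 'v, 'f) tseries \<Rightarrow>
    ('f, 'v, 'f) tseries" where
  "series_mult scale A B n =
     (\<lambda>t \<in> Sym scale n. \<Sum>k\<le>n. odot_fun scale k (n - k) (A k) (B (n - k)) t)"

primrec series_pow ::
  "('f::field \<Rightarrow> 'v::ab_group_add \<Rightarrow> 'v) \<Rightarrow> ('f, 'v, 'f) tseries \<Rightarrow> nat \<Rightarrow>
    ('f, 'v, 'f) tseries" where
  "series_pow scale C 0 = series_one scale"
| "series_pow scale C (Suc k) = series_mult scale C (series_pow scale C k)"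

text \<open>Only used for \<open>C(0) = 0\<close>; then \<open>C(v)\<^sup>k\<close> has no terms of degree below \<open>k\<close>, so the \<open>n\<close>th
  coefficient of \<open>\<Sum>\<^sub>k C(v)\<^sup>k / k!\<close> is the finite sum over \<open>k \<le> n\<close>.\<close>

definition series_exp ::
  "('f::field \<Rightarrow> 'v::ab_group_add \<Rightarrow> 'v) \<Rightarrow> ('f, 'v, 'f) tseries \<Rightarrow> ('f, 'v, 'f) tseries" where
  "series_exp scale C n =
     (\<lambda>t \<in> Sym scale n. \<Sum>k\<le>n. series_pow scale C k n t / of_nat (fact k))"

definition series_dual_pair ::
  "('f::field \<Rightarrow> 'v::ab_group_add \<Rightarrow> 'v) \<Rightarrow> ('v \<Rightarrow> 'f) \<Rightarrow> ('f, 'v, 'v) tseries \<Rightarrow>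
    ('f, 'v, 'f) tseries" where
  "series_dual_pair scale \<omega> B n = (\<lambda>t \<in> Sym scale n. \<omega> (B n t))"

text \<open>The series \<open>v\<close>.\<close>

definition series_id :: "('f::field \<Rightarrow> 'v::ab_group_add \<Rightarrow> 'v) \<Rightarrow> ('f, 'v, 'v) tseries" where
  "series_id scale n = sym_lift scale n scale UNIV (\<lambda>v. if n = 1 then v else 0)"

definition series_comp ::
  "('f::field \<Rightarrow> 'v::ab_group_add \<Rightarrow> 'v) \<Rightarrow> ('f, 'v, 'w::ab_group_add) tseries \<Rightarrow>
    ('f, 'v, 'v) tseries \<Rightarrow> ('f, 'v, 'w) tseries" where
  "series_comp scale A B n =
     (if n = 0 then A 0 else
        (\<lambda>t \<in> Sym scale n. \<Sum>m = 1..n. A m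
           (\<Sum>is | length is = m \<and> (\<forall>i \<in> set is. i \<ge> 1) \<and> sum_list is = n.
              odot_ops scale (map (\<lambda>i. (i, B i)) is) t)))"

definition F0 :: "('f::field \<Rightarrow> 'v::ab_group_add \<Rightarrow> 'v) \<Rightarrow> ('f, 'v, 'f) tseries set" where
  "F0 scale = {A \<in> tseries scale (*). series_at_0 scale A \<noteq> 0}"

text \<open>\<open>B 1\<close> is defined on \<open>V\<^bsup>\<odot>1\<^esup> = V\<close>; invertibility means that it is a bijection onto \<open>V\<close>.\<close>

definition F1 :: "('f::field \<Rightarrow> 'v::ab_group_add \<Rightarrow> 'v) \<Rightarrow> ('f, 'v, 'v) tseries set" where
  "F1 scale =
     {B \<in> tseries scale scale. series_at_0 scale B = 0 \<and> bij_betw (B 1) (Sym scale 1) UNIV}"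

definition riordan_group ::
  "('f::field \<Rightarrow> 'v::ab_group_add \<Rightarrow> 'v) \<Rightarrow>
    (('f, 'v, 'f) tseries \<times> ('f, 'v, 'v) tseries) monoid" where
  "riordan_group scale =
     \<lparr>carrier = F0 scale \<times> F1 scale,
      monoid.mult = (\<lambda>(A1, B1) (A2, B2).
        (series_mult scale (series_comp scale A1 B2) A2, series_comp scale B1 B2)),
      one = (series_one scale, series_id scale)\<rparr>"


section \<open>Polynomials on the dual space and polynomial sequences\<close>

text \<open>Functions on \<open>V\<^sup>*\<close> are extended by zero to all functions \<open>V \<rightarrow> \<F>\<close>, so that their pointwise
  vector space operations are those of the function space.\<close>

definition monom_poly ::
  "('f::field \<Rightarrow> 'v::ab_group_add \<Rightarrow> 'v) \<Rightarrow> nat \<Rightarrow> ('f, 'v) tensor \<Rightarrow> ('v \<Rightarrow> 'f) \<Rightarrow> 'f" where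
  "monom_poly scale n f = (\<lambda>\<omega>. if \<omega> \<in> dual scale then dual_pair n \<omega> f else 0)"

definition Polys :: "('f::field \<Rightarrow> 'v::ab_group_add \<Rightarrow> 'v) \<Rightarrow> (('v \<Rightarrow> 'f) \<Rightarrow> 'f) set" where
  "Polys scale =
     {p. \<exists>n f. (\<forall>k\<le>n. f k \<in> Sym scale k) \<and> p = (\<Sum>k\<le>n. monom_poly scale k (f k))}"

type_synonym ('f, 'v) poly_op = "(('v \<Rightarrow> 'f) \<Rightarrow> 'f) \<Rightarrow> (('v \<Rightarrow> 'f) \<Rightarrow> 'f)"

definition poly_seq_ops ::
  "('f::field \<Rightarrow> 'v::ab_group_add \<Rightarrow> 'v) \<Rightarrow> ('f, 'v) poly_op set" where
  "poly_seq_ops scale =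
     {P \<in> lin_maps fun_scale (Polys scale) fun_scale (Polys scale).
        \<exists>Q. (\<forall>n. \<forall>k\<le>n. Q k n \<in> lin_maps fun_scale (Sym scale n) fun_scale (Sym scale k)) \<and>
            (\<forall>n. bij_betw (Q n n) (Sym scale n) (Sym scale n)) \<and>
            (\<forall>n. \<forall>f \<in> Sym scale n. \<forall>\<omega> \<in> dual scale.
               P (monom_poly scale n f) \<omega> = (\<Sum>k\<le>n. dual_pair k \<omega> (Q k n f)))}"

text \<open>\<open>P\<^sub>n(\<omega>) \<in> (V\<^bsup>\<odot>n\<^esup>)\<^sup>*\<close>\<close>

definition poly_seq ::
  "('f::field \<Rightarrow> 'v::ab_group_add \<Rightarrow> 'v) \<Rightarrow> ('f, 'v) poly_op \<Rightarrow> nat \<Rightarrow> ('v \<Rightarrow> 'f) \<Rightarrow>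
    ('f, 'v) tensor \<Rightarrow> 'f" where
  "poly_seq scale P n \<omega> = (\<lambda>f \<in> Sym scale n. P (monom_poly scale n f) \<omega>)"

definition generating_series ::
  "('f::field \<Rightarrow> 'v::ab_group_add \<Rightarrow> 'v) \<Rightarrow> ('f, 'v) poly_op \<Rightarrow> ('v \<Rightarrow> 'f) \<Rightarrow>
    ('f, 'v, 'f) tseries" where
  "generating_series scale P \<omega> n = (\<lambda>t \<in> Sym scale n. poly_seq scale P n \<omega> t / of_nat (fact n))"

definition sheffer_generated ::
  "('f::field \<Rightarrow> 'v::ab_group_add \<Rightarrow> 'v) \<Rightarrow> ('f, 'v) poly_op \<Rightarrow> ('f, 'v, 'f) tseries \<Rightarrow>
    ('f, 'v, 'v) tseries \<Rightarrow> bool" where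
  "sheffer_generated scale S A B \<longleftrightarrow>
     (\<forall>\<omega> \<in> dual scale. generating_series scale S \<omega> =
        series_mult scale (series_exp scale (series_dual_pair scale \<omega> B)) A)"

definition Sheffer_ops :: "('f::field \<Rightarrow> 'v::ab_group_add \<Rightarrow> 'v) \<Rightarrow> ('f, 'v) poly_op set" where
  "Sheffer_ops scale =
     {S \<in> poly_seq_ops scale. \<exists>A \<in> F0 scale. \<exists>B \<in> F1 scale. sheffer_generated scale S A B}"

definition Appell_ops :: "('f::field \<Rightarrow> 'v::ab_group_add \<Rightarrow> 'v) \<Rightarrow> ('f, 'v) poly_op set" where
  "Appell_ops scale =
     {S \<in> Sheffer_ops scale. \<exists>A \<in> F0 scale. sheffer_generated scale S A (series_id scale)}"

definition umbral_ops :: "('f::field \<Rightarrow> 'v::ab_group_add \<Rightarrow> 'v) \<Rightarrow> ('f, 'v) poly_op set" where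
  "umbral_ops scale =
     {P \<in> poly_seq_ops scale.
        (\<forall>\<omega> \<in> dual scale. poly_seq scale P 0 \<omega> (tensor scale []) = 1) \<and>
        (\<forall>\<omega> \<in> dual scale. \<forall>\<theta> \<in> dual scale. \<forall>n\<ge>1. \<forall>t \<in> Sym scale n.
           poly_seq scale P n (\<omega> + \<theta>) t =
             (\<Sum>k\<le>n. of_nat (n choose k) *
                odot_fun scale k (n - k) (poly_seq scale P k \<omega>) (poly_seq scale P (n - k) \<theta>) t))}"

definition sheffer_group :: "('f::field \<Rightarrow> 'v::ab_group_add \<Rightarrow> 'v) \<Rightarrow> ('f, 'v) poly_op monoid" where
  "sheffer_group scale =
     \<lparr>carrier = Sheffer_ops scale,
      monoid.mult = (\<lambda>S T. compose (Polys scale) S T),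
      one = (\<lambda>p \<in> Polys scale. p)\<rparr>"

definition riordan_map ::
  "('f::field \<Rightarrow> 'v::ab_group_add \<Rightarrow> 'v) \<Rightarrow> ('f, 'v) poly_op \<Rightarrow>
    ('f, 'v, 'f) tseries \<times> ('f, 'v, 'v) tseries" where
  "riordan_map scale S =
     (THE AB. AB \<in> F0 scale \<times> F1 scale \<and> sheffer_generated scale S (fst AB) (snd AB))"

definition internal_semidirect_product :: "('a, 'b) monoid_scheme \<Rightarrow> 'a set \<Rightarrow> 'a set \<Rightarrow> bool" where
  "internal_semidirect_product G N H \<longleftrightarrow>
     group G \<and> N \<lhd> G \<and> subgroup H G \<and> N \<inter> H = {\<one>\<^bsub>G\<^esub>} \<and> N <#>\<^bsub>G\<^esub> H = carrier G"

end

theory Submission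
  imports Defs "HOL-Computational_Algebra.Polynomial" "HOL-Computational_Algebra.Formal_Power_Series"
begin

text \<open>
A Sheffer operator is determined by its effect on exponentials: the generating function says that
\<open>S\<close> sends \<open>\<omega> \<mapsto> exp \<langle>\<omega>, v\<rangle>\<close> to \<open>\<omega> \<mapsto> exp \<langle>\<omega>, B(v)\<rangle> A(v)\<close>, where both sides are read as series in \<open>v\<close>
with polynomial coefficients. If \<open>S\<close> and \<open>T\<close> belong to \<open>(A\<^sub>1, B\<^sub>1)\<close> and \<open>(A\<^sub>2, B\<^sub>2)\<close>, then applying \<open>S\<close>
to \<open>exp \<langle>\<omega>, B\<^sub>2(v)\<rangle> A\<^sub>2(v)\<close> just substitutes \<open>B\<^sub>2(v)\<close> for \<open>v\<close> and gives
\<open>exp \<langle>\<omega>, B\<^sub>1(B\<^sub>2(v))\<rangle> A\<^sub>1(B\<^sub>2(v)) A\<^sub>2(v)\<close>, which is the Riordan product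
(\<open>sheffer_generated_compose\<close>). The pair is recovered from \<open>S\<close>: at \<open>\<omega> = 0\<close> the generating function is
\<open>A\<close>, and then the exponential determines every \<open>\<langle>\<omega>, B(v)\<rangle>\<close> (\<open>sheffer_generated_unique\<close>). Conversely,
collecting the terms of degree \<open>k\<close> in \<open>\<omega>\<close> and \<open>n\<close> in \<open>v\<close> of \<open>n! exp \<langle>\<omega>, B(v)\<rangle> A(v)\<close> defines linear maps
from the \<open>n\<close>th to the \<open>k\<close>th symmetric power; for \<open>k = n\<close> this is \<open>A\<^sub>0 B\<^sub>1 \<odot> \<dots> \<odot> B\<^sub>1\<close>, a bijection, so every
pair comes from an operator (\<open>sheffer_operator_exists\<close>).

The Sheffer operators form a group because composition of operators is associative and because
\<open>A'(B(v)) A(v) = 1\<close> and \<open>B'(B(v)) = v\<close> can be solved degree by degree, using only that \<open>B\<^sub>1\<close> and \<open>A\<^sub>0\<close> are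
invertible (\<open>series_comp_solve_left\<close>, \<open>F0_inverse\<close>). The Riordan group inherits its group axioms through
the bijection; in particular, the associativity of composition of tensor power series is that of operators.
Appell operators are those with second component \<open>v\<close>, so they form a kernel; umbral operators are those
with first component \<open>1\<close> (\<open>umbral_ops_iff\<close>); and \<open>(A, B) = (A', v) (1, B)\<close> where \<open>A'(B(v)) = A(v)\<close>.

Three devices make tensor power series accessible. Symmetric powers are spanned by the powers
\<open>v\<^bsup>\<otimes>n\<^esup>\<close> (polarization), so linear maps on them are the same as homogeneous polynomial maps on \<open>V\<close>, and a
scalar series is the same as the family of ordinary formal power series \<open>ev A v\<close>, one for each \<open>v\<close>; in this form
products and exponentials are those of formal power series. Composition is treated by substituting
polynomial curves \<open>b\<^sub>1 s + b\<^sub>2 s\<^bsup>2\<^esup> + \<dots>\<close>: a multiplicative identity between polynomial functions of the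
scalar \<open>s\<close> is one between their coefficients (\<open>compose_curve_mult\<close>). Finally, the pairing with powers
of functionals is nondegenerate on symmetric powers, so a polynomial on the dual space has unique coefficients
(\<open>dual_pair_nondegenerate\<close>).
\<close>

section \<open>Multilinear expansion and polarization\<close>

lemma poly_fun_zero_imp_coeffs_zero:
  fixes c :: "nat \<Rightarrow> 'f::field_char_0"
  assumes "\<And>x. (\<Sum>k\<le>n. c k * x ^ k) = 0" "k \<le> n"
  shows "c k = 0"
proof -
  define p where "p = (\<Sum>k\<le>n. Polynomial.monom (c k) k)"
  have "poly p x = 0" for x
    by (simp add: p_def poly_sum poly_monom assms(1))
  then have "p = 0"
    using poly_eq_poly_eq_iff[of p 0] by (auto simp: fun_eq_iff)
  moreover have "poly.coeff p k = c k"
    using assms(2) by (simp add: p_def Polynomial.coeff_sum)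
  ultimately show ?thesis by simp
qed

lemma sum_fun_apply: "(\<Sum>i\<in>A. F i) x = (\<Sum>i\<in>A. F i x)"
  for F :: "'i \<Rightarrow> 'x \<Rightarrow> 'a::comm_monoid_add"
  by (induction A rule: infinite_finite_induct) auto

abbreviation words :: "nat \<Rightarrow> 'i set \<Rightarrow> 'i list set" where
  "words n S \<equiv> {is. set is \<subseteq> S \<and> length is = n}"

lemma sum_words_Suc:
  fixes F :: "'i list \<Rightarrow> 'a::comm_monoid_add"
  shows "(\<Sum>is\<in>words (Suc n) S. F is) = (\<Sum>i\<in>S. \<Sum>is\<in>words n S. F (i # is))"
proof -
  have "words (Suc n) S = (\<lambda>(i, is). i # is) ` (S \<times> words n S)"
    by (auto simp: length_Suc_conv image_iff)
  moreover have "inj_on (\<lambda>(i, is). i # is) (S \<times> words n S)"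
    by (auto simp: inj_on_def)
  ultimately show ?thesis
    by (simp add: sum.reindex sum.cartesian_product case_prod_unfold)
qed

lemma prod_list_power: "prod_list (map (\<lambda>i. s ^ i) is) = (s :: 'a::comm_monoid_mult) ^ sum_list is"
  by (induction "is") (auto simp: power_add)

lemma multilinear_update:
  assumes "multilinear scale sW n M" "length ys + Suc (length zs) = n"
  shows "Vector_Spaces.linear scale sW (\<lambda>y. M (ys @ y # zs))"
proof -
  have "length ys < n" "length (ys @ 0 # zs) = n" using assms(2) by auto
  then have "Vector_Spaces.linear scale sW (\<lambda>y. M ((ys @ 0 # zs)[length ys := y]))"
    using assms(1) unfolding multilinear_def by blast
  then show ?thesis by simp
qed

lemma linear_sum_rule:
  assumes "Vector_Spaces.linear s1 s2 f"
  shows "f (\<Sum>i\<in>S. x i) = (\<Sum>i\<in>S. f (x i))"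
proof -
  interpret Vector_Spaces.linear s1 s2 f by fact
  show ?thesis by (rule sum)
qed

lemma multilinear_expand_gen:
  assumes "multilinear scale sW n M" "length ys + k = n"
  shows "M (ys @ replicate k (\<Sum>i\<in>S. x i)) = (\<Sum>is\<in>words k S. M (ys @ map x is))"
  using assms(2)
proof (induction k arbitrary: ys)
  case 0
  have "words 0 S = {[]}" by auto
  then show ?case by simp
next
  case (Suc k)
  have "M (ys @ replicate (Suc k) (\<Sum>i\<in>S. x i)) = (\<Sum>i\<in>S. M ((ys @ [x i]) @ replicate k (\<Sum>i\<in>S. x i)))"
    using linear_sum_rule[OF multilinear_update[OF assms(1), of ys "replicate k (\<Sum>i\<in>S. x i)"]] Suc.prems
    by simp
  also have "\<dots> = (\<Sum>i\<in>S. \<Sum>is\<in>words k S. M (ys @ map x (i # is)))"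
    using Suc.prems by (subst Suc.IH) auto
  finally show ?case by (simp add: sum_words_Suc)
qed

lemma multilinear_expand:
  assumes "multilinear scale sW n M"
  shows "M (replicate n (\<Sum>i\<in>S. x i)) = (\<Sum>is\<in>words n S. M (map x is))"
  using multilinear_expand_gen[OF assms, of "[]" n x S] by simp

lemma multilinear_scale_gen:
  assumes "multilinear scale sW n M" "vector_space sW" "length ys + length is = n"
  shows "M (ys @ map (\<lambda>i. scale (a i) (x i)) is) = sW (prod_list (map a is)) (M (ys @ map x is))"
  using assms(3)
proof (induction "is" arbitrary: ys)
  case Nil
  interpret W: vector_space sW by fact
  show ?case by simp
next
  case (Cons i "is")
  interpret W: vector_space sW by fact
  have "M (ys @ map (\<lambda>i. scale (a i) (x i)) (i # is)) =
      M ((ys @ [scale (a i) (x i)]) @ map (\<lambda>i. scale (a i) (x i)) is)"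
    by simp
  also have "\<dots> = sW (prod_list (map a is)) (M (ys @ scale (a i) (x i) # map x is))"
    using Cons.prems by (subst Cons.IH) auto
  also have "M (ys @ scale (a i) (x i) # map x is) = sW (a i) (M (ys @ x i # map x is))"
    using multilinear_update[OF assms(1), of ys "map x is"] Cons.prems
    by (simp add: Vector_Spaces.linear_iff)
  finally show ?case by (simp add: mult.commute)
qed

lemma multilinear_scale:
  assumes "multilinear scale sW n M" "vector_space sW" "length is = n"
  shows "M (map (\<lambda>i. scale (a i) (x i)) is) = sW (prod_list (map a is)) (M (map x is))"
  using multilinear_scale_gen[OF assms(1,2), of "[]"] assms(3) by simp

lemma multilinear_expand_scaled:
  assumes "multilinear scale sW n M" "vector_space sW"
  shows "M (replicate n (\<Sum>i\<in>S. scale (a i) (x i))) =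
    (\<Sum>is\<in>words n S. sW (prod_list (map a is)) (M (map x is)))"
  unfolding multilinear_expand[OF assms(1)]
  by (intro sum.cong refl multilinear_scale[OF assms]) simp

text \<open>This turns linearity in the slot \<open>inv \<pi> i\<close> of the permuted list into linearity in the slot \<open>i\<close>.\<close>

lemma permute_list_update:
  assumes "\<pi> permutes {..<length xs}" "i < length xs"
  shows "permute_list \<pi> (xs[i := y]) = (permute_list \<pi> xs)[Hilbert_Choice.inv \<pi> i := y]"
proof (rule nth_equalityI)
  fix j assume "j < length (permute_list \<pi> (xs[i := y]))"
  then have j: "j < length xs" by simp
  then have "\<pi> j < length xs" using permutes_in_image[OF assms(1), of j] by simp
  moreover have "\<pi> j = i \<longleftrightarrow> Hilbert_Choice.inv \<pi> i = j"
    using permutes_inv_eq[OF assms(1)] by blast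
  ultimately show "permute_list \<pi> (xs[i := y]) ! j = (permute_list \<pi> xs)[Hilbert_Choice.inv \<pi> i := y] ! j"
    using j assms by (cases "\<pi> j = i") (auto simp: permute_list_nth)
qed simp

lemma multilinear_symtensor:
  fixes scale :: "'f::field_char_0 \<Rightarrow> 'v::ab_group_add \<Rightarrow> 'v"
  assumes "vector_space scale"
  shows "multilinear scale fun_scale n (\<lambda>xs. if length xs = n then symtensor scale xs else 0)"
proof -
  have lin: "Vector_Spaces.linear scale fun_scale (\<lambda>y. tensor scale (permute_list \<pi> (xs[i := y])))"
    if "\<pi> permutes {..<length xs}" "i < length xs" for \<pi> xs i
  proof -
    have "Hilbert_Choice.inv \<pi> i < length xs"
      using permutes_in_image[OF permutes_inv[OF that(1)], of i] that(2) by simp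
    then have "Vector_Spaces.linear scale fun_scale
        (\<lambda>y. tensor scale ((permute_list \<pi> xs)[Hilbert_Choice.inv \<pi> i := y]))"
      using multilinear_tensor[OF assms, of "length xs"] unfolding multilinear_def
      by (auto dest!: spec[of _ "permute_list \<pi> xs"])
    then show ?thesis using permute_list_update[OF that] by simp
  qed
  have add: "symtensor scale (xs[i := x + y]) = symtensor scale (xs[i := x]) + symtensor scale (xs[i := y])"
    and scl: "symtensor scale (xs[i := scale c x]) = fun_scale c (symtensor scale (xs[i := x]))"
    if "i < length xs" for xs i x y c
  proof -
    note l = lin[OF _ that, unfolded Vector_Spaces.linear_iff]
    have "(\<Sum>\<pi> | \<pi> permutes {..<length xs}. tensor scale (permute_list \<pi> (xs[i := x + y]))) =
      (\<Sum>\<pi> | \<pi> permutes {..<length xs}. tensor scale (permute_list \<pi> (xs[i := x])))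
       + (\<Sum>\<pi> | \<pi> permutes {..<length xs}. tensor scale (permute_list \<pi> (xs[i := y])))"
      unfolding sum.distrib[symmetric] using l by (intro sum.cong) auto
    then show "symtensor scale (xs[i := x + y]) = symtensor scale (xs[i := x]) + symtensor scale (xs[i := y])"
      by (simp add: symtensor_def fun_scale_def fun_eq_iff algebra_simps add_divide_distrib)
    have "(\<Sum>\<pi> | \<pi> permutes {..<length xs}. tensor scale (permute_list \<pi> (xs[i := scale c x]))) =
      (\<Sum>\<pi> | \<pi> permutes {..<length xs}. fun_scale c (tensor scale (permute_list \<pi> (xs[i := x]))))"
      using l by (intro sum.cong) auto
    also have "\<dots> = fun_scale c (\<Sum>\<pi> | \<pi> permutes {..<length xs}. tensor scale (permute_list \<pi> (xs[i := x])))"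
      by (simp add: fun_eq_iff fun_scale_def sum_fun_apply sum_distrib_left)
    finally show "symtensor scale (xs[i := scale c x]) = fun_scale c (symtensor scale (xs[i := x]))"
      by (simp add: symtensor_def fun_scale_def fun_eq_iff)
  qed
  then show ?thesis
    by (simp add: multilinear_def Vector_Spaces.linear_iff assms vector_space_fun_scale)
qed

text \<open>The words with letters in \<open>I\<close> are sorted by their exact set of letters. The part in which all letters
of \<open>I\<close> occur is the whole sum minus the parts for proper subsets, and those are in \<open>U\<close> by induction.\<close>

lemma polarization:
  fixes T :: "'i list \<Rightarrow> 'w::ab_group_add"
  assumes "module.subspace sW U" "vector_space sW" "finite I"
    and "\<And>S. S \<subseteq> I \<Longrightarrow> (\<Sum>is\<in>words n S. T is) \<in> U"
  shows "(\<Sum>is | set is = I \<and> length is = n. T is) \<in> U"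
  using assms(3,4)
proof (induction I rule: finite_psubset_induct)
  case (psubset I)
  interpret W: vector_space sW by fact
  have fin: "finite (words n I)" using psubset.hyps by (rule finite_lists_length_eq)
  have "words n I = (\<Union>S\<in>Pow I. {is. set is = S \<and> length is = n})" by auto
  moreover have "(\<Sum>is\<in>(\<Union>S\<in>Pow I. {is. set is = S \<and> length is = n}). T is) =
      (\<Sum>S\<in>Pow I. \<Sum>is | set is = S \<and> length is = n. T is)"
    using psubset.hyps by (intro sum.UNION_disjoint) (auto intro: finite_subset[OF _ fin])
  moreover have "Pow I = insert I (Pow I - {I})" by auto
  ultimately have "(\<Sum>is\<in>words n I. T is) = (\<Sum>is | set is = I \<and> length is = n. T is) +
      (\<Sum>S\<in>Pow I - {I}. \<Sum>is | set is = S \<and> length is = n. T is)"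
    using psubset.hyps by (metis (no_types, lifting) Diff_iff finite_Diff finite_Pow_iff insertI1 sum.insert)
  moreover have "(\<Sum>S\<in>Pow I - {I}. \<Sum>is | set is = S \<and> length is = n. T is) \<in> U"
  proof (rule W.subspace_sum[OF assms(1)])
    fix S assume "S \<in> Pow I - {I}"
    then have "S \<subset> I" by auto
    then show "(\<Sum>is | set is = S \<and> length is = n. T is) \<in> U"
      using psubset.IH[of S] psubset.prems by (meson order_trans psubset_imp_subset)
  qed
  moreover have "(\<Sum>is\<in>words n I. T is) \<in> U" using psubset by auto
  ultimately have "((\<Sum>is | set is = I \<and> length is = n. T is) +
      (\<Sum>S\<in>Pow I - {I}. \<Sum>is | set is = S \<and> length is = n. T is)) -
      (\<Sum>S\<in>Pow I - {I}. \<Sum>is | set is = S \<and> length is = n. T is) \<in> U"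
    by (intro W.subspace_diff[OF assms(1)]) simp_all
  then show ?case by simp
qed

text \<open>A word of length \<open>n\<close> that uses all of \<open>n\<close> letters is a permutation. Thus \<open>polarization\<close> with \<open>n\<close>
letters produces symmetrized values.\<close>

lemma sum_surjective_words:
  fixes T :: "'x list \<Rightarrow> 'w::comm_monoid_add"
  shows "(\<Sum>is | set is = {..<n} \<and> length is = n. T (map (\<lambda>i. xs ! i) is)) =
    (\<Sum>\<pi> | \<pi> permutes {..<n}. T (map (\<lambda>i. xs ! \<pi> i) [0..<n]))"
proof -
  have words: "{is. set is = {..<n} \<and> length is = n} = permutations_of_set {..<n}"
  proof (intro equalityI subsetI)
    fix l assume "l \<in> {is. set is = {..<n} \<and> length is = n}"
    then show "l \<in> permutations_of_set {..<n}"
      unfolding permutations_of_set_def using card_distinct[of l] by (metis (mono_tags, lifting) card_lessThan mem_Collect_eq)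
  next
    fix l assume "l \<in> permutations_of_set {..<n}"
    then show "l \<in> {is. set is = {..<n} \<and> length is = n}"
      unfolding permutations_of_set_def using distinct_card[of l] by (metis (mono_tags, lifting) card_lessThan mem_Collect_eq)
  qed
  have "bij_betw (\<lambda>\<pi>. map \<pi> [0..<n]) {\<pi>. \<pi> permutes {..<n}} (permutations_of_set {..<n})"
  proof (intro bij_betw_imageI)
    show "inj_on (\<lambda>\<pi>. map \<pi> [0..<n]) {\<pi>. \<pi> permutes {..<n}}"
    proof (rule inj_onI, rule ext)
      fix \<pi> \<sigma> i
      assume "\<pi> \<in> {\<pi>. \<pi> permutes {..<n}}" "\<sigma> \<in> {\<pi>. \<pi> permutes {..<n}}"
        "map \<pi> [0..<n] = map \<sigma> [0..<n]"
      then show "\<pi> i = \<sigma> i"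
        by (cases "i < n") (auto simp: permutes_not_in)
    qed
    show "(\<lambda>\<pi>. map \<pi> [0..<n]) ` {\<pi>. \<pi> permutes {..<n}} = permutations_of_set {..<n}"
    proof (intro equalityI subsetI)
      fix l assume "l \<in> (\<lambda>\<pi>. map \<pi> [0..<n]) ` {\<pi>. \<pi> permutes {..<n}}"
      then obtain \<pi> where \<pi>: "l = map \<pi> [0..<n]" "\<pi> permutes {..<n}" by blast
      have "set l = {..<n}"
        using permutes_image[OF \<pi>(2)] by (simp add: \<pi>(1) atLeast0LessThan)
      moreover have "distinct l"
        using permutes_inj_on[OF \<pi>(2)] by (simp add: \<pi>(1) distinct_map)
      ultimately show "l \<in> permutations_of_set {..<n}" by (rule permutations_of_setI)
    next
      fix l assume l0: "l \<in> permutations_of_set {..<n}"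
      have l: "set l = {..<n}" "distinct l" "length l = n"
        using permutations_of_setD[OF l0] length_finite_permutations_of_set[OF l0] by simp_all
      define \<pi> where "\<pi> = (\<lambda>i. if i < n then l ! i else i)"
      have "bij_betw \<pi> {..<n} {..<n}"
      proof (subst bij_betw_cong)
        show "bij_betw ((!) l) {..<n} {..<n}"
          by (rule bij_betw_nth[OF l(2)]) (simp_all add: l)
      qed (simp add: \<pi>_def)
      then have "\<pi> permutes {..<n}"
        by (rule bij_imp_permutes) (simp add: \<pi>_def)
      moreover have "map \<pi> [0..<n] = l"
        using l(3) by (intro nth_equalityI) (auto simp: \<pi>_def)
      ultimately show "l \<in> (\<lambda>\<pi>. map \<pi> [0..<n]) ` {\<pi>. \<pi> permutes {..<n}}" by auto
    qed
  qed
  then have "(\<Sum>is\<in>permutations_of_set {..<n}. T (map (\<lambda>i. xs ! i) is)) =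
     (\<Sum>\<pi> | \<pi> permutes {..<n}. T (map (\<lambda>i. xs ! i) (map \<pi> [0..<n])))"
    by (rule sum.reindex_bij_betw[symmetric])
  then show ?thesis unfolding words by (simp add: comp_def)
qed

section \<open>Symmetric powers are spanned by powers\<close>

global_interpretation fun_space: vector_space "fun_scale :: 'f::field \<Rightarrow> ('x \<Rightarrow> 'f) \<Rightarrow> 'x \<Rightarrow> 'f"
  by (rule vector_space_fun_scale)

lemma vector_space_times: "vector_space ((*) :: 'f::field \<Rightarrow> 'f \<Rightarrow> 'f)"
  by unfold_locales (auto simp: algebra_simps)

lemma fun_scale_apply: "fun_scale c p x = c * p x"
  by (simp add: fun_scale_def)

text \<open>Tensors and functionals are functions, but here they are mostly vectors: their sums and multiples have to
stay intact as arguments of linear maps, so pointwise evaluation happens only on demand.\<close>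

declare plus_fun_apply [simp del] zero_fun_apply [simp del]

lemmas fun_apply = plus_fun_apply zero_fun_apply fun_scale_apply sum_fun_apply

locale symmetric_powers = vector_space scale
  for scale :: "'f::field_char_0 \<Rightarrow> 'v::ab_group_add \<Rightarrow> 'v"
begin

lemmas vs = vector_space_axioms

lemma subspace_Sym: "fun_space.subspace (Sym scale n)"
  by (simp add: Sym_def)

lemma symtensor_in_Sym [intro]: "length xs = n \<Longrightarrow> symtensor scale xs \<in> Sym scale n"
  unfolding Sym_def by (auto intro: fun_space.span_base)

lemma symtensor_replicate: "symtensor scale (replicate n v) = tpow scale n v"
proof -
  have "permute_list \<pi> (replicate n v) = replicate n v" if "\<pi> permutes {..<n}" for \<pi>
  proof (rule nth_equalityI)
    fix i assume "i < length (permute_list \<pi> (replicate n v))"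
    then have "i < n" "\<pi> i < n" using permutes_in_image[OF that, of i] by auto
    then show "permute_list \<pi> (replicate n v) ! i = replicate n v ! i"
      using that by (simp add: permute_list_nth)
  qed simp
  then have "(\<Sum>\<pi> | \<pi> permutes {..<n}. tensor scale (permute_list \<pi> (replicate n v)) M)
      = (\<Sum>\<pi> | \<pi> permutes {..<n}. tensor scale (replicate n v) M)" for M
    by (intro sum.cong) auto
  then show ?thesis
    by (simp add: symtensor_def tpow_def fun_eq_iff fun_apply card_permutations[of "{..<n}"])
qed

lemma tpow_in_Sym [intro, simp]: "tpow scale n v \<in> Sym scale n"
  using symtensor_in_Sym[of "replicate n v" n] by (simp add: symtensor_replicate)

text \<open>Expanding the \<open>n\<close>th power of the sum of the \<open>x\<^sub>i\<close> with \<open>i\<close> in \<open>S\<close> gives the sum of the tensors belonging to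
all words with letters in \<open>S\<close>. So polarization applies to the span of the powers.\<close>

lemma symtensor_in_span_tpow:
  assumes "length xs = n"
  shows "symtensor scale xs \<in> fun_space.span (range (tpow scale n))"
proof -
  let ?U = "fun_space.span (range (tpow scale n))"
  let ?T = "\<lambda>is. tensor scale (map (\<lambda>i. xs ! i) is)"
  have "(\<Sum>is | set is = {..<n} \<and> length is = n. ?T is) \<in> ?U"
  proof (rule polarization[OF _ vector_space_fun_scale])
    fix S
    have "(\<Sum>is\<in>words n S. ?T is) = tpow scale n (\<Sum>i\<in>S. xs ! i)"
      using multilinear_expand[OF multilinear_tensor[OF vs, of n], of "\<lambda>i. xs ! i" S]
      by (simp add: tpow_def)
    then show "(\<Sum>is\<in>words n S. ?T is) \<in> ?U" by (auto intro: fun_space.span_base)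
  qed auto
  then have "(\<Sum>\<pi> | \<pi> permutes {..<n}. tensor scale (permute_list \<pi> xs)) \<in> ?U"
    using assms by (simp add: sum_surjective_words permute_list_def)
  then show ?thesis
    unfolding symtensor_def using assms by (auto intro: fun_space.span_scale)
qed

lemma Sym_eq_span_tpow: "Sym scale n = fun_space.span (range (tpow scale n))"
proof
  show "Sym scale n \<subseteq> fun_space.span (range (tpow scale n))"
    unfolding Sym_def by (rule fun_space.span_minimal) (auto intro: symtensor_in_span_tpow)
  show "fun_space.span (range (tpow scale n)) \<subseteq> Sym scale n"
    by (rule fun_space.span_minimal) (auto simp: subspace_Sym)
qed

lemma Sym_subset_Tensor: "Sym scale n \<subseteq> Tensor scale n"
  unfolding Sym_eq_span_tpow Tensor_def
  by (rule fun_space.span_mono) (auto simp: tpow_def intro: exI[of _ "replicate n _"])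

lemma Sym_induct [consumes 1, case_names tpow lincomb]:
  assumes "t \<in> Sym scale n"
    and "\<And>v. P (tpow scale n v)"
    and "\<And>c s t. s \<in> Sym scale n \<Longrightarrow> t \<in> Sym scale n \<Longrightarrow> P s \<Longrightarrow> P t \<Longrightarrow> P (fun_scale c s + t)"
  shows "P t"
proof -
  have "P (fun_scale (-1) (tpow scale n 0) + tpow scale n 0)"
    by (intro assms) auto
  then have "P 0" by (simp add: fun_scale_def plus_fun_def zero_fun_def)
  have "t \<in> fun_space.span (range (tpow scale n))" using assms(1) by (simp add: Sym_eq_span_tpow)
  then have "t \<in> Sym scale n \<and> P t"
  proof (induction rule: fun_space.span_induct_alt)
    case base
    show ?case using \<open>P 0\<close> fun_space.subspace_0[OF subspace_Sym] by (simp add: zero_fun_def)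
  next
    case (step c x y)
    then show ?case
      using fun_space.subspace_add[OF subspace_Sym] fun_space.subspace_scale[OF subspace_Sym]
      by (auto intro!: assms)
  qed
  then show ?thesis by simp
qed

lemma Sym_add: "s \<in> Sym scale n \<Longrightarrow> t \<in> Sym scale n \<Longrightarrow> s + t \<in> Sym scale n"
  by (rule fun_space.subspace_add[OF subspace_Sym])

lemma Sym_scale: "t \<in> Sym scale n \<Longrightarrow> fun_scale c t \<in> Sym scale n"
  by (rule fun_space.subspace_scale[OF subspace_Sym])

lemma Sym_zero: "0 \<in> Sym scale n"
  by (rule fun_space.subspace_0[OF subspace_Sym])

lemma Sym_sum: "(\<And>i. i \<in> I \<Longrightarrow> f i \<in> Sym scale n) \<Longrightarrow> (\<Sum>i\<in>I. f i) \<in> Sym scale n"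
  by (rule fun_space.subspace_sum[OF subspace_Sym])

section \<open>Linear maps on symmetric powers\<close>

lemma lin_maps_in: "L \<in> lin_maps fun_scale U sW W \<Longrightarrow> t \<in> U \<Longrightarrow> L t \<in> W"
  by (auto simp: lin_maps_def)

lemma lin_maps_add:
  "L \<in> lin_maps sU U sW W \<Longrightarrow> s \<in> U \<Longrightarrow> t \<in> U \<Longrightarrow> L (s + t) = L s + L t"
  by (auto simp: lin_maps_def)

lemma lin_maps_scale: "L \<in> lin_maps sU U sW W \<Longrightarrow> t \<in> U \<Longrightarrow> L (sU c t) = sW c (L t)"
  by (auto simp: lin_maps_def)

lemma lin_maps_sum_subspace:
  assumes "L \<in> lin_maps fun_scale U sW W" "vector_space sW" "fun_space.subspace U"
    and "\<And>i. i \<in> I \<Longrightarrow> f i \<in> U"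
  shows "L (\<Sum>i\<in>I. f i) = (\<Sum>i\<in>I. L (f i))"
proof -
  interpret W: vector_space sW by fact
  have "L 0 = 0"
    using lin_maps_scale[OF assms(1) fun_space.subspace_0[OF assms(3)], of 0] by simp
  then show ?thesis
    using assms(4)
    by (induction I rule: infinite_finite_induct)
      (simp_all add: lin_maps_add[OF assms(1)] fun_space.subspace_sum[OF assms(3)])
qed

lemma lin_maps_sum:
  assumes "L \<in> lin_maps fun_scale (Sym scale n) sW W" "vector_space sW"
    and "\<And>i. i \<in> I \<Longrightarrow> f i \<in> Sym scale n"
  shows "L (\<Sum>i\<in>I. f i) = (\<Sum>i\<in>I. L (f i))"
  by (rule lin_maps_sum_subspace[OF assms(1,2) subspace_Sym assms(3)])

lemma lin_maps_zero:
  assumes "L \<in> lin_maps fun_scale (Sym scale n) sW W" "vector_space sW"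
  shows "L 0 = 0"
  using lin_maps_sum[OF assms, of "{}"] by simp

lemma lin_maps_ext:
  assumes "L \<in> lin_maps fun_scale (Sym scale n) sW W" "L' \<in> lin_maps fun_scale (Sym scale n) sW W'"
    and "\<And>v. L (tpow scale n v) = L' (tpow scale n v)"
  shows "L = L'"
proof (rule extensionalityI)
  show "L \<in> extensional (Sym scale n)" "L' \<in> extensional (Sym scale n)"
    using assms(1,2) by (auto simp: lin_maps_def PiE_def)
  fix t assume "t \<in> Sym scale n"
  then show "L t = L' t"
    by (induction rule: Sym_induct)
      (simp_all add: assms(3) lin_maps_add[OF assms(1)] lin_maps_add[OF assms(2)] Sym_scale
        lin_maps_scale[OF assms(1)] lin_maps_scale[OF assms(2)])
qed

lemma lin_maps_restrictI:
  assumes "\<And>s. s \<in> Sym scale n \<Longrightarrow> F s \<in> W"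
    and "\<And>s t. s \<in> Sym scale n \<Longrightarrow> t \<in> Sym scale n \<Longrightarrow> F (s + t) = F s + F t"
    and "\<And>c t. t \<in> Sym scale n \<Longrightarrow> F (fun_scale c t) = sW c (F t)"
  shows "(\<lambda>t\<in>Sym scale n. F t) \<in> lin_maps fun_scale (Sym scale n) sW W"
  using assms by (auto simp: lin_maps_def Sym_add Sym_scale)

section \<open>Homogeneous polynomial maps\<close>

text \<open>By the universal property, these are exactly the maps \<open>v \<mapsto> L (v\<^bsup>\<otimes>n\<^esup>)\<close> with \<open>L\<close> linear on the symmetric
power (\<open>hompoly_lift_exists\<close>, \<open>hompoly_lin_maps\<close>). So the existence of a linear map with prescribed values on powers is reduced
to closure properties of this class.\<close>

definition hompoly :: "('f \<Rightarrow> 'w::ab_group_add \<Rightarrow> 'w) \<Rightarrow> nat \<Rightarrow> ('v \<Rightarrow> 'w) \<Rightarrow> bool" where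
  "hompoly sW n g \<longleftrightarrow> (\<exists>M. multilinear scale sW n M \<and> (\<forall>v. g v = M (replicate n v)))"

lemma hompoly_lift_exists:
  assumes "vector_space sW" "module.subspace sW W" "hompoly sW n g" "\<And>v. g v \<in> W"
  shows "\<exists>L \<in> lin_maps fun_scale (Sym scale n) sW W. \<forall>v. L (tpow scale n v) = g v"
proof -
  interpret W: vector_space sW by fact
  obtain M where M: "multilinear scale sW n M" "\<And>v. g v = M (replicate n v)"
    using assms(3) by (auto simp: hompoly_def)
  obtain L where L: "L \<in> lin_maps fun_scale (Tensor scale n) sW UNIV"
    "\<And>xs. length xs = n \<Longrightarrow> L (tensor scale xs) = M xs"
    using tensor_power_universal[OF assms(1) M(1)] by blast
  have Lg: "L (tpow scale n v) = g v" for v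
    by (simp add: tpow_def L(2) M(2))
  have *: "L t \<in> W" if "t \<in> Sym scale n" for t
    using that
  proof (induction rule: Sym_induct)
    case (tpow v)
    then show ?case by (simp add: Lg assms(4))
  next
    case (lincomb c s t)
    then have "s \<in> Tensor scale n" "t \<in> Tensor scale n" "fun_scale c s \<in> Tensor scale n"
      using Sym_subset_Tensor Sym_scale by blast+
    then show ?case
      using lincomb W.subspace_add[OF assms(2)] W.subspace_scale[OF assms(2)]
      by (simp add: lin_maps_add[OF L(1)] lin_maps_scale[OF L(1)])
  qed
  have "(\<lambda>t\<in>Sym scale n. L t) \<in> lin_maps fun_scale (Sym scale n) sW W"
    using Sym_subset_Tensor by (intro lin_maps_restrictI *)
      (auto intro!: lin_maps_add[OF L(1)] lin_maps_scale[OF L(1)])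
  then show ?thesis using Lg by (intro bexI[of _ "\<lambda>t\<in>Sym scale n. L t"]) auto
qed

text \<open>The description in \<open>sym_lift\<close> is proper: a homogeneous polynomial map lifts, and only one lift exists because powers span.\<close>

lemma sym_lift:
  assumes "vector_space sW" "module.subspace sW W" "hompoly sW n g" "\<And>v. g v \<in> W"
  shows sym_lift_lin_maps: "sym_lift scale n sW W g \<in> lin_maps fun_scale (Sym scale n) sW W" (is ?A)
    and sym_lift_tpow: "sym_lift scale n sW W g (tpow scale n v) = g v" (is ?B)
proof -
  have "\<exists>!L. L \<in> lin_maps fun_scale (Sym scale n) sW W \<and> (\<forall>v. L (tpow scale n v) = g v)"
    using hompoly_lift_exists[OF assms] by (auto intro: lin_maps_ext)
  from theI'[OF this] show ?A ?B by (simp_all add: sym_lift_def)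
qed

lemma multilinear_lin_maps:
  assumes "vector_space sW" "L \<in> lin_maps fun_scale (Sym scale n) sW W"
  shows "multilinear scale sW n (\<lambda>xs. if length xs = n then L (symtensor scale xs) else 0)"
proof -
  have "Vector_Spaces.linear scale sW (\<lambda>y. L (symtensor scale (xs[i := y])))"
    if "length xs = n" "i < n" for xs i
    using multilinear_symtensor[OF vs, of n] that
    by (auto simp: multilinear_def Vector_Spaces.linear_iff assms(1) symtensor_in_Sym
        lin_maps_add[OF assms(2)] lin_maps_scale[OF assms(2)])
  then show ?thesis by (auto simp: multilinear_def)
qed

lemma hompoly_lin_maps:
  assumes "vector_space sW" "L \<in> lin_maps fun_scale (Sym scale n) sW W"
  shows "hompoly sW n (\<lambda>v. L (tpow scale n v))"
  unfolding hompoly_def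
  using multilinear_lin_maps[OF assms] by (auto simp: symtensor_replicate)

lemma hompoly_zero:
  assumes "vector_space sW"
  shows "hompoly sW n (\<lambda>v. 0)"
proof -
  interpret W: vector_space sW by fact
  show ?thesis
    unfolding hompoly_def multilinear_def Vector_Spaces.linear_iff
    using vs assms by (auto intro!: exI[of _ "\<lambda>_. 0"])
qed

lemma hompoly_add: 
  assumes "hompoly sW n g" "hompoly sW n h"
  shows "hompoly sW n (\<lambda>v. g v + h v)"
proof -
  obtain M N where "multilinear scale sW n M" "\<And>v. g v = M (replicate n v)"
    "multilinear scale sW n N" "\<And>v. h v = N (replicate n v)"
    using assms by (auto simp: hompoly_def)
  then show ?thesis unfolding hompoly_def
    by (intro exI[of _ "\<lambda>xs. M xs + N xs"])
      (auto simp: multilinear_def Vector_Spaces.linear_iff vector_space_def module.scale_right_distrib)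
qed

lemma hompoly_sum:
  assumes "vector_space sW" "\<And>i. i \<in> I \<Longrightarrow> hompoly sW n (g i)"
  shows "hompoly sW n (\<lambda>v. \<Sum>i\<in>I. g i v)"
  using assms(2)
  by (induction I rule: infinite_finite_induct) (auto simp: hompoly_zero[OF assms(1)] intro: hompoly_add)

lemma hompoly_const: "vector_space sW \<Longrightarrow> hompoly sW 0 (\<lambda>v. c)"
  unfolding hompoly_def multilinear_def by (intro exI[of _ "\<lambda>xs. if xs = [] then c else 0"]) auto

lemma hompoly_id: "hompoly scale 1 (\<lambda>v. v)"
  unfolding hompoly_def multilinear_def
  by (intro exI[of _ "\<lambda>xs. if length xs = 1 then hd xs else 0"])
    (auto simp: Vector_Spaces.linear_iff vs length_Suc_conv)

lemma hompoly_tpow: "hompoly fun_scale n (tpow scale n)"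
  unfolding hompoly_def using multilinear_tensor[OF vs, of n] by (auto simp: tpow_def)

text \<open>The argument list is cut into consecutive blocks of the prescribed lengths and each block is fed
to its own form. This yields the multilinear form behind a product such as \<open>A\<^sub>1(v) \<odot> \<dots> \<odot> A\<^sub>m(v)\<close>.\<close>

primrec split_args :: "(nat \<times> ('v list \<Rightarrow> 'u)) list \<Rightarrow> 'v list \<Rightarrow> 'u list" where
  "split_args [] xs = []"
| "split_args (p # ps) xs = snd p (take (fst p) xs) # split_args ps (drop (fst p) xs)"

lemma length_split_args [simp]: "length (split_args ps xs) = length ps"
  by (induction ps arbitrary: xs) auto

text \<open>An argument lies in exactly one block, so changing it changes a single value, and does so linearly.\<close>

lemma split_args_update:
  assumes "\<And>p. p \<in> set ps \<Longrightarrow> multilinear scale sU (fst p) (snd p)"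
    and "length xs = sum_list (map fst ps)" "i < length xs"
  shows "\<exists>j<length ps. \<exists>h. Vector_Spaces.linear scale sU h \<and>
    (\<forall>y. split_args ps (xs[i := y]) = (split_args ps xs)[j := h y])"
  using assms
proof (induction ps arbitrary: xs i)
  case Nil
  then show ?case by simp
next
  case (Cons p ps)
  show ?case
  proof (cases "i < fst p")
    case True
    have "Vector_Spaces.linear scale sU (\<lambda>y. snd p ((take (fst p) xs)[i := y]))"
      using Cons.prems True unfolding multilinear_def by auto
    moreover have "split_args (p # ps) (xs[i := y]) =
        (split_args (p # ps) xs)[0 := snd p ((take (fst p) xs)[i := y])]" for y
      using True by (simp add: take_update_swap)
    ultimately show ?thesis by (intro exI[of _ 0]) auto
  next
    case False
    then obtain j h where "j < length ps" "Vector_Spaces.linear scale sU h"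
      "\<And>y. split_args ps ((drop (fst p) xs)[i - fst p := y]) = (split_args ps (drop (fst p) xs))[j := h y]"
      using Cons.IH[of "drop (fst p) xs" "i - fst p"] Cons.prems by (metis (no_types, lifting) add_diff_cancel_left' diff_less_mono fst_conv
          length_drop linorder_not_less list.set_intros(2) list.simps(9) sum_list.Cons)
    then show ?thesis
      using False by (intro exI[of _ "Suc j"]) (auto simp: drop_update_swap)
  qed
qed

lemma hompoly_multilinear_comp:
  assumes "multilinear sU sW (length ps) N"
    and "\<And>p. p \<in> set ps \<Longrightarrow> hompoly sU (fst p) (snd p)"
  shows "hompoly sW (sum_list (map fst ps)) (\<lambda>v. N (map (\<lambda>p. snd p v) ps))"
proof -
  obtain m where m: "\<And>p. p \<in> set ps \<Longrightarrow> multilinear scale sU (fst p) (m p)"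
    "\<And>p v. p \<in> set ps \<Longrightarrow> snd p v = m p (replicate (fst p) v)"
    using assms(2) unfolding hompoly_def by metis
  define qs where "qs = map (\<lambda>p. (fst p, m p)) ps"
  have qs: "length qs = length ps" "map fst qs = map fst ps"
    "\<And>q. q \<in> set qs \<Longrightarrow> multilinear scale sU (fst q) (snd q)"
    using m(1) by (auto simp: qs_def)
  define n where "n = sum_list (map fst ps)"
  have "Vector_Spaces.linear scale sW (\<lambda>y. N (split_args qs (xs[i := y])))"
    if "length xs = n" "i < n" for xs i
  proof -
    have "\<exists>j<length qs. \<exists>h. Vector_Spaces.linear scale sU h \<and>
        (\<forall>y. split_args qs (xs[i := y]) = (split_args qs xs)[j := h y])"
      by (rule split_args_update) (use qs that in \<open>auto simp: n_def\<close>)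
    then obtain j h where jh: "j < length ps" "Vector_Spaces.linear scale sU h"
      "\<And>y. split_args qs (xs[i := y]) = (split_args qs xs)[j := h y]"
      using qs(1) by auto
    have "Vector_Spaces.linear sU sW (\<lambda>y. N ((split_args qs xs)[j := y]))"
      using assms(1) jh(1) qs(1) unfolding multilinear_def by auto
    then show ?thesis using jh(2,3) by (auto simp: Vector_Spaces.linear_iff)
  qed
  then have "multilinear scale sW n (\<lambda>xs. if length xs = n then N (split_args qs xs) else 0)"
    by (auto simp: multilinear_def)
  moreover have "split_args (map (\<lambda>p. (fst p, m p)) rs) (replicate (sum_list (map fst rs)) v) =
      map (\<lambda>p. snd p v) rs" if "set rs \<subseteq> set ps" for rs v
    using that by (induction rs) (auto simp: m(2))
  ultimately show ?thesis
    unfolding hompoly_def n_def[symmetric] 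
    by (intro exI[of _ "\<lambda>xs. if length xs = n then N (split_args qs xs) else 0"])
      (auto simp: qs_def n_def)
qed

lemma hompoly_mult:
  assumes "vector_space sW" "hompoly (*) k g" "hompoly sW l h"
  shows "hompoly sW (k + l) (\<lambda>v. sW (g v) (h v))"
proof -
  interpret W: vector_space sW by fact
  obtain M N where M: "multilinear scale (*) k M" "\<And>v. g v = M (replicate k v)"
    and N: "multilinear scale sW l N" "\<And>v. h v = N (replicate l v)"
    using assms by (auto simp: hompoly_def)
  have "Vector_Spaces.linear scale sW (\<lambda>y. sW (M (take k (xs[i := y]))) (N (drop k (xs[i := y]))))"
    if "length xs = k + l" "i < k + l" for xs i
  proof (cases "i < k")
    case True
    then have "Vector_Spaces.linear scale (*) (\<lambda>y. M ((take k xs)[i := y]))"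
      using M(1) that unfolding multilinear_def by auto
    then show ?thesis using True
      by (auto simp: Vector_Spaces.linear_iff take_update_swap W.scale_left_distrib assms(1))
  next
    case False
    then have "Vector_Spaces.linear scale sW (\<lambda>y. N ((drop k xs)[i - k := y]))"
      using N(1) that unfolding multilinear_def by auto
    then show ?thesis using False
      by (auto simp: Vector_Spaces.linear_iff drop_update_swap W.scale_right_distrib mult.commute)
  qed
  then show ?thesis
    unfolding hompoly_def
    by (intro exI[of _ "\<lambda>xs. if length xs = k + l then sW (M (take k xs)) (N (drop k xs)) else 0"])
      (auto simp: multilinear_def M(2) N(2))
qed

lemma hompoly_scale:
  assumes "vector_space sW" "hompoly sW n g"
  shows "hompoly sW n (\<lambda>v. sW c (g v))"
  using hompoly_mult[OF assms(1) hompoly_const[OF vector_space_times, of c] assms(2)] by simp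

lemma hompoly_diff:
  assumes "vector_space sW" "hompoly sW n g" "hompoly sW n h"
  shows "hompoly sW n (\<lambda>v. g v - h v)"
proof -
  interpret W: vector_space sW by fact
  show ?thesis
    using hompoly_add[OF assms(2) hompoly_scale[OF assms(1,3), of "-1"]] by simp
qed

lemma hompoly_comp_linear:
  assumes "hompoly sW n g" "Vector_Spaces.linear scale scale h"
  shows "hompoly sW n (\<lambda>v. g (h v))"
proof -
  obtain M where M: "multilinear scale sW n M" "\<And>v. g v = M (replicate n v)"
    using assms(1) by (auto simp: hompoly_def)
  have "multilinear scale sW n (\<lambda>xs. M (map h xs))"
    using M(1) assms(2) by (auto simp: multilinear_def map_update Vector_Spaces.linear_iff)
  then show ?thesis using M(2) by (auto simp: hompoly_def)
qed

end

section \<open>The pairing with powers of functionals\<close>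

lemma power_sum_words:
  fixes x :: "'i \<Rightarrow> 'a::comm_semiring_1"
  shows "(\<Sum>i\<in>S. x i) ^ n = (\<Sum>is\<in>words n S. prod_list (map x is))"
proof (induction n)
  case 0
  have "words 0 S = {[]}" by auto
  then show ?case by simp
next
  case (Suc n)
  have "(\<Sum>i\<in>S. x i) ^ Suc n = (\<Sum>i\<in>S. x i * (\<Sum>is\<in>words n S. prod_list (map x is)))"
    by (simp add: Suc.IH sum_distrib_right)
  then show ?case by (simp add: sum_words_Suc sum_distrib_left)
qed

context symmetric_powers
begin

lemma dual_iff: "\<omega> \<in> dual scale \<longleftrightarrow>
    (\<forall>x y. \<omega> (x + y) = \<omega> x + \<omega> y) \<and> (\<forall>c x. \<omega> (scale c x) = c * \<omega> x)"
  by (simp add: dual_def Vector_Spaces.linear_iff vs vector_space_times)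

lemma dual_zero: "0 \<in> dual scale"
  by (simp add: dual_iff fun_apply)

lemma dual_add: "\<omega> \<in> dual scale \<Longrightarrow> \<theta> \<in> dual scale \<Longrightarrow> \<omega> + \<theta> \<in> dual scale"
  by (simp add: dual_iff fun_apply algebra_simps)

lemma dual_scale: "\<omega> \<in> dual scale \<Longrightarrow> fun_scale c \<omega> \<in> dual scale"
  by (simp add: dual_iff fun_apply algebra_simps)

lemma dual_sum: "(\<And>i. i \<in> I \<Longrightarrow> \<omega> i \<in> dual scale) \<Longrightarrow> (\<Sum>i\<in>I. \<omega> i) \<in> dual scale"
  by (induction I rule: infinite_finite_induct) (auto simp: dual_zero intro: dual_add)

lemma dual_apply_sum:
  assumes "\<omega> \<in> dual scale"
  shows "\<omega> (\<Sum>i\<in>I. x i) = (\<Sum>i\<in>I. \<omega> (x i))"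
  using assms by (intro linear_sum_rule[of scale "(*)"]) (simp add: dual_def)

text \<open>Coordinates with respect to a fixed basis of \<open>V\<close>; they supply enough functionals.\<close>

definition coord :: "'v \<Rightarrow> 'v \<Rightarrow> 'f" where
  "coord b v = representation (extend_basis {}) v b"

lemma coord_dual: "coord b \<in> dual scale"
  using independent_extend_basis[OF independent_empty] span_extend_basis[OF independent_empty]
  by (simp add: dual_iff coord_def representation_add representation_scale)

lemma finite_coord: "finite {b. coord b v \<noteq> 0}"
  unfolding coord_def by (rule finite_representation)

lemma sum_coord:
  assumes "finite E" "{b. coord b v \<noteq> 0} \<subseteq> E"
  shows "(\<Sum>b\<in>E. scale (coord b v) b) = v"
proof -
  have "(\<Sum>b\<in>E. scale (coord b v) b) = (\<Sum>b | coord b v \<noteq> 0. scale (coord b v) b)"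
    using assms by (intro sum.mono_neutral_right) auto
  also have "\<dots> = v"
    unfolding coord_def
    using independent_extend_basis[OF independent_empty] span_extend_basis[OF independent_empty]
    by (simp add: sum_nonzero_representation_eq)
  finally show ?thesis .
qed

lemma dual_separates:
  assumes "\<And>\<omega>. \<omega> \<in> dual scale \<Longrightarrow> \<omega> v = \<omega> w"
  shows "v = w"
proof -
  have eq: "coord b v = coord b w" for b by (rule assms[OF coord_dual])
  have "v = (\<Sum>b | coord b v \<noteq> 0. scale (coord b v) b)"
    by (rule sum_coord[OF finite_coord order_refl, symmetric])
  also have "\<dots> = (\<Sum>b | coord b w \<noteq> 0. scale (coord b w) b)"
    by (simp only: eq)
  also have "\<dots> = w" by (rule sum_coord[OF finite_coord order_refl])
  finally show ?thesis .
qed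

lemma dual_pair_add: "dual_pair n \<omega> (s + t) = dual_pair n \<omega> s + dual_pair n \<omega> t"
  and dual_pair_scale: "dual_pair n \<omega> (fun_scale c t) = c * dual_pair n \<omega> t"
  and dual_pair_zero: "dual_pair n \<omega> 0 = 0"
  and dual_pair_sum: "dual_pair n \<omega> (\<Sum>i\<in>I. f i) = (\<Sum>i\<in>I. dual_pair n \<omega> (f i))"
  by (simp_all add: dual_pair_def fun_apply)

lemma dual_pair_tpow:
  assumes "\<omega> \<in> dual scale"
  shows "dual_pair n \<omega> (tpow scale n v) = \<omega> v ^ n"
  using dual_pair_symtensor[OF assms, of "replicate n v"] by (simp add: symtensor_replicate)

lemma dual_pair_fun_scale:
  assumes "\<omega> \<in> dual scale" "t \<in> Sym scale n"
  shows "dual_pair n (fun_scale c \<omega>) t = c ^ n * dual_pair n \<omega> t"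
  using assms(2)
proof (induction rule: Sym_induct)
  case (tpow v)
  show ?case
    by (simp add: dual_pair_tpow assms(1) dual_scale) (simp add: fun_scale_apply power_mult_distrib)
next
  case (lincomb a s t)
  then show ?case by (simp add: dual_pair_add dual_pair_scale algebra_simps)
qed

text \<open>Write \<open>f\<close> as a linear combination of powers \<open>w\<^bsup>\<otimes>n\<^esup>\<close>. Only finitely many coordinates occur in it, and any
\<open>n\<close>-linear form, evaluated at these vectors, is a combination of products of \<open>n\<close> coordinate functionals.
The value of \<open>f\<close> at such a product is symmetric in the factors, hence up to \<open>n!\<close> it is
obtained by polarization from the values of \<open>f\<close> at powers of functionals, which vanish.\<close>

lemma dual_pair_nondegenerate:
  assumes f: "f \<in> Sym scale n" and zero: "\<And>\<omega>. \<omega> \<in> dual scale \<Longrightarrow> dual_pair n \<omega> f = 0"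
  shows "f = 0"
proof -
  have "f \<in> fun_space.span (range (tpow scale n))" using f by (simp add: Sym_eq_span_tpow)
  then obtain t r where t: "finite t" "t \<subseteq> range (tpow scale n)" and f_t: "f = (\<Sum>a\<in>t. fun_scale (r a) a)"
    by (auto simp: fun_space.span_explicit)
  then obtain w where w: "\<And>a. a \<in> t \<Longrightarrow> a = tpow scale n (w a)"
    by (metis image_iff subsetD)
  have f_eq: "f = (\<Sum>a\<in>t. fun_scale (r a) (tpow scale n (w a)))"
    unfolding f_t using w by (intro sum.cong) auto
  \<comment> \<open>The value of \<open>f\<close> at the product of the coordinate functionals of the basis vectors \<open>bs\<close>.\<close>
  define Z where "Z = (\<lambda>bs. \<Sum>a\<in>t. r a * prod_list (map (\<lambda>b. coord b (w a)) bs))"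
  have Z0: "Z bs = 0" if "length bs = n" for bs
  proof -
    interpret F: vector_space "(*) :: 'f \<Rightarrow> 'f \<Rightarrow> 'f" by (rule vector_space_times)
    have "(\<Sum>is | set is = {..<n} \<and> length is = n. Z (map (\<lambda>i. bs ! i) is)) \<in> {0}"
    proof (rule polarization[OF _ vector_space_times])
      fix S
      let ?\<omega> = "\<Sum>i\<in>S. coord (bs ! i)"
      have "(\<Sum>is\<in>words n S. Z (map (\<lambda>i. bs ! i) is)) =
          (\<Sum>a\<in>t. r a * (\<Sum>i\<in>S. coord (bs ! i) (w a)) ^ n)"
        unfolding Z_def power_sum_words sum_distrib_left by (subst sum.swap) (simp add: comp_def)
      also have "\<dots> = dual_pair n ?\<omega> f"
        unfolding f_eq
        by (simp add: dual_pair_sum dual_pair_scale dual_pair_tpow dual_sum coord_dual fun_apply)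
      also have "\<dots> = 0" by (intro zero dual_sum coord_dual)
      finally show "(\<Sum>is\<in>words n S. Z (map (\<lambda>i. bs ! i) is)) \<in> {0}" by simp
    qed (auto simp: F.subspace_single_0)
    then have "(\<Sum>\<pi> | \<pi> permutes {..<n}. Z (permute_list \<pi> bs)) = 0"
      using that by (simp add: sum_surjective_words permute_list_def)
    moreover have "Z (permute_list \<pi> bs) = Z bs" if "\<pi> permutes {..<n}" for \<pi>
    proof -
      have "mset (permute_list \<pi> bs) = mset bs" using that \<open>length bs = n\<close> by simp
      then have "prod_list (map (\<lambda>b. coord b v) (permute_list \<pi> bs)) = prod_list (map (\<lambda>b. coord b v) bs)" for v
        by (metis mset_map prod_mset_prod_list)
      then show ?thesis by (simp add: Z_def)
    qed
    ultimately have "(\<Sum>\<pi> | \<pi> permutes {..<n}. Z bs) = 0" by simp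
    then show ?thesis by (simp add: card_permutations[of "{..<n}"])
  qed
  \<comment> \<open>The finitely many basis vectors that occur in the vectors \<open>w a\<close>.\<close>
  define E where "E = (\<Union>a\<in>t. {b. coord b (w a) \<noteq> 0})"
  have E: "finite E" "\<And>a. a \<in> t \<Longrightarrow> {b. coord b (w a) \<noteq> 0} \<subseteq> E"
    using t(1) finite_coord by (auto simp: E_def)
  have "f M = 0" for M
  proof (cases "multilinear scale (*) n M")
    case True
    have "f M = (\<Sum>a\<in>t. r a * M (replicate n (\<Sum>b\<in>E. scale (coord b (w a)) b)))"
      unfolding f_eq using True E
      by (simp add: fun_apply tpow_def tensor_def sum_coord)
    also have "\<dots> = (\<Sum>a\<in>t. r a * (\<Sum>bs\<in>words n E. prod_list (map (\<lambda>b. coord b (w a)) bs) * M bs))"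
      by (simp add: multilinear_expand_scaled[OF True vector_space_times])
    also have "\<dots> = (\<Sum>bs\<in>words n E. Z bs * M bs)"
      unfolding Z_def sum_distrib_left sum_distrib_right
      by (subst sum.swap) (simp add: mult.assoc)
    also have "\<dots> = 0" by (simp add: Z0)
    finally show ?thesis .
  next
    case False
    then show ?thesis unfolding f_eq by (simp add: fun_apply tpow_def tensor_def)
  qed
  then show ?thesis by (simp add: fun_eq_iff fun_apply)
qed

lemma monom_poly_apply: "\<omega> \<in> dual scale \<Longrightarrow> monom_poly scale n f \<omega> = dual_pair n \<omega> f"
  by (simp add: monom_poly_def)

text \<open>Along the line \<open>c \<mapsto> c \<omega>\<close> the component of degree \<open>k\<close> is multiplied by \<open>c\<^bsup>k\<^esup>\<close>, so the components can be
separated before nondegeneracy is applied to each.\<close>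

lemma monom_poly_sum_eq_0:
  assumes f: "\<And>k. k \<le> n \<Longrightarrow> f k \<in> Sym scale k"
    and zero: "(\<Sum>k\<le>n. monom_poly scale k (f k)) = 0" and "k \<le> n"
  shows "f k = 0"
proof (rule dual_pair_nondegenerate)
  show "f k \<in> Sym scale k" using f \<open>k \<le> n\<close> by blast
  fix \<omega> assume \<omega>: "\<omega> \<in> dual scale"
  have "(\<Sum>k\<le>n. dual_pair k \<omega> (f k) * c ^ k) = (\<Sum>k\<le>n. monom_poly scale k (f k)) (fun_scale c \<omega>)" for c
    using \<omega> f by (simp add: fun_apply monom_poly_apply dual_scale dual_pair_fun_scale mult.commute)
  then have "(\<Sum>k\<le>n. dual_pair k \<omega> (f k) * c ^ k) = 0" for c
    by (simp add: zero fun_apply)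
  then show "dual_pair k \<omega> (f k) = 0"
    by (rule poly_fun_zero_imp_coeffs_zero[OF _ \<open>k \<le> n\<close>])
qed

end

section \<open>Exponentials of formal power series\<close>

definition fps_expo :: "'f::field_char_0 fps \<Rightarrow> 'f fps" where
  "fps_expo c = fps_exp 1 oo c"

lemma fps_expo_nth: "fps_nth (fps_expo c) n = (\<Sum>k\<le>n. fps_nth (c ^ k) n / fact k)"
  by (simp add: fps_expo_def fps_compose_nth atLeast0AtMost)

lemma fps_expo_nth_0 [simp]: "fps_nth (fps_expo c) 0 = 1"
  by (simp add: fps_expo_def)

lemma fps_expo_0 [simp]: "fps_expo 0 = 1"
  by (simp add: fps_expo_def)

lemma fps_expo_neq_0 [simp]: "fps_expo c \<noteq> 0"
  by (metis fps_expo_nth_0 fps_zero_nth zero_neq_one)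

lemma fps_deriv_expo: "fps_nth c 0 = 0 \<Longrightarrow> fps_deriv (fps_expo c) = fps_deriv c * fps_expo c"
  by (simp add: fps_expo_def fps_compose_deriv mult.commute)

text \<open>The equation determines each coefficient from the previous ones. It is used to identify
the exponential of a sum with the product of the exponentials.\<close>

lemma fps_linear_ODE_unique:
  fixes y z :: "'f::field_char_0 fps"
  assumes "fps_deriv y = g * y" "fps_deriv z = g * z" "fps_nth y 0 = fps_nth z 0"
  shows "y = z"
proof (rule fps_ext)
  fix n show "fps_nth y n = fps_nth z n"
  proof (induction n rule: less_induct)
    case (less n)
    show ?case
    proof (cases n)
      case 0
      then show ?thesis using assms(3) by simp
    next
      case (Suc m)
      have "of_nat (Suc m) * fps_nth y (Suc m) = (\<Sum>i=0..m. fps_nth g i * fps_nth y (m - i))"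
        using arg_cong[OF assms(1), of "\<lambda>f. fps_nth f m"] by (simp add: fps_mult_nth)
      also have "\<dots> = (\<Sum>i=0..m. fps_nth g i * fps_nth z (m - i))"
        using less Suc by (intro sum.cong) auto
      also have "\<dots> = of_nat (Suc m) * fps_nth z (Suc m)"
        using arg_cong[OF assms(2), of "\<lambda>f. fps_nth f m"] by (simp add: fps_mult_nth)
      finally show ?thesis using Suc by (simp del: of_nat_Suc)
    qed
  qed
qed

lemma fps_expo_add:
  assumes "fps_nth c 0 = 0" "fps_nth d 0 = 0"
  shows "fps_expo (c + d) = fps_expo c * fps_expo d"
  by (rule fps_linear_ODE_unique[of _ "fps_deriv c + fps_deriv d"])
    (simp_all add: assms fps_deriv_expo algebra_simps)

lemma fps_expo_inj:
  assumes "fps_nth c 0 = 0" "fps_nth d 0 = 0" "fps_expo c = fps_expo d"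
  shows "c = d"
proof -
  have "fps_deriv c * fps_expo c = fps_deriv d * fps_expo c"
    using fps_deriv_expo[OF assms(1)] fps_deriv_expo[OF assms(2)] assms(3) by simp
  then have "fps_deriv c = fps_deriv d" by simp
  then show ?thesis using assms(1,2) by (simp add: fps_deriv_eq_iff)
qed

section \<open>Scalar tensor power series as families of formal power series\<close>

context symmetric_powers
begin

lemma tseriesD: "A \<in> tseries scale sW \<Longrightarrow> A n \<in> lin_maps fun_scale (Sym scale n) sW UNIV"
  by (simp add: tseries_def)

lemma tseries_ext:
  assumes "A \<in> tseries scale sW" "B \<in> tseries scale sW"
    and "\<And>n v. A n (tpow scale n v) = B n (tpow scale n v)"
  shows "A = B"
  using assms by (intro ext[of A B] lin_maps_ext[OF tseriesD tseriesD])

lemma subspace_UNIV_of: "vector_space sW \<Longrightarrow> module.subspace sW UNIV"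
  by (simp add: module.subspace_UNIV module_iff_vector_space)

lemmas sym_lift_UNIV = sym_lift_lin_maps[OF _ subspace_UNIV_of _ UNIV_I]
lemmas sym_lift_UNIV_tpow = sym_lift_tpow[OF _ subspace_UNIV_of _ UNIV_I]

text \<open>The series \<open>A\<close> restricted to the line through \<open>v\<close>, that is \<open>A(s v)\<close> as a formal power series in \<open>s\<close>. Since
powers span, \<open>A\<close> can be recovered from all these restrictions (\<open>ev_eqI\<close>), and all operations on
scalar series except composition become those of ordinary formal power series.\<close>

definition ev :: "('f, 'v, 'f) tseries \<Rightarrow> 'v \<Rightarrow> 'f fps" where
  "ev A v = Abs_fps (\<lambda>n. A n (tpow scale n v))"

lemma ev_nth [simp]: "fps_nth (ev A v) n = A n (tpow scale n v)"
  by (simp add: ev_def)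

lemma ev_eqI:
  assumes "A \<in> tseries scale (*)" "B \<in> tseries scale (*)" "\<And>v. ev A v = ev B v"
  shows "A = B"
proof (rule tseries_ext[OF assms(1,2)])
  fix n v show "A n (tpow scale n v) = B n (tpow scale n v)"
    using arg_cong[OF assms(3)[of v], of "\<lambda>f. fps_nth f n"] by simp
qed

lemma odot_fun:
  assumes "\<phi> \<in> lin_maps fun_scale (Sym scale k) (*) UNIV" "\<psi> \<in> lin_maps fun_scale (Sym scale l) (*) UNIV"
  shows odot_fun_lin_maps: "odot_fun scale k l \<phi> \<psi> \<in> lin_maps fun_scale (Sym scale (k + l)) (*) UNIV"
    and odot_fun_tpow: "odot_fun scale k l \<phi> \<psi> (tpow scale (k + l) v) =
      \<phi> (tpow scale k v) * \<psi> (tpow scale l v)"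
proof -
  have "hompoly (*) (k + l) (\<lambda>v. \<phi> (tpow scale k v) * \<psi> (tpow scale l v))"
    by (intro hompoly_mult vector_space_times hompoly_lin_maps[OF vector_space_times assms(1)]
      hompoly_lin_maps[OF vector_space_times assms(2)])
  then show "odot_fun scale k l \<phi> \<psi> \<in> lin_maps fun_scale (Sym scale (k + l)) (*) UNIV"
    and "odot_fun scale k l \<phi> \<psi> (tpow scale (k + l) v) = \<phi> (tpow scale k v) * \<psi> (tpow scale l v)"
    unfolding odot_fun_def by (simp_all add: sym_lift_UNIV sym_lift_UNIV_tpow vector_space_times)
qed

lemma lin_maps_sum_closed:
  assumes "vector_space sW" "\<And>i. i \<in> I \<Longrightarrow> F i \<in> lin_maps fun_scale (Sym scale n) sW UNIV"
  shows "(\<lambda>t\<in>Sym scale n. \<Sum>i\<in>I. F i t) \<in> lin_maps fun_scale (Sym scale n) sW UNIV"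
proof -
  interpret W: vector_space sW by fact
  show ?thesis
    using assms(2) by (intro lin_maps_restrictI)
      (auto simp: lin_maps_add[of _ fun_scale "Sym scale n" sW UNIV] lin_maps_scale[of _ fun_scale "Sym scale n" sW UNIV]
        sum.distrib W.scale_sum_right)
qed

lemma series_mult_tseries:
  assumes "A \<in> tseries scale (*)" "B \<in> tseries scale (*)"
  shows "series_mult scale A B \<in> tseries scale (*)"
  unfolding tseries_def series_mult_def
  using odot_fun_lin_maps[OF tseriesD[OF assms(1)] tseriesD[OF assms(2)]]
  by (auto intro!: lin_maps_sum_closed vector_space_times) (metis le_add_diff_inverse)

lemma ev_series_mult:
  assumes "A \<in> tseries scale (*)" "B \<in> tseries scale (*)"
  shows "ev (series_mult scale A B) v = ev A v * ev B v"
proof (rule fps_ext)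
  fix n
  have "odot_fun scale k (n - k) (A k) (B (n - k)) (tpow scale n v) =
      A k (tpow scale k v) * B (n - k) (tpow scale (n - k) v)" if "k \<le> n" for k
    using odot_fun_tpow[OF tseriesD[OF assms(1)] tseriesD[OF assms(2)], of k "n - k" v] that by simp
  then show "fps_nth (ev (series_mult scale A B) v) n = fps_nth (ev A v * ev B v) n"
    by (simp add: series_mult_def fps_mult_nth atLeast0AtMost)
qed

lemma hompoly_delta:
  assumes "vector_space sW" "hompoly sW m g"
  shows "hompoly sW n (\<lambda>v. if n = m then g v else 0)"
  using assms by (cases "n = m") (simp_all add: hompoly_zero)

lemma series_one_tseries: "series_one scale \<in> tseries scale (*)"
  unfolding tseries_def series_one_def
  by (auto intro!: sym_lift_UNIV vector_space_times hompoly_zero hompoly_const)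

lemma ev_series_one: "ev (series_one scale) v = 1"
proof (rule fps_ext)
  fix n
  have "hompoly (*) n (\<lambda>v. if n = 0 then 1 else 0 :: 'f)"
    by (intro hompoly_delta hompoly_const vector_space_times)
  then show "fps_nth (ev (series_one scale) v) n = fps_nth 1 n"
    by (simp add: series_one_def sym_lift_UNIV_tpow vector_space_times)
qed

lemma series_pow_tseries:
  "C \<in> tseries scale (*) \<Longrightarrow> series_pow scale C k \<in> tseries scale (*)"
  by (induction k) (simp_all add: series_one_tseries series_mult_tseries)

lemma ev_series_pow: "C \<in> tseries scale (*) \<Longrightarrow> ev (series_pow scale C k) v = ev C v ^ k"
  by (induction k) (simp_all add: ev_series_one ev_series_mult series_pow_tseries)

lemma series_exp_tseries:
  assumes "C \<in> tseries scale (*)"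
  shows "series_exp scale C \<in> tseries scale (*)"
proof -
  have "(\<lambda>t\<in>Sym scale n. \<Sum>k\<le>n. series_pow scale C k n t / of_nat (fact k))
      \<in> lin_maps fun_scale (Sym scale n) (*) UNIV" for n
    by (intro lin_maps_restrictI)
      (simp_all add: lin_maps_add[OF tseriesD[OF series_pow_tseries[OF assms]]]
        lin_maps_scale[OF tseriesD[OF series_pow_tseries[OF assms]]]
        add_divide_distrib sum.distrib sum_distrib_left)
  then show ?thesis by (simp add: tseries_def series_exp_def)
qed

lemma ev_series_exp:
  assumes "C \<in> tseries scale (*)"
  shows "ev (series_exp scale C) v = fps_expo (ev C v)"
  by (rule fps_ext) (simp add: series_exp_def fps_expo_nth flip: ev_series_pow[OF assms])

lemma series_dual_pair_tseries:
  assumes "\<omega> \<in> dual scale" "B \<in> tseries scale scale"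
  shows "series_dual_pair scale \<omega> B \<in> tseries scale (*)"
  using assms(1) unfolding tseries_def series_dual_pair_def
  by (auto intro!: lin_maps_restrictI simp: dual_iff lin_maps_add[OF tseriesD[OF assms(2)]]
      lin_maps_scale[OF tseriesD[OF assms(2)]])

lemma series_dual_pair_tpow [simp]:
  "series_dual_pair scale \<omega> B n (tpow scale n v) = \<omega> (B n (tpow scale n v))"
  by (simp add: series_dual_pair_def)

lemma series_id_tseries: "series_id scale \<in> tseries scale scale"
  unfolding tseries_def series_id_def
  using hompoly_delta[OF vs hompoly_id] by (auto intro!: sym_lift_UNIV vs)

lemma series_id_tpow: "series_id scale n (tpow scale n v) = (if n = 1 then v else 0)"
proof -
  have "hompoly scale n (\<lambda>v. if n = 1 then v else 0)"
    by (intro hompoly_delta hompoly_id vs)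
  then show ?thesis by (simp add: series_id_def sym_lift_UNIV_tpow vs)
qed

end

section \<open>Composition\<close>

abbreviation comps :: "nat \<Rightarrow> nat \<Rightarrow> nat list set" where
  "comps m n \<equiv> {is. length is = m \<and> (\<forall>i \<in> set is. i \<ge> 1) \<and> sum_list is = n}"

lemma finite_comps [simp]: "finite (comps m n)"
proof (rule finite_subset)
  show "comps m n \<subseteq> words m {..n}"
    by (auto intro: member_le_sum_list)
qed (simp add: finite_lists_length_eq)

lemma length_le_sum_list: "(\<forall>i \<in> set is. i \<ge> 1) \<Longrightarrow> length is \<le> sum_list (is :: nat list)"
  by (induction "is") auto

lemma comps_empty: "n < m \<Longrightarrow> comps m n = {}"
  using length_le_sum_list by fastforce

lemma comps_0: "comps 0 n = (if n = 0 then {[]} else {})"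
  by auto

text \<open>The only such composition has all parts equal to \<open>1\<close>; it produces the leading term of every triangular system below.\<close>

lemma comps_self: "comps n n = {replicate n 1}"
proof (intro equalityI subsetI)
  fix js assume "js \<in> comps n n"
  then have "length js = n" "\<forall>i\<in>set js. i \<ge> 1" "sum_list js = length js" by auto
  then show "js \<in> {replicate n 1}"
  proof (induction js arbitrary: n)
    case (Cons j js)
    have "length js \<le> sum_list js" using Cons.prems length_le_sum_list by auto
    then have "j = 1" "sum_list js = length js" using Cons.prems by auto
    then show ?case using Cons.IH[of "length js"] Cons.prems by auto
  qed auto
qed (auto simp: sum_list_replicate)

context symmetric_powers
begin

lemma odot_ops:
  assumes "B \<in> tseries scale scale" "length is = m" "sum_list is = n"
  shows odot_ops_lin_maps: "odot_ops scale (map (\<lambda>i. (i, B i)) is) \<in>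
      lin_maps fun_scale (Sym scale n) fun_scale (Sym scale m)"
    and odot_ops_tpow: "odot_ops scale (map (\<lambda>i. (i, B i)) is) (tpow scale n v) =
      symtensor scale (map (\<lambda>i. B i (tpow scale i v)) is)"
proof -
  let ?N = "\<lambda>xs. if length xs = m then symtensor scale xs else 0"
  have "hompoly fun_scale (sum_list (map fst (map (\<lambda>i. (i, \<lambda>v. B i (tpow scale i v))) is)))
      (\<lambda>v. ?N (map (\<lambda>p. snd p v) (map (\<lambda>i. (i, \<lambda>v. B i (tpow scale i v))) is)))"
    using multilinear_symtensor[OF vs, of m] assms(2)
    by (intro hompoly_multilinear_comp[where sU = scale])
      (auto intro!: hompoly_lin_maps[OF vs tseriesD[OF assms(1)]])
  then have h: "hompoly fun_scale n (\<lambda>v. symtensor scale (map (\<lambda>i. B i (tpow scale i v)) is))"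
    using assms(2,3) by (simp add: comp_def)
  show "odot_ops scale (map (\<lambda>i. (i, B i)) is) \<in> lin_maps fun_scale (Sym scale n) fun_scale (Sym scale m)"
    and "odot_ops scale (map (\<lambda>i. (i, B i)) is) (tpow scale n v) =
      symtensor scale (map (\<lambda>i. B i (tpow scale i v)) is)"
    using sym_lift_lin_maps[OF vector_space_fun_scale subspace_Sym h, of m]
      sym_lift_tpow[OF vector_space_fun_scale subspace_Sym h, of m] assms(2,3)
    by (simp_all add: odot_ops_def comp_def symtensor_in_Sym)
qed

text \<open>The contribution of \<open>A\<^sub>m\<close> to the coefficient of \<open>s\<^bsup>n\<^esup>\<close> when the curve \<open>b\<^sub>1 s + b\<^sub>2 s\<^bsup>2\<^esup> + \<dots>\<close> is substituted
into \<open>A\<close>. For the curve with \<open>b\<^sub>i = B\<^sub>i v\<^bsup>\<otimes>i\<^esup>\<close> these are the terms of the composition with \<open>B\<close>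
(\<open>series_comp_tpow\<close>).\<close>

definition comp_coeff :: "('f, 'v, 'w::ab_group_add) tseries \<Rightarrow> (nat \<Rightarrow> 'v) \<Rightarrow> nat \<Rightarrow> nat \<Rightarrow> 'w" where
  "comp_coeff A b m n = (\<Sum>is\<in>comps m n. A m (symtensor scale (map b is)))"

lemma comp_coeff_0: "comp_coeff A b 0 n = (if n = 0 then A 0 (symtensor scale []) else 0)"
  unfolding comp_coeff_def comps_0 by simp

lemma comp_coeff_eq_0: "n < m \<Longrightarrow> comp_coeff A b m n = 0"
  unfolding comp_coeff_def by (subst comps_empty) auto

lemma series_comp_lin_maps:
  assumes "vector_space sW" "A \<in> tseries scale sW" "B \<in> tseries scale scale"
  shows "(\<lambda>t\<in>Sym scale n. A m (\<Sum>is\<in>comps m n. odot_ops scale (map (\<lambda>i. (i, B i)) is) t))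
    \<in> lin_maps fun_scale (Sym scale n) sW UNIV"
proof (rule lin_maps_restrictI)
  note o = odot_ops_lin_maps[OF assms(3), of _ m n]
  have in_Sym: "(\<Sum>is\<in>comps m n. odot_ops scale (map (\<lambda>i. (i, B i)) is) t) \<in> Sym scale m"
    if "t \<in> Sym scale n" for t
    by (rule Sym_sum, rule lin_maps_in[OF o that]) auto
  show "A m (\<Sum>is\<in>comps m n. odot_ops scale (map (\<lambda>i. (i, B i)) is) (s + t)) =
      A m (\<Sum>is\<in>comps m n. odot_ops scale (map (\<lambda>i. (i, B i)) is) s) +
      A m (\<Sum>is\<in>comps m n. odot_ops scale (map (\<lambda>i. (i, B i)) is) t)"
    if "s \<in> Sym scale n" "t \<in> Sym scale n" for s t
  proof -
    have "(\<Sum>is\<in>comps m n. odot_ops scale (map (\<lambda>i. (i, B i)) is) (s + t)) =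
      (\<Sum>is\<in>comps m n. odot_ops scale (map (\<lambda>i. (i, B i)) is) s) +
      (\<Sum>is\<in>comps m n. odot_ops scale (map (\<lambda>i. (i, B i)) is) t)"
      unfolding sum.distrib[symmetric] using that by (intro sum.cong) (auto intro: lin_maps_add[OF o])
    then show ?thesis using lin_maps_add[OF tseriesD[OF assms(2)] in_Sym in_Sym, OF that] by simp
  qed
  show "A m (\<Sum>is\<in>comps m n. odot_ops scale (map (\<lambda>i. (i, B i)) is) (fun_scale c t)) =
      sW c (A m (\<Sum>is\<in>comps m n. odot_ops scale (map (\<lambda>i. (i, B i)) is) t))"
    if "t \<in> Sym scale n" for c t
  proof -
    have "(\<Sum>is\<in>comps m n. odot_ops scale (map (\<lambda>i. (i, B i)) is) (fun_scale c t)) =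
      fun_scale c (\<Sum>is\<in>comps m n. odot_ops scale (map (\<lambda>i. (i, B i)) is) t)"
      unfolding fun_space.scale_sum_right using that
      by (intro sum.cong) (auto intro: lin_maps_scale[OF o])
    then show ?thesis using lin_maps_scale[OF tseriesD[OF assms(2)] in_Sym, OF that] by simp
  qed
qed simp

lemma series_comp_tseries:
  assumes "vector_space sW" "A \<in> tseries scale sW" "B \<in> tseries scale scale"
  shows "series_comp scale A B \<in> tseries scale sW"
proof -
  have "series_comp scale A B n \<in> lin_maps fun_scale (Sym scale n) sW UNIV" for n
  proof (cases "n = 0")
    case True
    then show ?thesis using tseriesD[OF assms(2), of 0] by (simp add: series_comp_def)
  next
    case False
    let ?F = "\<lambda>m. (\<lambda>t\<in>Sym scale n. A m (\<Sum>is\<in>comps m n. odot_ops scale (map (\<lambda>i. (i, B i)) is) t))"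
    have "(\<lambda>t\<in>Sym scale n. \<Sum>m = 1..n. ?F m t) \<in> lin_maps fun_scale (Sym scale n) sW UNIV"
      by (rule lin_maps_sum_closed[OF assms(1) series_comp_lin_maps[OF assms]])
    moreover have "series_comp scale A B n = (\<lambda>t\<in>Sym scale n. \<Sum>m = 1..n. ?F m t)"
      unfolding series_comp_def using False by (auto intro!: restrict_ext)
    ultimately show ?thesis by simp
  qed
  then show ?thesis by (simp add: tseries_def)
qed

text \<open>The summand \<open>m = 0\<close> may be included: it vanishes in positive degree and is the whole value in degree zero.\<close>

lemma series_comp_tpow:
  assumes "vector_space sW" "A \<in> tseries scale sW" "B \<in> tseries scale scale"
  shows "series_comp scale A B n (tpow scale n v) =
    (\<Sum>m\<le>n. comp_coeff A (\<lambda>i. B i (tpow scale i v)) m n)"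
proof (cases "n = 0")
  case True
  then show ?thesis
    by (simp add: series_comp_def comp_coeff_0 flip: symtensor_replicate)
next
  case False
  have "A m (\<Sum>is\<in>comps m n. odot_ops scale (map (\<lambda>i. (i, B i)) is) (tpow scale n v)) =
      comp_coeff A (\<lambda>i. B i (tpow scale i v)) m n" for m
    unfolding comp_coeff_def
    by (subst lin_maps_sum[OF tseriesD[OF assms(2)] assms(1)])
      (auto simp: odot_ops_tpow[OF assms(3)] symtensor_in_Sym)
  moreover have "(\<Sum>m\<le>n. comp_coeff A (\<lambda>i. B i (tpow scale i v)) m n) =
      (\<Sum>m = 1..n. comp_coeff A (\<lambda>i. B i (tpow scale i v)) m n)"
    using False by (intro sum.mono_neutral_right) (auto simp: comp_coeff_0 not_less_eq_eq)
  ultimately show ?thesis using False by (simp add: series_comp_def)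
qed

section \<open>Composition is multiplicative\<close>

definition comp_fps :: "('f, 'v, 'f) tseries \<Rightarrow> (nat \<Rightarrow> 'v) \<Rightarrow> nat \<Rightarrow> 'f fps" where
  "comp_fps A b m = Abs_fps (comp_coeff A b m)"

lemma comp_fps_nth [simp]: "fps_nth (comp_fps A b m) n = comp_coeff A b m n"
  by (simp add: comp_fps_def)

text \<open>The curve truncated at degree \<open>N\<close>, substituted into \<open>A\<^sub>m\<close>, as a polynomial in the curve parameter. Up to degree \<open>N\<close> the
truncation does not affect the coefficients (\<open>coeff_subst_poly\<close>).\<close>

definition subst_poly :: "('f, 'v, 'f) tseries \<Rightarrow> (nat \<Rightarrow> 'v) \<Rightarrow> nat \<Rightarrow> nat \<Rightarrow> 'f poly" where
  "subst_poly A b N m =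
     (\<Sum>is\<in>words m {1..N}. Polynomial.monom (A m (symtensor scale (map b is))) (sum_list is))"

lemma poly_subst_poly:
  assumes "A \<in> tseries scale (*)"
  shows "poly (subst_poly A b N m) s = A m (tpow scale m (\<Sum>i = 1..N. scale (s ^ i) (b i)))"
proof -
  let ?M = "\<lambda>xs. if length xs = m then A m (symtensor scale xs) else 0"
  have "A m (tpow scale m (\<Sum>i = 1..N. scale (s ^ i) (b i))) =
      ?M (replicate m (\<Sum>i = 1..N. scale (s ^ i) (b i)))"
    by (simp add: symtensor_replicate)
  also have "\<dots> = (\<Sum>is\<in>words m {1..N}. prod_list (map (\<lambda>i. s ^ i) is) * ?M (map b is))"
    by (rule multilinear_expand_scaled[OF multilinear_lin_maps[OF vector_space_times tseriesD[OF assms]]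
          vector_space_times])
  also have "\<dots> = poly (subst_poly A b N m) s"
    unfolding subst_poly_def poly_sum by (intro sum.cong) (auto simp: poly_monom prod_list_power)
  finally show ?thesis ..
qed

lemma coeff_subst_poly:
  assumes "n \<le> N"
  shows "poly.coeff (subst_poly A b N m) n = comp_coeff A b m n"
proof -
  have "poly.coeff (subst_poly A b N m) n =
      (\<Sum>is\<in>words m {1..N}. if sum_list is = n then A m (symtensor scale (map b is)) else 0)"
    by (simp add: subst_poly_def Polynomial.coeff_sum)
  also have "\<dots> = comp_coeff A b m n"
    unfolding comp_coeff_def
  proof (rule sum.mono_neutral_cong_right)
    show "finite (words m {1..N})" by (rule finite_lists_length_eq) simp
    show "comps m n \<subseteq> words m {1..N}"
    proof
      fix js assume js: "js \<in> comps m n"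
      have "i \<le> N" if "i \<in> set js" for i
        using member_le_sum_list[OF that] js assms by simp
      then show "js \<in> words m {1..N}" using js by (simp add: subset_iff)
    qed
    show "\<forall>is\<in>words m {1..N} - comps m n.
        (if sum_list is = n then A m (symtensor scale (map b is)) else 0) = 0"
    proof
      fix js assume "js \<in> words m {1..N} - comps m n"
      then have "sum_list js \<noteq> n" by (simp add: subset_iff) blast
      then show "(if sum_list js = n then A m (symtensor scale (map b js)) else 0) = 0" by simp
    qed
    show "(if sum_list is = n then A m (symtensor scale (map b is)) else 0) =
        A m (symtensor scale (map b is))" if "is \<in> comps m n" for "is"
      using that by simp
  qed
  finally show ?thesis .
qed

text \<open>At each scalar \<open>s\<close> the truncated curve is a single vector of \<open>V\<close>, and there the product of series is evaluated
factor by factor. Equality of the two polynomial functions of \<open>s\<close> gives equality of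
the coefficients.\<close>

lemma comp_fps_mult:
  assumes "A1 \<in> tseries scale (*)" "A2 \<in> tseries scale (*)"
  shows "comp_fps (series_mult scale A1 A2) b m = (\<Sum>k\<le>m. comp_fps A1 b k * comp_fps A2 b (m - k))"
proof (rule fps_ext)
  fix n
  let ?b = "\<lambda>s. \<Sum>i = 1..n. scale (s ^ i) (b i)"
  have "poly (subst_poly (series_mult scale A1 A2) b n m) s =
      poly (\<Sum>k\<le>m. subst_poly A1 b n k * subst_poly A2 b n (m - k)) s" for s
    using arg_cong[OF ev_series_mult[OF assms, of "?b s"], of "\<lambda>f. fps_nth f m"]
    by (simp add: poly_subst_poly assms series_mult_tseries poly_sum fps_mult_nth atLeast0AtMost)
  then have eq: "subst_poly (series_mult scale A1 A2) b n m =
      (\<Sum>k\<le>m. subst_poly A1 b n k * subst_poly A2 b n (m - k))"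
    by (rule poly_ext)
  show "fps_nth (comp_fps (series_mult scale A1 A2) b m) n =
      fps_nth (\<Sum>k\<le>m. comp_fps A1 b k * comp_fps A2 b (m - k)) n"
    using arg_cong[OF eq, of "\<lambda>p. poly.coeff p n"]
    by (simp add: coeff_subst_poly Polynomial.coeff_sum coeff_mult fps_sum_nth fps_mult_nth atLeast0AtMost)
qed

text \<open>The series \<open>A(b\<^sub>1 s + b\<^sub>2 s\<^bsup>2\<^esup> + \<dots>)\<close> in \<open>s\<close>. Terms with \<open>m > n\<close> would vanish because the curve starts in degree one.\<close>

definition compose_curve :: "('f, 'v, 'f) tseries \<Rightarrow> (nat \<Rightarrow> 'v) \<Rightarrow> 'f fps" where
  "compose_curve A b = Abs_fps (\<lambda>n. \<Sum>m\<le>n. comp_coeff A b m n)"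

lemma ev_series_comp:
  assumes "A \<in> tseries scale (*)" "B \<in> tseries scale scale"
  shows "ev (series_comp scale A B) v = compose_curve A (\<lambda>i. B i (tpow scale i v))"
  by (rule fps_ext) (simp add: compose_curve_def series_comp_tpow[OF vector_space_times assms])

lemma compose_curve_nth_le:
  assumes "n \<le> N"
  shows "fps_nth (compose_curve A b) n = (\<Sum>m\<le>N. comp_coeff A b m n)"
  unfolding compose_curve_def fps_nth_Abs_fps
  using assms by (intro sum.mono_neutral_left) (auto simp: comp_coeff_eq_0)

lemma compose_curve_mult:
  assumes "A1 \<in> tseries scale (*)" "A2 \<in> tseries scale (*)"
  shows "compose_curve (series_mult scale A1 A2) b = compose_curve A1 b * compose_curve A2 b"
proof (rule fps_ext)
  fix n
  \<comment> \<open>The factors have order at least \<open>k\<close> and \<open>l\<close>, so the triangular and the square sum agree.\<close>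
  have zero: "fps_nth (comp_fps A1 b k * comp_fps A2 b l) n = 0" if "n < k + l" for k l
    unfolding fps_mult_nth
  proof (rule sum.neutral, rule ballI)
    fix i assume "i \<in> {0..n}"
    then show "fps_nth (comp_fps A1 b k) i * fps_nth (comp_fps A2 b l) (n - i) = 0"
      using that by (cases "i < k") (auto simp: comp_coeff_eq_0)
  qed
  have "fps_nth (compose_curve (series_mult scale A1 A2) b) n =
      (\<Sum>m\<le>n. fps_nth (comp_fps (series_mult scale A1 A2) b m) n)"
    by (simp add: compose_curve_def)
  also have "\<dots> = (\<Sum>m\<le>n. \<Sum>k\<le>m. fps_nth (comp_fps A1 b k * comp_fps A2 b (m - k)) n)"
    by (simp add: comp_fps_mult[OF assms] fps_sum_nth)
  also have "\<dots> = (\<Sum>(k, l)\<in>{(k, l). k + l \<le> n}. fps_nth (comp_fps A1 b k * comp_fps A2 b l) n)"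
    by (rule sum.triangle_reindex_eq[symmetric])
  also have "\<dots> = (\<Sum>(k, l)\<in>{..n} \<times> {..n}. fps_nth (comp_fps A1 b k * comp_fps A2 b l) n)"
    by (rule sum.mono_neutral_left) (auto intro: zero)
  also have "\<dots> = (\<Sum>k\<le>n. \<Sum>l\<le>n. \<Sum>i\<le>n. comp_coeff A1 b k i * comp_coeff A2 b l (n - i))"
    by (simp add: sum.cartesian_product[symmetric] fps_mult_nth atLeast0AtMost)
  also have "\<dots> = (\<Sum>i\<le>n. (\<Sum>k\<le>n. comp_coeff A1 b k i) * (\<Sum>l\<le>n. comp_coeff A2 b l (n - i)))"
    unfolding sum_product by (subst sum.swap[of _ "{..n}" "{..n}"], subst sum.swap) (rule refl)
  also have "\<dots> = fps_nth (compose_curve A1 b * compose_curve A2 b) n"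
    by (simp add: fps_mult_nth atLeast0AtMost compose_curve_nth_le[where N = n])
  finally show "fps_nth (compose_curve (series_mult scale A1 A2) b) n =
      fps_nth (compose_curve A1 b * compose_curve A2 b) n" .
qed

lemma compose_curve_one: "compose_curve (series_one scale) b = 1"
proof (rule fps_ext)
  fix n
  have "comp_coeff (series_one scale) b m n = (if m = 0 \<and> n = 0 then 1 else 0)" for m
  proof (cases "m = 0")
    case True
    have "series_one scale 0 (symtensor scale []) = (1 :: 'f)"
      using arg_cong[OF ev_series_one, of "\<lambda>f. fps_nth f 0"]
      by (simp flip: symtensor_replicate)
    then show ?thesis using True by (simp add: comp_coeff_0)
  next
    case False
    have "series_one scale m t = (0 :: 'f)" if "t \<in> Sym scale m" for t
      using that arg_cong[OF ev_series_one, of "\<lambda>f. fps_nth f m"] False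
      by (induction rule: Sym_induct)
       (simp_all add: lin_maps_add[OF tseriesD[OF series_one_tseries]]
         lin_maps_scale[OF tseriesD[OF series_one_tseries]] Sym_scale)
    then show ?thesis using False by (auto simp: comp_coeff_def symtensor_in_Sym intro!: sum.neutral)
  qed
  then show "fps_nth (compose_curve (series_one scale) b) n = fps_nth 1 n"
    by (auto simp: compose_curve_def)
qed

lemma compose_curve_pow:
  "C \<in> tseries scale (*) \<Longrightarrow> compose_curve (series_pow scale C k) b = compose_curve C b ^ k"
  by (induction k) (simp_all add: compose_curve_one compose_curve_mult series_pow_tseries)

lemma series_pow_eq_0:
  assumes "C \<in> tseries scale (*)" "series_at_0 scale C = 0" "n < k" "t \<in> Sym scale n"
  shows "series_pow scale C k n t = 0"
  using assms(4)
proof (induction rule: Sym_induct)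
  case (tpow v)
  have "fps_nth (ev C v) 0 = 0" using assms(2) by (simp add: series_at_0_def tpow_def)
  then have "fps_nth (ev C v ^ k) n = 0" using assms(3) startsby_zero_power_prefix by blast
  then show ?case by (simp flip: ev_series_pow[OF assms(1)])
next
  case (lincomb c s t)
  then show ?case
    by (simp add: lin_maps_add[OF tseriesD[OF series_pow_tseries[OF assms(1)]]] Sym_scale
      lin_maps_scale[OF tseriesD[OF series_pow_tseries[OF assms(1)]]])
qed

text \<open>In degree \<open>m\<close> the exponential is a sum over \<open>k \<le> m\<close>; as \<open>C\<^bsup>k\<^esup>\<close> has no terms below degree \<open>k\<close>, the bound may be raised to a
common \<open>n\<close>, and the powers are handled by multiplicativity.\<close>

lemma compose_curve_exp:
  assumes "C \<in> tseries scale (*)" "series_at_0 scale C = 0"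
  shows "compose_curve (series_exp scale C) b = fps_expo (compose_curve C b)"
proof (rule fps_ext)
  fix n
  have "comp_coeff (series_exp scale C) b m n = (\<Sum>k\<le>n. comp_coeff (series_pow scale C k) b m n / fact k)"
    if "m \<le> n" for m
  proof -
    have "series_exp scale C m t = (\<Sum>k\<le>n. series_pow scale C k m t / fact k)" if "t \<in> Sym scale m" for t
    proof -
      have "series_exp scale C m t = (\<Sum>k\<le>m. series_pow scale C k m t / fact k)"
        using that by (simp add: series_exp_def)
      also have "\<dots> = (\<Sum>k\<le>n. series_pow scale C k m t / fact k)"
        using \<open>m \<le> n\<close> that by (intro sum.mono_neutral_left) (auto simp: series_pow_eq_0[OF assms])
      finally show ?thesis .
    qed
    then show ?thesis
      unfolding comp_coeff_def sum_divide_distrib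
      by (subst sum.swap) (auto intro!: sum.cong simp: symtensor_in_Sym)
  qed
  then have "fps_nth (compose_curve (series_exp scale C) b) n =
      (\<Sum>k\<le>n. fps_nth (compose_curve (series_pow scale C k) b) n / fact k)"
    unfolding compose_curve_def fps_nth_Abs_fps sum_divide_distrib by (subst sum.swap) simp
  then show "fps_nth (compose_curve (series_exp scale C) b) n = fps_nth (fps_expo (compose_curve C b)) n"
    by (simp add: fps_expo_nth compose_curve_pow[OF assms(1)])
qed

end

section \<open>Coefficients of powers\<close>

lemma comps_Suc: "comps (Suc k) n = (\<Union>i\<in>{1..n}. (#) i ` comps k (n - i))"
proof
  show "comps (Suc k) n \<subseteq> (\<Union>i\<in>{1..n}. (#) i ` comps k (n - i))"
  proof
    fix js assume js: "js \<in> comps (Suc k) n"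
    then obtain i "is" where "js = i # is" by (cases js) auto
    then show "js \<in> (\<Union>i\<in>{1..n}. (#) i ` comps k (n - i))"
      using js by (intro UN_I[of i] image_eqI[of _ _ "is"]) auto
  qed
qed auto

text \<open>For a series without constant term only compositions with positive parts contribute, the same index set as
in the definition of the composition of tensor power series.\<close>

lemma fps_power_nth_comps:
  assumes "fps_nth c 0 = 0"
  shows "fps_nth (c ^ k) n = (\<Sum>is\<in>comps k n. prod_list (map (fps_nth c) is))"
proof (induction k arbitrary: n)
  case 0
  show ?case unfolding comps_0 by simp
next
  case (Suc k)
  have "fps_nth (c ^ Suc k) n = (\<Sum>i\<le>n. fps_nth c i * fps_nth (c ^ k) (n - i))"
    by (simp add: fps_mult_nth atLeast0AtMost)
  also have "\<dots> = (\<Sum>i=1..n. fps_nth c i * fps_nth (c ^ k) (n - i))"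
    using assms by (intro sum.mono_neutral_right) (auto simp: not_less_eq_eq)
  also have "\<dots> = (\<Sum>i=1..n. \<Sum>is\<in>(#) i ` comps k (n - i). prod_list (map (fps_nth c) is))"
    by (simp add: Suc.IH sum.reindex sum_distrib_left)
  also have "\<dots> = (\<Sum>is\<in>comps (Suc k) n. prod_list (map (fps_nth c) is))"
    unfolding comps_Suc
  proof (rule sum.UNION_disjoint[symmetric])
    show "\<forall>i\<in>{1..n}. finite ((#) i ` comps k (n - i))"
      by (intro ballI finite_imageI finite_comps)
  qed auto
  finally show ?case .
qed

lemma fps_expo_mult_nth:
  assumes "fps_nth c 0 = 0"
  shows "fps_nth (fps_expo c * a) n = (\<Sum>k\<le>n. fps_nth (c ^ k * a) n / fact k)"
proof -
  have "fps_nth (fps_expo c) j = (\<Sum>k\<le>n. fps_nth (c ^ k) j / fact k)" if "j \<le> n" for j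
    unfolding fps_expo_nth using that startsby_zero_power_prefix[OF assms]
    by (intro sum.mono_neutral_left) auto
  then have "fps_nth (fps_expo c * a) n =
      (\<Sum>j\<le>n. (\<Sum>k\<le>n. fps_nth (c ^ k) j / fact k) * fps_nth a (n - j))"
    by (simp add: fps_mult_nth atLeast0AtMost)
  also have "\<dots> = (\<Sum>k\<le>n. fps_nth (c ^ k * a) n / fact k)"
    unfolding sum_distrib_right by (subst sum.swap) (simp add: fps_mult_nth atLeast0AtMost sum_divide_distrib)
  finally show ?thesis .
qed

section \<open>Polynomials on the dual space\<close>

context symmetric_powers
begin

lemma monom_poly_add: "monom_poly scale n (s + t) = monom_poly scale n s + monom_poly scale n t"
  and monom_poly_scale: "monom_poly scale n (fun_scale c t) = fun_scale c (monom_poly scale n t)"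
  and monom_poly_zero: "monom_poly scale n 0 = 0"
  by (simp_all add: monom_poly_def fun_eq_iff fun_apply dual_pair_add dual_pair_scale dual_pair_zero)

text \<open>A finitely supported family of coefficients, with any bound \<open>n\<close> on its support, so that two polynomials can be brought
to a common bound.\<close>

definition represents :: "(('v \<Rightarrow> 'f) \<Rightarrow> 'f) \<Rightarrow> (nat \<Rightarrow> ('f, 'v) tensor) \<Rightarrow> nat \<Rightarrow> bool" where
  "represents p f n \<longleftrightarrow> (\<forall>k. f k \<in> Sym scale k) \<and> (\<forall>k>n. f k = 0) \<and>
     p = (\<Sum>k\<le>n. monom_poly scale k (f k))"

lemma Polys_iff: "p \<in> Polys scale \<longleftrightarrow> (\<exists>f n. represents p f n)"
proof
  assume "p \<in> Polys scale"
  then obtain n f where "\<forall>k\<le>n. f k \<in> Sym scale k" "p = (\<Sum>k\<le>n. monom_poly scale k (f k))"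
    by (auto simp: Polys_def)
  then have "represents p (\<lambda>k. if k \<le> n then f k else 0) n"
    by (simp add: represents_def Sym_zero)
  then show "\<exists>f n. represents p f n" by blast
qed (auto simp: Polys_def represents_def)

lemma represents_sum_mono:
  assumes "represents p f n" "n \<le> N" "\<And>k. T k 0 = 0"
  shows "(\<Sum>k\<le>n. T k (f k)) = (\<Sum>k\<le>N. T k (f k))"
  using assms by (intro sum.mono_neutral_left) (auto simp: represents_def)

lemma represents_mono: "represents p f n \<Longrightarrow> n \<le> N \<Longrightarrow> represents p f N"
  using represents_sum_mono[of p f n N "monom_poly scale"]
  by (simp add: represents_def monom_poly_zero)

text \<open>The difference of two representations represents zero, and homogeneous components are unique.\<close>

lemma represents_unique:
  assumes "represents p f n" "represents p g m"
  shows "f = g"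
proof
  fix k
  define N where "N = max k (max n m)"
  have f: "represents p f N" and g: "represents p g N"
    using assms by (auto intro: represents_mono simp: N_def)
  have "(\<Sum>k\<le>N. monom_poly scale k (f k + fun_scale (-1) (g k))) = p + fun_scale (-1) p"
  proof -
    have "(\<Sum>k\<le>N. monom_poly scale k (f k)) = p" "(\<Sum>k\<le>N. monom_poly scale k (g k)) = p"
      using f g by (simp_all add: represents_def)
    then show ?thesis
      by (simp only: monom_poly_add monom_poly_scale sum.distrib fun_space.scale_sum_right[symmetric])
  qed
  also have "\<dots> = 0" by (simp add: fun_eq_iff fun_apply)
  finally have "(\<Sum>k\<le>N. monom_poly scale k (f k + fun_scale (-1) (g k))) = 0" .
  then have "f k + fun_scale (-1) (g k) = 0"
  proof (rule monom_poly_sum_eq_0[rotated])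
    show "f j + fun_scale (-1) (g j) \<in> Sym scale j" for j
      by (intro Sym_add Sym_scale) (use f g in \<open>simp_all add: represents_def\<close>)
  qed (simp add: N_def)
  then show "f k = g k" by (simp add: fun_eq_iff fun_apply)
qed

lemma represents_add:
  assumes "represents p f n" "represents q g n"
  shows "represents (p + q) (\<lambda>k. f k + g k) n"
  using assms by (auto simp: represents_def monom_poly_add sum.distrib intro: Sym_add)

lemma represents_scale:
  assumes "represents p f n"
  shows "represents (fun_scale c p) (\<lambda>k. fun_scale c (f k)) n"
  using assms
  by (auto simp: represents_def monom_poly_scale fun_space.scale_sum_right intro: Sym_scale)

lemma represents_monom:
  "f \<in> Sym scale n \<Longrightarrow> represents (monom_poly scale n f) (\<lambda>k. if k = n then f else 0) n"
  by (auto simp: represents_def Sym_zero if_distrib[of "monom_poly scale _"] monom_poly_zero cong: if_cong)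

lemma represents_common:
  assumes "p \<in> Polys scale" "q \<in> Polys scale"
  obtains f g n where "represents p f n" "represents q g n"
proof -
  obtain f n g m where "represents p f n" "represents q g m"
    using assms by (auto simp: Polys_iff)
  then have "represents p f (max n m)" "represents q g (max n m)"
    by (auto intro: represents_mono)
  then show thesis by (rule that)
qed

lemma monom_poly_in_Polys: "f \<in> Sym scale n \<Longrightarrow> monom_poly scale n f \<in> Polys scale"
  using represents_monom Polys_iff by blast

lemma subspace_Polys: "fun_space.subspace (Polys scale)"
proof (rule fun_space.subspaceI)
  show "0 \<in> Polys scale"
    using monom_poly_in_Polys[OF Sym_zero, of 0] by (simp add: monom_poly_zero)
  show "p + q \<in> Polys scale" if "p \<in> Polys scale" "q \<in> Polys scale" for p q
    using that represents_common[OF that] represents_add Polys_iff by metis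
  show "fun_scale c p \<in> Polys scale" if "p \<in> Polys scale" for c p
    using that represents_scale Polys_iff by metis
qed

lemma Polys_off_dual: "p \<in> Polys scale \<Longrightarrow> \<omega> \<notin> dual scale \<Longrightarrow> p \<omega> = 0"
  by (auto simp: Polys_def fun_apply monom_poly_def)

abbreviation "poly_maps \<equiv> lin_maps fun_scale (Polys scale) fun_scale (Polys scale)"

text \<open>Powers span the symmetric powers, and these give all polynomials.\<close>

lemma poly_maps_ext:
  assumes "S \<in> poly_maps" "T \<in> poly_maps"
    and "\<And>n v. S (monom_poly scale n (tpow scale n v)) = T (monom_poly scale n (tpow scale n v))"
  shows "S = T"
proof (rule extensionalityI)
  show "S \<in> extensional (Polys scale)" "T \<in> extensional (Polys scale)"
    using assms(1,2) by (auto simp: lin_maps_def PiE_def)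
  have monom: "S (monom_poly scale n f) = T (monom_poly scale n f)" if "f \<in> Sym scale n" for n f
    using that
  proof (induction rule: Sym_induct)
    case (lincomb c s t)
    then show ?case
      using monom_poly_in_Polys Sym_scale
      by (simp add: monom_poly_add monom_poly_scale lin_maps_add[OF assms(1)] lin_maps_add[OF assms(2)]
        lin_maps_scale[OF assms(1)] lin_maps_scale[OF assms(2)] fun_space.subspace_scale[OF subspace_Polys])
  qed (rule assms(3))
  fix p assume "p \<in> Polys scale"
  then obtain f n where r: "represents p f n" by (auto simp: Polys_iff)
  then have f: "f k \<in> Sym scale k" for k by (simp add: represents_def)
  have "S p = (\<Sum>k\<le>n. S (monom_poly scale k (f k)))"
    using r f unfolding represents_def
    by (auto intro!: lin_maps_sum_subspace[OF assms(1) vector_space_fun_scale subspace_Polys] monom_poly_in_Polys)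
  also have "\<dots> = (\<Sum>k\<le>n. T (monom_poly scale k (f k)))"
    by (simp add: monom f)
  also have "\<dots> = T p"
    using r f unfolding represents_def
    by (auto intro!: lin_maps_sum_subspace[OF assms(2) vector_space_fun_scale subspace_Polys, symmetric] monom_poly_in_Polys)
  finally show "S p = T p" .
qed

text \<open>Polynomials on the dual space are the direct sum of their homogeneous parts, so a linear map may be
prescribed on each part.\<close>

lemma poly_maps_extension:
  assumes T: "\<And>k. T k \<in> lin_maps fun_scale (Sym scale k) fun_scale (Polys scale)"
  shows "\<exists>S\<in>poly_maps. \<forall>k. \<forall>f\<in>Sym scale k. S (monom_poly scale k f) = T k f"
proof -
  \<comment> \<open>The value does not depend on the chosen representation, by uniqueness of coefficients.\<close>
  define S where "S = (\<lambda>p\<in>Polys scale. let (f, n) = (SOME (f, n). represents p f n) in \<Sum>k\<le>n. T k (f k))"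
  have T0: "T k 0 = 0" for k by (rule lin_maps_zero[OF T vector_space_fun_scale])
  have S: "S p = (\<Sum>k\<le>n. T k (f k))" if r: "represents p f n" for p f n
  proof -
    obtain g m where gm: "(SOME (f, n). represents p f n) = (g, m)" by fastforce
    have "represents p g m"
      using someI_ex[of "\<lambda>(f, n). represents p f n"] r gm by auto
    moreover from this have "g = f" using r by (rule represents_unique)
    ultimately have "(\<Sum>k\<le>m. T k (f k)) = (\<Sum>k\<le>n. T k (f k))"
      using represents_sum_mono[of p f m "max m n" T] represents_sum_mono[of p f n "max m n" T] r T0
      by simp
    moreover have "p \<in> Polys scale" using r Polys_iff by blast
    ultimately show ?thesis using gm \<open>g = f\<close> by (simp add: S_def)
  qed
  have "S \<in> poly_maps"
    unfolding lin_maps_def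
  proof (intro CollectI conjI ballI allI PiE_I)
    fix p assume p: "p \<in> Polys scale"
    then obtain f n where r: "represents p f n" by (auto simp: Polys_iff)
    then have f: "f k \<in> Sym scale k" for k by (simp add: represents_def)
    show "S p \<in> Polys scale"
      unfolding S[OF r] by (intro fun_space.subspace_sum[OF subspace_Polys] lin_maps_in[OF T f])
    show "S (fun_scale c p) = fun_scale c (S p)" for c
      unfolding S[OF r] S[OF represents_scale[OF r]]
      by (simp add: lin_maps_scale[OF T f] fun_space.scale_sum_right)
    fix q assume "q \<in> Polys scale"
    then obtain f g n where r: "represents p f n" "represents q g n"
      using p represents_common by blast
    then have f: "f k \<in> Sym scale k" "g k \<in> Sym scale k" for k by (simp_all add: represents_def)
    show "S (p + q) = S p + S q"
      unfolding S[OF r(1)] S[OF r(2)] S[OF represents_add[OF r]]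
      by (simp add: lin_maps_add[OF T f] sum.distrib)
  qed (simp add: S_def)
  moreover have "S (monom_poly scale k f) = T k f" if "f \<in> Sym scale k" for k f
    unfolding S[OF represents_monom[OF that]]
    by (simp add: if_distrib[of "T _"] T0 cong: if_cong)
  ultimately show ?thesis by blast
qed

section \<open>Generating series\<close>

lemma poly_seq_ops_maps: "S \<in> poly_seq_ops scale \<Longrightarrow> S \<in> poly_maps"
  by (simp add: poly_seq_ops_def)

lemma poly_seq_lin_maps:
  assumes "S \<in> poly_maps"
  shows "poly_seq scale S n \<omega> \<in> lin_maps fun_scale (Sym scale n) (*) UNIV"
  unfolding poly_seq_def
  by (rule lin_maps_restrictI)
    (auto simp: monom_poly_add monom_poly_scale monom_poly_in_Polys lin_maps_add[OF assms]
      lin_maps_scale[OF assms] fun_apply)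

lemma generating_series_tseries:
  assumes "S \<in> poly_maps"
  shows "generating_series scale S \<omega> \<in> tseries scale (*)"
proof -
  note p = poly_seq_lin_maps[OF assms]
  have "(\<lambda>t\<in>Sym scale n. poly_seq scale S n \<omega> t / of_nat (fact n))
      \<in> lin_maps fun_scale (Sym scale n) (*) UNIV" for n
    by (rule lin_maps_restrictI) (simp_all add: lin_maps_add[OF p] lin_maps_scale[OF p] add_divide_distrib)
  then show ?thesis by (simp add: tseries_def generating_series_def)
qed

lemma generating_series_tpow:
  "generating_series scale S \<omega> n (tpow scale n v) = S (monom_poly scale n (tpow scale n v)) \<omega> / fact n"
  by (simp add: generating_series_def poly_seq_def)

text \<open>The defining identity of series, tested on every line through the origin.\<close>

lemma sheffer_generated_iff:
  assumes "S \<in> poly_maps" "A \<in> tseries scale (*)" "B \<in> tseries scale scale"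
  shows "sheffer_generated scale S A B \<longleftrightarrow> (\<forall>\<omega>\<in>dual scale. \<forall>v.
    ev (generating_series scale S \<omega>) v = fps_expo (ev (series_dual_pair scale \<omega> B) v) * ev A v)"
proof -
  have "generating_series scale S \<omega> = series_mult scale (series_exp scale (series_dual_pair scale \<omega> B)) A \<longleftrightarrow>
    (\<forall>v. ev (generating_series scale S \<omega>) v = fps_expo (ev (series_dual_pair scale \<omega> B) v) * ev A v)"
    if "\<omega> \<in> dual scale" for \<omega>
  proof -
    note D = series_dual_pair_tseries[OF that assms(3)]
    note C = series_exp_tseries[OF D]
    have "ev (series_mult scale (series_exp scale (series_dual_pair scale \<omega> B)) A) v =
        fps_expo (ev (series_dual_pair scale \<omega> B) v) * ev A v" for v
      by (simp add: ev_series_mult[OF C assms(2)] ev_series_exp[OF D])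
    then show ?thesis
      using ev_eqI[OF generating_series_tseries[OF assms(1)] series_mult_tseries[OF C assms(2)], of \<omega>]
      by auto
  qed
  then show ?thesis by (simp add: sheffer_generated_def)
qed

lemma F0D: "A \<in> F0 scale \<Longrightarrow> A \<in> tseries scale (*)" 
  by (simp add: F0_def)

lemma F0_nth_0: "A \<in> F0 scale \<Longrightarrow> fps_nth (ev A v) 0 \<noteq> 0"
  by (simp add: F0_def series_at_0_def tpow_def)

lemma F0_neq_0: "A \<in> F0 scale \<Longrightarrow> ev A v \<noteq> 0"
  by (metis F0_nth_0 fps_zero_nth)

lemma F1D: "B \<in> F1 scale \<Longrightarrow> B \<in> tseries scale scale"
  by (simp add: F1_def)

lemma F1_at_0: "B \<in> F1 scale \<Longrightarrow> B 0 (tpow scale 0 v) = 0"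
  by (simp add: F1_def series_at_0_def tpow_def)

lemma ev_dual_pair_nth_0: "B \<in> F1 scale \<Longrightarrow> \<omega> \<in> dual scale \<Longrightarrow>
    fps_nth (ev (series_dual_pair scale \<omega> B) v) 0 = 0"
  by (simp add: F1_at_0 dual_iff) (metis add_cancel_right_right)

lemma series_dual_pair_zero: "ev (series_dual_pair scale 0 B) v = 0"
  by (rule fps_ext) (simp add: fun_apply)

text \<open>At \<open>\<omega> = 0\<close> the exponential factor is \<open>1\<close>, which isolates \<open>A\<close>. As \<open>A(0) \<noteq> 0\<close>, it can be
cancelled for general \<open>\<omega>\<close>; then injectivity of the exponential gives \<open>\<langle>\<omega>, B(v)\<rangle>\<close>, and
functionals separate the points of \<open>V\<close>.\<close>

lemma sheffer_generated_unique:
  assumes S: "S \<in> poly_maps" and A: "A \<in> F0 scale" "A' \<in> F0 scale" and B: "B \<in> F1 scale" "B' \<in> F1 scale"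
    and gen: "sheffer_generated scale S A B" "sheffer_generated scale S A' B'"
  shows "A = A' \<and> B = B'"
proof
  note g = gen(1)[unfolded sheffer_generated_iff[OF S F0D[OF A(1)] F1D[OF B(1)]], rule_format]
  note g' = gen(2)[unfolded sheffer_generated_iff[OF S F0D[OF A(2)] F1D[OF B(2)]], rule_format]
  show "A = A'"
    using g[OF dual_zero] g'[OF dual_zero]
    by (intro ev_eqI F0D A) (simp add: series_dual_pair_zero)
  show "B = B'"
  proof (rule tseries_ext[OF F1D F1D, OF B], rule dual_separates)
    fix n v \<omega> assume \<omega>: "\<omega> \<in> dual scale"
    have "fps_expo (ev (series_dual_pair scale \<omega> B) v) = fps_expo (ev (series_dual_pair scale \<omega> B') v)"
      using g[OF \<omega>, of v] g'[OF \<omega>, of v] F0_neq_0[OF A(2), of v] \<open>A = A'\<close> by simp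
    then have "ev (series_dual_pair scale \<omega> B) v = ev (series_dual_pair scale \<omega> B') v"
      by (rule fps_expo_inj[OF ev_dual_pair_nth_0[OF B(1) \<omega>] ev_dual_pair_nth_0[OF B(2) \<omega>]])
    from arg_cong[OF this, of "\<lambda>f. fps_nth f n"]
    show "\<omega> (B n (tpow scale n v)) = \<omega> (B' n (tpow scale n v))" by simp
  qed
qed

lemma sheffer_generated_determines:
  assumes "S \<in> poly_maps" "T \<in> poly_maps" "sheffer_generated scale S A B" "sheffer_generated scale T A B"
  shows "S = T"
proof (rule poly_maps_ext[OF assms(1,2)], rule ext)
  fix n v \<omega>
  show "S (monom_poly scale n (tpow scale n v)) \<omega> = T (monom_poly scale n (tpow scale n v)) \<omega>"
  proof (cases "\<omega> \<in> dual scale")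
    case True
    then have "generating_series scale S \<omega> = generating_series scale T \<omega>"
      using assms(3,4) by (simp add: sheffer_generated_def)
    then show ?thesis
      using generating_series_tpow[of S \<omega> n v] generating_series_tpow[of T \<omega> n v] by simp
  next
    case False
    then show ?thesis
      using Polys_off_dual lin_maps_in[OF assms(1)] lin_maps_in[OF assms(2)] monom_poly_in_Polys tpow_in_Sym
      by metis
  qed
qed

section \<open>Sheffer operators with given generating function\<close>

text \<open>The symmetric tensor \<open>Q\<^bsub>kn\<^esub> v\<^bsup>\<otimes>n\<^esup>\<close> for the operator with pair \<open>(A, B)\<close>: it is \<open>n!\<close> times the term of degree \<open>n\<close> in \<open>v\<close> of
\<open>B(v)\<^bsup>\<odot>k\<^esup> A(v) / k!\<close>, so that it collects the part of degree \<open>k\<close> in \<open>\<omega>\<close> of the generating function.\<close>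

definition sheffer_coeff :: "('f, 'v, 'f) tseries \<Rightarrow> ('f, 'v, 'v) tseries \<Rightarrow> nat \<Rightarrow> nat \<Rightarrow> 'v \<Rightarrow> ('f, 'v) tensor" where
  "sheffer_coeff A B k n v = fun_scale (fact n / fact k) (\<Sum>l\<le>n. fun_scale (A l (tpow scale l v))
     (\<Sum>is\<in>comps k (n - l). symtensor scale (map (\<lambda>i. B i (tpow scale i v)) is)))"

lemma sheffer_coeff_in_Sym: "sheffer_coeff A B k n v \<in> Sym scale k"
  unfolding sheffer_coeff_def by (intro Sym_scale Sym_sum symtensor_in_Sym) simp

lemma hompoly_sheffer_coeff:
  assumes "A \<in> tseries scale (*)" "B \<in> tseries scale scale"
  shows "hompoly fun_scale n (sheffer_coeff A B k n)"
proof -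
  have "hompoly fun_scale n (\<lambda>v. fun_scale (A l (tpow scale l v))
      (\<Sum>is\<in>comps k (n - l). symtensor scale (map (\<lambda>i. B i (tpow scale i v)) is)))" if "l \<le> n" for l
  proof -
    have "hompoly fun_scale (n - l) (\<lambda>v. symtensor scale (map (\<lambda>i. B i (tpow scale i v)) is))"
      if "is \<in> comps k (n - l)" for "is"
      using hompoly_lin_maps[OF vector_space_fun_scale odot_ops_lin_maps[OF assms(2), of "is" k "n - l"]] that
      by (simp add: odot_ops_tpow[OF assms(2), of "is" k "n - l"])
    then have "hompoly fun_scale (n - l)
        (\<lambda>v. \<Sum>is\<in>comps k (n - l). symtensor scale (map (\<lambda>i. B i (tpow scale i v)) is))"
      by (rule hompoly_sum[OF vector_space_fun_scale])
    then have "hompoly fun_scale (l + (n - l)) (\<lambda>v. fun_scale (A l (tpow scale l v))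
      (\<Sum>is\<in>comps k (n - l). symtensor scale (map (\<lambda>i. B i (tpow scale i v)) is)))"
      by (rule hompoly_mult[OF vector_space_fun_scale
            hompoly_lin_maps[OF vector_space_times tseriesD[OF assms(1)]]])
    then show ?thesis using that by simp
  qed
  then show ?thesis
    unfolding sheffer_coeff_def
    by (intro hompoly_scale hompoly_sum vector_space_fun_scale) simp
qed

lemma dual_pair_sheffer_coeff:
  assumes "B \<in> F1 scale" "\<omega> \<in> dual scale"
  shows "dual_pair k \<omega> (sheffer_coeff A B k n v) =
    fact n / fact k * fps_nth (ev (series_dual_pair scale \<omega> B) v ^ k * ev A v) n"
proof -
  let ?c = "ev (series_dual_pair scale \<omega> B) v"
  have c: "prod_list (map \<omega> (map (\<lambda>i. B i (tpow scale i v)) is)) = prod_list (map (fps_nth ?c) is)" for "is"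
    by (rule arg_cong[of _ _ prod_list]) simp
  have "dual_pair k \<omega> (symtensor scale (map (\<lambda>i. B i (tpow scale i v)) is)) = prod_list (map (fps_nth ?c) is)"
    if "length is = k" for "is"
    using dual_pair_symtensor[OF assms(2), of "map (\<lambda>i. B i (tpow scale i v)) is"] that c by simp
  then have "dual_pair k \<omega> (sheffer_coeff A B k n v) =
      fact n / fact k * (\<Sum>l\<le>n. A l (tpow scale l v) * (\<Sum>is\<in>comps k (n - l). prod_list (map (fps_nth ?c) is)))"
    by (simp add: sheffer_coeff_def dual_pair_scale dual_pair_sum)
  also have "\<dots> = fact n / fact k * fps_nth (ev A v * ?c ^ k) n"
    unfolding fps_power_nth_comps[OF ev_dual_pair_nth_0[OF assms], symmetric]
    by (simp add: fps_mult_nth atLeast0AtMost)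
  finally show ?thesis by (simp add: mult.commute)
qed

lemma sum_dual_pair_sheffer_coeff:
  assumes "B \<in> F1 scale" "\<omega> \<in> dual scale"
  shows "(\<Sum>k\<le>n. dual_pair k \<omega> (sheffer_coeff A B k n v)) =
    fact n * fps_nth (fps_expo (ev (series_dual_pair scale \<omega> B) v) * ev A v) n"
  by (simp add: dual_pair_sheffer_coeff[OF assms] fps_expo_mult_nth[OF ev_dual_pair_nth_0[OF assms]]
      sum_distrib_left)

text \<open>The generating function, rewritten as an equation between polynomials that another operator can be applied to.\<close>

lemma sheffer_generated_iff_expansion:
  assumes "S \<in> poly_maps" "A \<in> F0 scale" "B \<in> F1 scale"
  shows "sheffer_generated scale S A B \<longleftrightarrow> (\<forall>n v. S (monom_poly scale n (tpow scale n v)) =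
    (\<Sum>k\<le>n. monom_poly scale k (sheffer_coeff A B k n v)))" (is "?gen \<longleftrightarrow> ?exp")
proof -
  let ?c = "\<lambda>\<omega>. ev (series_dual_pair scale \<omega> B)"
  have dual: "(\<Sum>k\<le>n. monom_poly scale k (sheffer_coeff A B k n v)) \<omega> =
      fact n * fps_nth (fps_expo (?c \<omega> v) * ev A v) n" if "\<omega> \<in> dual scale" for n v \<omega>
    using that by (simp add: fun_apply monom_poly_apply sum_dual_pair_sheffer_coeff[OF assms(3)])
  have gen: "S (monom_poly scale n (tpow scale n v)) \<omega> =
      fact n * fps_nth (ev (generating_series scale S \<omega>) v) n" for n v \<omega>
    by (simp add: generating_series_tpow)
  show ?thesis
  proof
    assume ?gen
    show ?exp
    proof (intro allI ext)
      fix n v \<omega>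
      show "S (monom_poly scale n (tpow scale n v)) \<omega> =
        (\<Sum>k\<le>n. monom_poly scale k (sheffer_coeff A B k n v)) \<omega>"
      proof (cases "\<omega> \<in> dual scale")
        case True
        then show ?thesis
          using \<open>?gen\<close> by (simp add: dual gen sheffer_generated_iff[OF assms(1) F0D F1D] assms)
      next
        case False
        then show ?thesis
          using Polys_off_dual[OF lin_maps_in[OF assms(1)] False, OF monom_poly_in_Polys[OF tpow_in_Sym]]
          by (simp add: fun_apply monom_poly_def)
      qed
    qed
  next
    assume exp: ?exp
    show ?gen
      unfolding sheffer_generated_iff[OF assms(1) F0D[OF assms(2)] F1D[OF assms(3)]]
    proof (intro ballI allI fps_ext)
      fix \<omega> v n assume \<omega>: "\<omega> \<in> dual scale"
      have "fact n * fps_nth (ev (generating_series scale S \<omega>) v) n =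
          fact n * fps_nth (fps_expo (?c \<omega> v) * ev A v) n"
        using exp unfolding gen[symmetric] dual[OF \<omega>, symmetric] by simp
      then show "fps_nth (ev (generating_series scale S \<omega>) v) n = fps_nth (fps_expo (?c \<omega> v) * ev A v) n"
        by simp
    qed
  qed
qed

lemma linear_tpow_1: "Vector_Spaces.linear scale fun_scale (tpow scale 1)"
proof -
  have "tpow scale 1 = (\<lambda>y. tensor scale [y])" by (simp add: tpow_def fun_eq_iff)
  then show ?thesis using multilinear_update[OF multilinear_tensor[OF vs, of 1], of "[]" "[]"] by simp
qed

lemma Sym_1: "Sym scale 1 = range (tpow scale 1)"
proof
  show "Sym scale 1 \<subseteq> range (tpow scale 1)"
  proof
    fix t assume "t \<in> Sym scale 1"
    then show "t \<in> range (tpow scale 1)"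
    proof (induction rule: Sym_induct)
      case (lincomb c s t)
      then obtain v w where "s = tpow scale 1 v" "t = tpow scale 1 w" by auto
      then have "fun_scale c s + t = tpow scale 1 (scale c v + w)"
        using linear_tpow_1 by (simp add: Vector_Spaces.linear_iff)
      then show ?case by simp
    qed auto
  qed
qed auto

lemma inj_tpow_1: "inj (tpow scale 1)"
proof (rule injI, rule dual_separates)
  fix v w \<omega> assume "tpow scale 1 v = tpow scale 1 w" "\<omega> \<in> dual scale"
  then show "\<omega> v = \<omega> w" using dual_pair_tpow[of \<omega> 1 v] dual_pair_tpow[of \<omega> 1 w] by simp
qed

lemma F1_linear:
  assumes "B \<in> F1 scale"
  shows "Vector_Spaces.linear scale scale (\<lambda>v. B 1 (tpow scale 1 v))" "bij (\<lambda>v. B 1 (tpow scale 1 v))"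
proof -
  show "Vector_Spaces.linear scale scale (\<lambda>v. B 1 (tpow scale 1 v))"
    using linear_tpow_1 lin_maps_add[OF tseriesD[OF F1D[OF assms]], of _ 1]
      lin_maps_scale[OF tseriesD[OF F1D[OF assms]], of _ 1]
    by (simp only: Vector_Spaces.linear_iff vs tpow_in_Sym simp_thms)
  have "bij_betw (tpow scale 1) UNIV (Sym scale 1)"
    using inj_tpow_1 Sym_1 by (simp add: bij_betw_def)
  moreover have "bij_betw (B 1) (Sym scale 1) UNIV" using assms by (simp add: F1_def)
  ultimately show "bij (\<lambda>v. B 1 (tpow scale 1 v))"
    using bij_betw_trans by (fastforce simp: comp_def)
qed

text \<open>The inverse of \<open>B\<^sub>1\<close> as a map of \<open>V\<close>, where \<open>V\<close> is identified with its first symmetric power.\<close>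

lemma F1_inverse_linear:
  assumes "B \<in> F1 scale"
  shows "\<exists>\<gamma>. Vector_Spaces.linear scale scale \<gamma> \<and>
    (\<forall>v. \<gamma> (B 1 (tpow scale 1 v)) = v) \<and> (\<forall>v. B 1 (tpow scale 1 (\<gamma> v)) = v)"
proof -
  let ?\<beta> = "\<lambda>v. B 1 (tpow scale 1 v)"
  define \<gamma> where "\<gamma> = Hilbert_Choice.inv ?\<beta>"
  have 1: "?\<beta> (\<gamma> v) = v" "\<gamma> (?\<beta> v) = v" for v
    unfolding \<gamma>_def using F1_linear(2)[OF assms]
    by (rule surj_f_inv_f[OF bij_is_surj], rule inv_f_f[OF bij_is_inj])
  have "\<gamma> (x + y) = \<gamma> x + \<gamma> y" "\<gamma> (scale a x) = scale a (\<gamma> x)" for a x y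
    using F1_linear(1)[OF assms] 1 unfolding Vector_Spaces.linear_iff by metis+
  then have "Vector_Spaces.linear scale scale \<gamma>" by (simp add: Vector_Spaces.linear_iff vs)
  then show ?thesis using 1 by blast
qed

text \<open>The inverse is the lift of \<open>v \<mapsto> \<gamma>(v)\<^bsup>\<otimes>n\<^esup> / c\<close>.\<close>

lemma bij_betw_Sym:
  assumes L: "L \<in> lin_maps fun_scale (Sym scale n) fun_scale (Sym scale n)"
    and L_tpow: "\<And>v. L (tpow scale n v) = fun_scale c (tpow scale n (\<beta> v))"
    and c: "c \<noteq> 0"
    and \<gamma>: "Vector_Spaces.linear scale scale \<gamma>" "\<And>v. \<gamma> (\<beta> v) = v" "\<And>v. \<beta> (\<gamma> v) = v"
  shows "bij_betw L (Sym scale n) (Sym scale n)"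
proof -
  have "hompoly fun_scale n (\<lambda>v. fun_scale (1 / c) (tpow scale n (\<gamma> v)))"
    by (rule hompoly_scale[OF vector_space_fun_scale hompoly_comp_linear[OF hompoly_tpow \<gamma>(1)]])
  then obtain L' where L': "L' \<in> lin_maps fun_scale (Sym scale n) fun_scale (Sym scale n)"
    "\<And>v. L' (tpow scale n v) = fun_scale (1 / c) (tpow scale n (\<gamma> v))"
    using hompoly_lift_exists[OF vector_space_fun_scale subspace_Sym] Sym_scale tpow_in_Sym by metis
  have "L' (L t) = t" if "t \<in> Sym scale n" for t
    using that
    by (induction rule: Sym_induct)
      (simp_all add: L_tpow L'(2) lin_maps_scale[OF L'(1)] lin_maps_add[OF L'(1)] lin_maps_in[OF L]
        lin_maps_scale[OF L] lin_maps_add[OF L] Sym_scale c \<gamma>(2,3))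
  moreover have "L (L' t) = t" if "t \<in> Sym scale n" for t
    using that
    by (induction rule: Sym_induct)
      (simp_all add: L_tpow L'(2) lin_maps_scale[OF L'(1)] lin_maps_add[OF L'(1)] lin_maps_in[OF L'(1)]
        lin_maps_scale[OF L] lin_maps_add[OF L] Sym_scale c \<gamma>(2,3))
  ultimately show ?thesis
    by (intro bij_betw_byWitness[of _ L']) (auto intro: lin_maps_in[OF L] lin_maps_in[OF L'(1)])
qed

text \<open>A composition of \<open>n - l\<close> into \<open>n\<close> positive parts exists only for \<open>l = 0\<close>, and then all parts are \<open>1\<close>.\<close>

lemma sheffer_coeff_diag:
  "sheffer_coeff A B n n v = fun_scale (A 0 (tpow scale 0 v)) (tpow scale n (B 1 (tpow scale 1 v)))"
proof -
  have "(\<Sum>l\<le>n. fun_scale (A l (tpow scale l v))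
     (\<Sum>is\<in>comps n (n - l). symtensor scale (map (\<lambda>i. B i (tpow scale i v)) is))) =
     (\<Sum>l\<in>{0}. fun_scale (A l (tpow scale l v))
     (\<Sum>is\<in>comps n (n - l). symtensor scale (map (\<lambda>i. B i (tpow scale i v)) is)))"
  proof (rule sum.mono_neutral_right)
    show "\<forall>l\<in>{..n} - {0}. fun_scale (A l (tpow scale l v))
     (\<Sum>is\<in>comps n (n - l). symtensor scale (map (\<lambda>i. B i (tpow scale i v)) is)) = 0"
    proof
      fix l assume "l \<in> {..n} - {0}"
      then have "comps n (n - l) = {}" by (intro comps_empty) auto
      then show "fun_scale (A l (tpow scale l v))
         (\<Sum>is\<in>comps n (n - l). symtensor scale (map (\<lambda>i. B i (tpow scale i v)) is)) = 0"
        by (simp only: sum.empty fun_space.scale_zero_right)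
    qed
  qed auto
  also have "\<dots> = fun_scale (A 0 (tpow scale 0 v)) (tpow scale n (B 1 (tpow scale 1 v)))"
    using comps_self[of n] by (simp only: sum.insert sum.empty finite.emptyI empty_iff diff_zero
      not_False_eq_True add_0_right map_replicate symtensor_replicate)
  finally show ?thesis by (simp add: sheffer_coeff_def)
qed

text \<open>The coefficients \<open>sheffer_coeff\<close> are homogeneous polynomial in \<open>v\<close> and lift to linear maps \<open>Q\<^bsub>kn\<^esub>\<close>; the operator is the sum of the
\<open>Q\<^bsub>kn\<^esub>\<close> with \<open>k \<le> n\<close>. The diagonal is bijective because \<open>A\<^sub>0 \<noteq> 0\<close> and \<open>B\<^sub>1\<close> is invertible.\<close>

lemma sheffer_operator_exists:
  assumes A: "A \<in> F0 scale" and B: "B \<in> F1 scale"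
  shows "\<exists>S \<in> poly_seq_ops scale. sheffer_generated scale S A B"
proof -
  have "\<exists>L \<in> lin_maps fun_scale (Sym scale n) fun_scale (Sym scale k).
      \<forall>v. L (tpow scale n v) = sheffer_coeff A B k n v" for k n
    by (rule hompoly_lift_exists[OF vector_space_fun_scale subspace_Sym
          hompoly_sheffer_coeff[OF F0D[OF A] F1D[OF B]] sheffer_coeff_in_Sym])
  then have ex: "\<exists>L. L \<in> lin_maps fun_scale (Sym scale n) fun_scale (Sym scale k) \<and>
      (\<forall>v. L (tpow scale n v) = sheffer_coeff A B k n v)" for k n
    by blast
  define Q where "Q k n = (SOME L. L \<in> lin_maps fun_scale (Sym scale n) fun_scale (Sym scale k) \<and>
      (\<forall>v. L (tpow scale n v) = sheffer_coeff A B k n v))" for k n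
  have Q: "Q k n \<in> lin_maps fun_scale (Sym scale n) fun_scale (Sym scale k)"
    "Q k n (tpow scale n v) = sheffer_coeff A B k n v" for k n v
    using someI_ex[OF ex[of n k]] by (simp_all add: Q_def)
  define T where "T = (\<lambda>n. \<lambda>f\<in>Sym scale n. \<Sum>k\<le>n. monom_poly scale k (Q k n f))"
  have "T n \<in> lin_maps fun_scale (Sym scale n) fun_scale (Polys scale)" for n
    unfolding T_def
    by (rule lin_maps_restrictI)
      (simp_all add: lin_maps_add[OF Q(1)] lin_maps_scale[OF Q(1)] monom_poly_add monom_poly_scale
        sum.distrib fun_space.scale_sum_right monom_poly_in_Polys lin_maps_in[OF Q(1)]
        fun_space.subspace_sum[OF subspace_Polys])
  from poly_maps_extension[of T, OF this]
  obtain S where S: "S \<in> poly_maps" "\<And>n f. f \<in> Sym scale n \<Longrightarrow> S (monom_poly scale n f) = T n f"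
    by blast
  have "sheffer_generated scale S A B"
    unfolding sheffer_generated_iff_expansion[OF S(1) A B] by (simp add: S(2) T_def Q(2))
  moreover have "S \<in> poly_seq_ops scale"
    unfolding poly_seq_ops_def
  proof (intro CollectI conjI exI[of _ Q] allI impI ballI)
    show "S \<in> poly_maps" by (rule S(1))
    show "Q k n \<in> lin_maps fun_scale (Sym scale n) fun_scale (Sym scale k)" for k n by (rule Q(1))
    obtain \<gamma> where \<gamma>: "Vector_Spaces.linear scale scale \<gamma>"
      "\<And>v. \<gamma> (B 1 (tpow scale 1 v)) = v" "\<And>v. B 1 (tpow scale 1 (\<gamma> v)) = v"
      using F1_inverse_linear[OF B] by (elim exE conjE) (rule that; blast)
    show "bij_betw (Q n n) (Sym scale n) (Sym scale n)" for n
    proof (rule bij_betw_Sym[OF Q(1) _ _ \<gamma>])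
      show "A 0 (tpow scale 0 0) \<noteq> 0" using F0_nth_0[OF A] by simp
      show "Q n n (tpow scale n v) = fun_scale (A 0 (tpow scale 0 0)) (tpow scale n (B 1 (tpow scale 1 v)))" for v
        by (simp add: Q(2) sheffer_coeff_diag) (simp add: tpow_def)
    qed
    show "S (monom_poly scale n f) \<omega> = (\<Sum>k\<le>n. dual_pair k \<omega> (Q k n f))"
      if "f \<in> Sym scale n" "\<omega> \<in> dual scale" for n f \<omega>
      using that by (simp add: S(2) T_def fun_apply monom_poly_apply)
  qed
  ultimately show ?thesis by blast
qed

section \<open>Closure under the Riordan product\<close>

lemma F0I: "A \<in> tseries scale (*) \<Longrightarrow> A 0 (tpow scale 0 0) \<noteq> 0 \<Longrightarrow> A \<in> F0 scale"
  by (simp add: F0_def series_at_0_def tpow_def)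

lemma F1I:
  assumes "B \<in> tseries scale scale" "B 0 (tpow scale 0 0) = 0" "bij (\<lambda>v. B 1 (tpow scale 1 v))"
  shows "B \<in> F1 scale"
proof -
  have "bij_betw (tpow scale 1) UNIV (Sym scale 1)"
    using inj_tpow_1 Sym_1 by (simp add: bij_betw_def)
  from bij_betw_comp_iff[OF this, of "B 1" UNIV] have "bij_betw (B 1) (Sym scale 1) UNIV"
    using assms(3) by (simp add: comp_def)
  then show ?thesis using assms(1,2) by (simp add: F1_def series_at_0_def tpow_def)
qed

lemma series_one_F0: "series_one scale \<in> F0 scale"
  using arg_cong[OF ev_series_one[of 0], of "\<lambda>f. fps_nth f 0"]
  by (intro F0I series_one_tseries) simp

lemma series_id_F1: "series_id scale \<in> F1 scale"
  by (intro F1I series_id_tseries) (simp_all add: series_id_tpow bij_id[unfolded id_def])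

lemma series_mult_F0:
  assumes "A \<in> F0 scale" "A' \<in> F0 scale"
  shows "series_mult scale A A' \<in> F0 scale"
proof (rule F0I)
  show "series_mult scale A A' \<in> tseries scale (*)"
    by (rule series_mult_tseries[OF assms[THEN F0D]])
  have "series_mult scale A A' 0 (tpow scale 0 0) = fps_nth (ev A 0) 0 * fps_nth (ev A' 0) 0"
    using arg_cong[OF ev_series_mult[OF assms[THEN F0D], of 0], of "\<lambda>f. fps_nth f 0"] by simp
  then show "series_mult scale A A' 0 (tpow scale 0 0) \<noteq> 0"
    using F0_nth_0[OF assms(1)] F0_nth_0[OF assms(2)] by simp
qed

lemma series_comp_F0:
  assumes "A \<in> F0 scale" "B \<in> F1 scale"
  shows "series_comp scale A B \<in> F0 scale"
proof (rule F0I)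
  show "series_comp scale A B \<in> tseries scale (*)"
    by (rule series_comp_tseries[OF vector_space_times F0D[OF assms(1)] F1D[OF assms(2)]])
  show "series_comp scale A B 0 (tpow scale 0 0) \<noteq> 0"
    using F0_nth_0[OF assms(1), of 0] by (simp add: series_comp_def)
qed

lemma series_comp_1:
  assumes "A \<in> tseries scale scale" "B \<in> tseries scale scale"
  shows "series_comp scale A B 1 (tpow scale 1 v) = A 1 (tpow scale 1 (B 1 (tpow scale 1 v)))"
proof -
  have "comp_coeff A b 1 1 = A 1 (tpow scale 1 (b 1))" for b
    unfolding comp_coeff_def comps_self using symtensor_replicate[of 1 "b 1"] by simp
  moreover have "{..1::nat} = {0, 1}" by auto
  ultimately show ?thesis
    using series_comp_tpow[OF vs assms, of 1 v] by (simp add: comp_coeff_0)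
qed

lemma series_comp_F1: "A \<in> F1 scale \<Longrightarrow> B \<in> F1 scale \<Longrightarrow> series_comp scale A B \<in> F1 scale"
proof (rule F1I)
  assume AB: "A \<in> F1 scale" "B \<in> F1 scale"
  show "series_comp scale A B \<in> tseries scale scale"
    by (rule series_comp_tseries[OF vs F1D[OF AB(1)] F1D[OF AB(2)]])
  show "series_comp scale A B 0 (tpow scale 0 0) = 0"
    using F1_at_0[OF AB(1)] by (simp add: series_comp_def)
  have "bij ((\<lambda>v. A 1 (tpow scale 1 v)) \<circ> (\<lambda>v. B 1 (tpow scale 1 v)))"
    by (intro bij_comp F1_linear AB)
  then show "bij (\<lambda>v. series_comp scale A B 1 (tpow scale 1 v))"
    unfolding series_comp_1[OF F1D[OF AB(1)] F1D[OF AB(2)]] by (simp only: comp_def)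
qed

section \<open>Composition of Sheffer operators\<close>

lemma poly_maps_compose:
  assumes "S \<in> poly_maps" "T \<in> poly_maps"
  shows "compose (Polys scale) S T \<in> poly_maps"
proof -
  note P = fun_space.subspace_add[OF subspace_Polys] fun_space.subspace_scale[OF subspace_Polys]
  show ?thesis
    unfolding lin_maps_def
    by (auto simp: compose_def P lin_maps_add[OF assms(1)] lin_maps_add[OF assms(2)]
        lin_maps_scale[OF assms(1)] lin_maps_scale[OF assms(2)] lin_maps_in[OF assms(1)]
        lin_maps_in[OF assms(2)])
qed

lemma comp_coeff_dual_pair:
  assumes "\<omega> \<in> dual scale"
  shows "comp_coeff (series_dual_pair scale \<omega> B) b m n = \<omega> (comp_coeff B b m n)"
  unfolding comp_coeff_def dual_apply_sum[OF assms]
  by (intro sum.cong) (auto simp: series_dual_pair_def symtensor_in_Sym)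

lemma compose_curve_dual_pair:
  assumes "\<omega> \<in> dual scale" "B1 \<in> tseries scale scale" "B2 \<in> tseries scale scale"
  shows "compose_curve (series_dual_pair scale \<omega> B1) (\<lambda>i. B2 i (tpow scale i v)) =
    ev (series_dual_pair scale \<omega> (series_comp scale B1 B2)) v"
  by (rule fps_ext)
    (simp add: compose_curve_def comp_coeff_dual_pair assms(1) series_comp_tpow[OF vs assms(2,3)]
      dual_apply_sum)

lemma poly_map_monom:
  "f \<in> Sym scale k \<Longrightarrow> S (monom_poly scale k f) \<omega> = fact k * generating_series scale S \<omega> k f"
  by (simp add: generating_series_def poly_seq_def)

text \<open>Up to factorials, this is the term of degree \<open>n\<close> of \<open>A(v) Z\<^sub>k(B(v)\<^bsup>\<odot>k\<^esup>)\<close>.\<close>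

lemma tseries_sheffer_coeff:
  assumes Z: "Z \<in> tseries scale (*)"
  shows "Z k (sheffer_coeff A B k n v) =
    fact n / fact k * (\<Sum>l\<le>n. A l (tpow scale l v) * comp_coeff Z (\<lambda>i. B i (tpow scale i v)) k (n - l))"
proof -
  note Zk = tseriesD[OF Z, of k]
  have Sy: "symtensor scale (map (\<lambda>i. B i (tpow scale i v)) is) \<in> Sym scale k" if "is \<in> comps k j" for "is" j
    using that by (auto intro: symtensor_in_Sym)
  have "Z k (sheffer_coeff A B k n v) = fact n / fact k * (\<Sum>l\<le>n. Z k (fun_scale (A l (tpow scale l v))
      (\<Sum>is\<in>comps k (n - l). symtensor scale (map (\<lambda>i. B i (tpow scale i v)) is))))"
    unfolding sheffer_coeff_def
    by (subst lin_maps_scale[OF Zk], intro Sym_sum Sym_scale Sy, assumption,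
        subst lin_maps_sum[OF Zk vector_space_times], intro Sym_sum Sym_scale Sy, assumption, rule refl)
  also have "\<dots> = fact n / fact k *
      (\<Sum>l\<le>n. A l (tpow scale l v) * comp_coeff Z (\<lambda>i. B i (tpow scale i v)) k (n - l))"
    unfolding comp_coeff_def
    by (simp only: lin_maps_scale[OF Zk] lin_maps_sum[OF Zk vector_space_times] Sy Sym_sum)
  finally show ?thesis .
qed

text \<open>For fixed \<open>\<omega>\<close> let \<open>Z(v)\<close> be the generating function of \<open>S\<close> at \<open>\<omega>\<close>. Linearity of \<open>S\<close> and the expansion of \<open>T\<close> give
\<open>Z(B\<^sub>2(v)) A\<^sub>2(v)\<close> for the generating function of the composition, and substitution of \<open>B\<^sub>2(v)\<close> respects the product and the
exponential in \<open>Z(v) = exp \<langle>\<omega>, B\<^sub>1(v)\<rangle> A\<^sub>1(v)\<close>.\<close>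

lemma sheffer_generated_compose:
  assumes S: "S \<in> poly_maps" "sheffer_generated scale S A1 B1" "A1 \<in> F0 scale" "B1 \<in> F1 scale"
    and T: "T \<in> poly_maps" "sheffer_generated scale T A2 B2" "A2 \<in> F0 scale" "B2 \<in> F1 scale"
  shows "sheffer_generated scale (compose (Polys scale) S T)
    (series_mult scale (series_comp scale A1 B2) A2) (series_comp scale B1 B2)"
proof -
  have A12: "series_comp scale A1 B2 \<in> tseries scale (*)"
    and A: "series_mult scale (series_comp scale A1 B2) A2 \<in> tseries scale (*)"
    and B: "series_comp scale B1 B2 \<in> tseries scale scale"
    using assms by (simp_all add: series_comp_tseries series_mult_tseries F0D F1D vector_space_times vs)
  show ?thesis
    unfolding sheffer_generated_iff[OF poly_maps_compose[OF S(1) T(1)] A B]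
  proof (intro ballI allI)
    fix \<omega> v assume \<omega>: "\<omega> \<in> dual scale"
    let ?b = "\<lambda>i. B2 i (tpow scale i v)"
    let ?Z = "generating_series scale S \<omega>" and ?C = "series_dual_pair scale \<omega> B1"
    have C: "?C \<in> tseries scale (*)" "series_at_0 scale ?C = 0"
      using series_dual_pair_tseries[OF \<omega> F1D[OF S(4)]] ev_dual_pair_nth_0[OF S(4) \<omega>, of 0]
      by (simp_all add: series_at_0_def tpow_def)
    have Z: "?Z \<in> tseries scale (*)" by (rule generating_series_tseries[OF S(1)])
    have "?Z = series_mult scale (series_exp scale ?C) A1"
      using S(2) \<omega> by (simp add: sheffer_generated_def)
    then have curve: "compose_curve ?Z ?b =
        fps_expo (ev (series_dual_pair scale \<omega> (series_comp scale B1 B2)) v) * ev (series_comp scale A1 B2) v"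
      using \<omega> S T by (simp add: compose_curve_mult series_exp_tseries C F0D compose_curve_exp
          compose_curve_dual_pair F1D ev_series_comp)
    have "ev (generating_series scale (compose (Polys scale) S T) \<omega>) v = compose_curve ?Z ?b * ev A2 v"
    proof (rule fps_ext)
      fix n
      have "T (monom_poly scale n (tpow scale n v)) = (\<Sum>k\<le>n. monom_poly scale k (sheffer_coeff A2 B2 k n v))"
        using T(2) by (simp add: sheffer_generated_iff_expansion[OF T(1,3,4)])
      then have "compose (Polys scale) S T (monom_poly scale n (tpow scale n v)) =
          (\<Sum>k\<le>n. S (monom_poly scale k (sheffer_coeff A2 B2 k n v)))"
        by (simp add: compose_def monom_poly_in_Polys lin_maps_sum_subspace[OF S(1) vector_space_fun_scale subspace_Polys]
            sheffer_coeff_in_Sym)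
      then have "fact n * fps_nth (ev (generating_series scale (compose (Polys scale) S T) \<omega>) v) n =
          (\<Sum>k\<le>n. fact k * ?Z k (sheffer_coeff A2 B2 k n v))"
        by (simp add: generating_series_tpow fun_apply poly_map_monom sheffer_coeff_in_Sym)
      also have "\<dots> = fact n * (\<Sum>k\<le>n. \<Sum>l\<le>n. A2 l (tpow scale l v) * comp_coeff ?Z ?b k (n - l))"
        by (simp add: tseries_sheffer_coeff[OF Z] sum_distrib_left)
      also have "(\<Sum>k\<le>n. \<Sum>l\<le>n. A2 l (tpow scale l v) * comp_coeff ?Z ?b k (n - l)) =
          (\<Sum>l\<le>n. A2 l (tpow scale l v) * (\<Sum>k\<le>n. comp_coeff ?Z ?b k (n - l)))"
        by (subst sum.swap) (simp add: sum_distrib_left)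
      also have "\<dots> = fps_nth (ev A2 v * compose_curve ?Z ?b) n"
        by (simp add: fps_mult_nth atLeast0AtMost compose_curve_nth_le[where N = n])
      finally show "fps_nth (ev (generating_series scale (compose (Polys scale) S T) \<omega>) v) n =
          fps_nth (compose_curve ?Z ?b * ev A2 v) n"
        by (simp add: mult.commute)
    qed
    then show "ev (generating_series scale (compose (Polys scale) S T) \<omega>) v =
        fps_expo (ev (series_dual_pair scale \<omega> (series_comp scale B1 B2)) v) *
        ev (series_mult scale (series_comp scale A1 B2) A2) v"
      by (simp add: curve ev_series_mult[OF A12 F0D[OF T(3)]] mult.assoc)
  qed
qed

lemma poly_maps_id: "(\<lambda>p\<in>Polys scale. p) \<in> poly_maps"
  unfolding lin_maps_def
  by (auto simp: fun_space.subspace_add[OF subspace_Polys] fun_space.subspace_scale[OF subspace_Polys])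

lemma sheffer_generated_id:
  "sheffer_generated scale (\<lambda>p\<in>Polys scale. p) (series_one scale) (series_id scale)"
  unfolding sheffer_generated_iff[OF poly_maps_id series_one_tseries series_id_tseries]
proof (intro ballI allI fps_ext)
  fix \<omega> v n assume \<omega>: "\<omega> \<in> dual scale"
  then have "\<omega> 0 = 0" by (simp add: dual_iff) (metis add_cancel_right_right)
  then have "ev (series_dual_pair scale \<omega> (series_id scale)) v = fps_const (\<omega> v) * fps_X"
    by (intro fps_ext) (simp add: series_id_tpow)
  then have "fps_nth (fps_expo (ev (series_dual_pair scale \<omega> (series_id scale)) v)) n =
      (\<Sum>k\<le>n. if k = n then \<omega> v ^ k / fact k else 0)"
    unfolding fps_expo_nth by (intro sum.cong) (auto simp: power_mult_distrib fps_const_power)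
  then show "fps_nth (ev (generating_series scale (\<lambda>p\<in>Polys scale. p) \<omega>) v) n =
      fps_nth (fps_expo (ev (series_dual_pair scale \<omega> (series_id scale)) v) * ev (series_one scale) v) n"
    using \<omega> by (simp add: ev_series_one generating_series_tpow monom_poly_in_Polys monom_poly_apply dual_pair_tpow)
qed

section \<open>Solving for a left factor\<close>

lemma hompoly_comp_coeff:
  assumes "vector_space sW" "A m \<in> lin_maps fun_scale (Sym scale m) sW UNIV" "B \<in> tseries scale scale"
  shows "hompoly sW n (\<lambda>v. comp_coeff A (\<lambda>i. B i (tpow scale i v)) m n)"
  unfolding comp_coeff_def
proof (rule hompoly_sum[OF assms(1)])
  fix js assume js: "js \<in> comps m n"
  let ?ps = "map (\<lambda>i. (i, \<lambda>v. B i (tpow scale i v))) js"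
  have "hompoly sW (sum_list (map fst ?ps)) (\<lambda>v. (\<lambda>xs. if length xs = m then A m (symtensor scale xs) else 0)
      (map (\<lambda>p. snd p v) ?ps))"
    using multilinear_lin_maps[OF assms(1,2)] js
    by (intro hompoly_multilinear_comp[where sU = scale])
      (auto intro!: hompoly_lin_maps[OF vs tseriesD[OF assms(3)]])
  then show "hompoly sW n (\<lambda>v. A m (symtensor scale (map (\<lambda>i. B i (tpow scale i v)) js)))"
    using js by (simp add: comp_def)
qed

text \<open>Coefficients may be chosen one after the other, as long as the prescribed value in degree \<open>n\<close> is a homogeneous polynomial
in \<open>v\<close> that depends only on lower coefficients.\<close>

lemma tseries_recursion:
  fixes R :: "('f, 'v, 'w::ab_group_add) tseries \<Rightarrow> nat \<Rightarrow> 'v \<Rightarrow> 'w"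
  assumes "vector_space sW"
    and cong: "\<And>G H n v. (\<And>m. m < n \<Longrightarrow> G m = H m) \<Longrightarrow> R G n v = R H n v"
    and hom: "\<And>G n. (\<And>m. m < n \<Longrightarrow> G m \<in> lin_maps fun_scale (Sym scale m) sW UNIV) \<Longrightarrow> hompoly sW n (R G n)"
  shows "\<exists>G\<in>tseries scale sW. \<forall>n v. G n (tpow scale n v) = R G n v"
proof -
  define P where "P = (\<lambda>(G :: ('f, 'v, 'w) tseries) n L. L \<in> lin_maps fun_scale (Sym scale n) sW UNIV \<and>
      (\<forall>v. L (tpow scale n v) = R G n v))"
  have "\<exists>G. \<forall>n. P G n (G n)"
  proof (rule dependent_wf_choice[OF wf_less_than])
    fix G H :: "('f, 'v, 'w) tseries" and n L
    assume "\<And>m. (m, n) \<in> less_than \<Longrightarrow> G m = H m"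
    then have "R G n v = R H n v" for v by (intro cong) auto
    then show "P G n L = P H n L" by (simp add: P_def)
  next
    fix G n assume "\<And>m. (m, n) \<in> less_than \<Longrightarrow> P G m (G m)"
    then have "hompoly sW n (R G n)" by (intro hom) (auto simp: P_def)
    from hompoly_lift_exists[OF assms(1) subspace_UNIV_of[OF assms(1)] this]
    show "\<exists>L. P G n L" by (auto simp: P_def)
  qed
  then show ?thesis by (auto simp: P_def tseries_def)
qed

text \<open>In degree \<open>n\<close> the unknown \<open>G\<^sub>n\<close> occurs only through \<open>G\<^sub>n (B\<^sub>1 v)\<^bsup>\<otimes>n\<^esup>\<close>, all other terms having smaller index \<open>m\<close>. As \<open>B\<^sub>1\<close> is invertible,
replacing \<open>v\<close> by its preimage under \<open>B\<^sub>1\<close> solves the equation for \<open>G\<^sub>n\<close>.\<close>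

lemma series_comp_solve_left:
  assumes "vector_space sW" "H \<in> tseries scale sW" "B \<in> F1 scale"
  shows "\<exists>G\<in>tseries scale sW. series_comp scale G B = H"
proof -
  obtain \<gamma> where \<gamma>: "Vector_Spaces.linear scale scale \<gamma>"
    "\<And>v. \<gamma> (B 1 (tpow scale 1 v)) = v" "\<And>v. B 1 (tpow scale 1 (\<gamma> v)) = v"
    using F1_inverse_linear[OF assms(3)] by (elim exE conjE) (rule that; blast)
  let ?b = "\<lambda>v i. B i (tpow scale i v)"
  define R where "R = (\<lambda>G n v. H n (tpow scale n (\<gamma> v)) - (\<Sum>m<n. comp_coeff G (?b (\<gamma> v)) m n))"
  have "\<exists>G\<in>tseries scale sW. \<forall>n v. G n (tpow scale n v) = R G n v"
  proof (rule tseries_recursion[OF assms(1)])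
    show "R G n v = R Z n v" if "\<And>m. m < n \<Longrightarrow> G m = Z m" for G Z n v
      using that by (simp add: R_def comp_coeff_def)
    show "hompoly sW n (R G n)"
      if "\<And>m. m < n \<Longrightarrow> G m \<in> lin_maps fun_scale (Sym scale m) sW UNIV" for G n
    proof -
      have "hompoly sW n (\<lambda>v. H n (tpow scale n v) - (\<Sum>m<n. comp_coeff G (?b v) m n))"
        using that by (intro hompoly_diff assms(1) hompoly_sum hompoly_comp_coeff F1D[OF assms(3)]
          hompoly_lin_maps[OF assms(1) tseriesD[OF assms(2)]]) auto
      from hompoly_comp_linear[OF this \<gamma>(1)] show ?thesis by (simp add: R_def)
    qed
  qed
  then obtain G where G: "G \<in> tseries scale sW" "\<And>n v. G n (tpow scale n v) = R G n v"
    by blast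
  have "series_comp scale G B = H"
  proof (rule tseries_ext[OF series_comp_tseries[OF assms(1) G(1) F1D[OF assms(3)]] assms(2)])
    fix n v
    have "comp_coeff G (?b v) n n = G n (tpow scale n (?b v 1))"
      unfolding comp_coeff_def comps_self by (simp add: symtensor_replicate)
    also have "\<dots> = H n (tpow scale n v) - (\<Sum>m<n. comp_coeff G (?b v) m n)"
      using G(2)[of n "?b v 1"] by (simp only: R_def \<gamma>(2))
    finally show "series_comp scale G B n (tpow scale n v) = H n (tpow scale n v)"
      by (simp add: series_comp_tpow[OF assms(1) G(1) F1D[OF assms(3)]] lessThan_Suc_atMost[symmetric])
  qed
  then show ?thesis using G(1) by blast
qed

lemma F0_inverse:
  assumes "A \<in> F0 scale"
  shows "\<exists>G\<in>tseries scale (*). series_mult scale G A = series_one scale"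
proof -
  define a0 where "a0 = A 0 (tpow scale 0 0)"
  have a0: "a0 \<noteq> 0" using F0_nth_0[OF assms, of 0] by (simp add: a0_def)
  define R where "R = (\<lambda>G n v. inverse a0 * ((if n = 0 then 1 else 0) -
      (\<Sum>m<n. G m (tpow scale m v) * A (n - m) (tpow scale (n - m) v))))"
  have "\<exists>G\<in>tseries scale (*). \<forall>n v. G n (tpow scale n v) = R G n v"
  proof (rule tseries_recursion[OF vector_space_times])
    show "R G n v = R Z n v" if "\<And>m. m < n \<Longrightarrow> G m = Z m" for G Z n v
      using that by (simp add: R_def)
    show "hompoly (*) n (R G n)"
      if G: "\<And>m. m < n \<Longrightarrow> G m \<in> lin_maps fun_scale (Sym scale m) (*) UNIV" for G n
    proof -
      have "hompoly (*) n (\<lambda>v. G m (tpow scale m v) * A (n - m) (tpow scale (n - m) v))" if "m < n" for m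
        using hompoly_mult[OF vector_space_times hompoly_lin_maps[OF vector_space_times G[OF that]]
          hompoly_lin_maps[OF vector_space_times tseriesD[OF F0D[OF assms]]], of "n - m"] that by simp
      then show ?thesis
        unfolding R_def
        by (intro hompoly_scale hompoly_diff hompoly_sum hompoly_delta hompoly_const vector_space_times) auto
    qed
  qed
  then obtain G where G: "G \<in> tseries scale (*)" "\<And>n v. G n (tpow scale n v) = R G n v"
    by blast
  have "series_mult scale G A = series_one scale"
  proof (rule ev_eqI[OF series_mult_tseries[OF G(1) F0D[OF assms]] series_one_tseries], rule fps_ext)
    fix v n
    have "A 0 (tpow scale 0 v) = a0" by (simp add: a0_def tpow_def)
    then have "fps_nth (ev G v * ev A v) n =
        (\<Sum>m<n. G m (tpow scale m v) * A (n - m) (tpow scale (n - m) v)) + R G n v * a0"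
      by (simp add: fps_mult_nth atLeast0AtMost lessThan_Suc_atMost[symmetric] G(2)[of n v])
    also have "\<dots> = fps_nth 1 n" using a0 by (simp add: R_def)
    finally show "fps_nth (ev (series_mult scale G A) v) n = fps_nth (ev (series_one scale) v) n"
      by (simp add: ev_series_mult G(1) F0D assms ev_series_one)
  qed
  then show ?thesis using G(1) by blast
qed

lemma F0_if_mult_F0:
  assumes "G \<in> tseries scale (*)" "A \<in> tseries scale (*)" "series_mult scale G A \<in> F0 scale"
  shows "G \<in> F0 scale"
  using F0_nth_0[OF assms(3), of 0] by (intro F0I assms(1)) (auto simp: ev_series_mult[OF assms(1,2)])

lemma F1_left_inverse:
  assumes "B \<in> F1 scale"
  shows "\<exists>G\<in>F1 scale. series_comp scale G B = series_id scale"
proof -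
  obtain G where G: "G \<in> tseries scale scale" "series_comp scale G B = series_id scale"
    using series_comp_solve_left[OF vs series_id_tseries assms] by blast
  obtain \<gamma> where "Vector_Spaces.linear scale scale \<gamma>"
    and \<gamma>: "\<And>v. \<gamma> (B 1 (tpow scale 1 v)) = v" "\<And>v. B 1 (tpow scale 1 (\<gamma> v)) = v"
    using F1_inverse_linear[OF assms] by (elim exE conjE) (rule that; blast)
  have "G 1 (tpow scale 1 v) = \<gamma> v" for v
  proof -
    have "G 1 (tpow scale 1 v) = G 1 (tpow scale 1 (B 1 (tpow scale 1 (\<gamma> v))))"
      by (simp only: \<gamma>(2))
    also have "\<dots> = series_comp scale G B 1 (tpow scale 1 (\<gamma> v))"
      by (rule series_comp_1[OF G(1) F1D[OF assms], symmetric])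
    also have "\<dots> = \<gamma> v" by (simp only: G(2) series_id_tpow if_True simp_thms)
    finally show ?thesis .
  qed
  moreover have "bij \<gamma>" using \<gamma> by (intro o_bij[of "\<lambda>v. B 1 (tpow scale 1 v)"]) (simp_all only: fun_eq_iff o_apply id_apply simp_thms)
  moreover have "G 0 (tpow scale 0 0) = 0"
    using fun_cong[OF G(2), of 0] series_id_tpow[of 0 0] by (simp add: series_comp_def)
  ultimately have "G \<in> F1 scale" by (intro F1I G(1)) simp_all
  then show ?thesis using G(2) by blast
qed

section \<open>Umbral operators\<close>

lemma poly_seq_tpow: "poly_seq scale S n \<omega> (tpow scale n v) = fact n * fps_nth (ev (generating_series scale S \<omega>) v) n"
  by (simp add: generating_series_def)

lemma binomial_identity_iff:
  assumes S: "S \<in> poly_maps"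
  shows "(\<forall>t\<in>Sym scale n. poly_seq scale S n (\<omega> + \<theta>) t = (\<Sum>k\<le>n. of_nat (n choose k) *
      odot_fun scale k (n - k) (poly_seq scale S k \<omega>) (poly_seq scale S (n - k) \<theta>) t)) \<longleftrightarrow>
    (\<forall>v. fps_nth (ev (generating_series scale S (\<omega> + \<theta>)) v) n =
      fps_nth (ev (generating_series scale S \<omega>) v * ev (generating_series scale S \<theta>) v) n)"
proof -
  let ?G = "\<lambda>\<omega>. ev (generating_series scale S \<omega>)"
  note P = poly_seq_lin_maps[OF S]
  let ?R = "\<lambda>t\<in>Sym scale n. \<Sum>k\<le>n. of_nat (n choose k) *
      odot_fun scale k (n - k) (poly_seq scale S k \<omega>) (poly_seq scale S (n - k) \<theta>) t"
  have o: "odot_fun scale k (n - k) (poly_seq scale S k \<omega>) (poly_seq scale S (n - k) \<theta>) \<in>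
      lin_maps fun_scale (Sym scale n) (*) UNIV" if "k \<le> n" for k
    using odot_fun_lin_maps[OF P P, of k "n - k"] that by simp
  have R: "?R \<in> lin_maps fun_scale (Sym scale n) (*) UNIV"
    by (rule lin_maps_restrictI)
      (simp_all add: lin_maps_add[OF o] lin_maps_scale[OF o] algebra_simps sum.distrib sum_distrib_left)
  have R_tpow: "?R (tpow scale n v) = fact n * fps_nth (?G \<omega> v * ?G \<theta> v) n" for v
  proof -
    have "of_nat (n choose k) * odot_fun scale k (n - k) (poly_seq scale S k \<omega>) (poly_seq scale S (n - k) \<theta>) (tpow scale n v)
      = fact n * (fps_nth (?G \<omega> v) k * fps_nth (?G \<theta> v) (n - k))" if "k \<le> n" for k
    proof -
      have "fact n = of_nat (n choose k) * (fact k * fact (n - k) :: 'f)"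
        using binomial_fact_lemma[OF that, THEN arg_cong, of "of_nat :: nat \<Rightarrow> 'f"]
        by (simp add: mult_ac)
      then show ?thesis
        using odot_fun_tpow[OF P P, of k "n - k"] that by (simp add: poly_seq_tpow del: ev_nth)
    qed
    then show ?thesis
      by (simp add: fps_mult_nth atLeast0AtMost sum_distrib_left del: ev_nth)
  qed
  have "(\<forall>t\<in>Sym scale n. poly_seq scale S n (\<omega> + \<theta>) t = ?R t) \<longleftrightarrow>
      (\<forall>v. poly_seq scale S n (\<omega> + \<theta>) (tpow scale n v) = ?R (tpow scale n v))"
  proof
    assume "\<forall>v. poly_seq scale S n (\<omega> + \<theta>) (tpow scale n v) = ?R (tpow scale n v)"
    then have "poly_seq scale S n (\<omega> + \<theta>) = ?R" by (intro lin_maps_ext[OF P R]) blast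
    then show "\<forall>t\<in>Sym scale n. poly_seq scale S n (\<omega> + \<theta>) t = ?R t" by simp
  qed (use tpow_in_Sym in blast)
  then have "(\<forall>t\<in>Sym scale n. poly_seq scale S n (\<omega> + \<theta>) t = ?R t) \<longleftrightarrow>
      (\<forall>v. fact n * fps_nth (?G (\<omega> + \<theta>) v) n = fact n * fps_nth (?G \<omega> v * ?G \<theta> v) n)"
    unfolding R_tpow poly_seq_tpow .
  then show ?thesis by (simp del: ev_nth)
qed

text \<open>Divided by \<open>n!\<close>, the binomial identities say that the generating function at \<open>\<omega> + \<theta>\<close> is the product of those at
\<open>\<omega>\<close> and at \<open>\<theta>\<close>. The normalization covers the remaining degree \<open>n = 0\<close>.\<close>

lemma umbral_ops_iff_multiplicative:
  "S \<in> umbral_ops scale \<longleftrightarrow> S \<in> poly_seq_ops scale \<and>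
    (\<forall>\<omega>\<in>dual scale. \<forall>v. fps_nth (ev (generating_series scale S \<omega>) v) 0 = 1) \<and>
    (\<forall>\<omega>\<in>dual scale. \<forall>\<theta>\<in>dual scale. \<forall>v. ev (generating_series scale S (\<omega> + \<theta>)) v =
      ev (generating_series scale S \<omega>) v * ev (generating_series scale S \<theta>) v)"
proof -
  let ?G = "\<lambda>\<omega>. ev (generating_series scale S \<omega>)"
  have zero: "poly_seq scale S 0 \<omega> (tensor scale []) = fps_nth (?G \<omega> v) 0" for \<omega> v
    using poly_seq_tpow[of S 0 \<omega> v] by (simp add: tpow_def del: ev_nth)
  have "(\<forall>n\<ge>1. \<forall>v. fps_nth (?G (\<omega> + \<theta>) v) n = fps_nth (?G \<omega> v * ?G \<theta> v) n) \<longleftrightarrow>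
      (\<forall>v. ?G (\<omega> + \<theta>) v = ?G \<omega> v * ?G \<theta> v)"
    if "\<forall>\<omega>\<in>dual scale. \<forall>v. fps_nth (?G \<omega> v) 0 = 1" "\<omega> \<in> dual scale" "\<theta> \<in> dual scale" for \<omega> \<theta>
  proof
    assume *: "\<forall>n\<ge>1. \<forall>v. fps_nth (?G (\<omega> + \<theta>) v) n = fps_nth (?G \<omega> v * ?G \<theta> v) n"
    show "\<forall>v. ?G (\<omega> + \<theta>) v = ?G \<omega> v * ?G \<theta> v"
    proof (intro allI fps_ext)
      fix v n show "fps_nth (?G (\<omega> + \<theta>) v) n = fps_nth (?G \<omega> v * ?G \<theta> v) n"
        using * that dual_add[OF that(2,3)] by (cases "n = 0") (simp_all del: ev_nth)
    qed
  qed simp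
  then show ?thesis
    unfolding umbral_ops_def using binomial_identity_iff[OF poly_seq_ops_maps] zero
    by (simp del: ev_nth cong: conj_cong)
qed

text \<open>A normalized one-parameter family \<open>G(c)\<close> of power series that depends polynomially on \<open>c\<close>, with \<open>g\<^sub>k\<close> the coefficient of \<open>c\<^bsup>k\<^esup>\<close>, and
turns sums into products is \<open>exp(c g\<^sub>1)\<close>: comparing the coefficients of \<open>a\<^bsup>k\<^esup> b\<close> in \<open>G(a + b) = G(a) G(b)\<close> gives
\<open>(k + 1) g\<^bsub>k+1\<^esub> = g\<^sub>k g\<^sub>1\<close>, hence \<open>k! g\<^sub>k = g\<^sub>1\<^bsup>k\<^esup>\<close>. The lemma records the value at \<open>c = 1\<close>.\<close>

lemma multiplicative_imp_expo:
  fixes g :: "nat \<Rightarrow> 'f fps"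
  assumes g: "\<And>k n. n < k \<Longrightarrow> fps_nth (g k) n = 0"
    and G: "\<And>c n. fps_nth (G c) n = (\<Sum>k\<le>n. fps_nth (g k) n * c ^ k)"
    and mult: "\<And>a b. G (a + b) = G a * G b" and one: "fps_nth (G 0) 0 = 1"
  shows "G 1 = fps_expo (g 1)"
proof -
  have G_le: "fps_nth (G c) m = (\<Sum>k\<le>n. fps_nth (g k) m * c ^ k)" if "m \<le> n" for c m n
    unfolding G using that by (intro sum.mono_neutral_left) (auto simp: g)
  have "G 0 = g 0"
    by (rule fps_ext) (simp add: G power_0_left if_distrib cong: if_cong)
  moreover have "G 0 = G 0 * G 0" using mult[of 0 0] by simp
  moreover have "G 0 \<noteq> 0" using one by auto
  ultimately have g0: "g 0 = 1" by simp
  have coeff: "fps_nth (of_nat (Suc k) * g (Suc k)) n = fps_nth (g k * g 1) n" for k n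
  proof (cases "k \<le> n \<and> n \<noteq> 0")
    case True
    have G_n: "fps_nth (G c) m = (\<Sum>k\<le>n. fps_nth (g k) m * c ^ k)" if "m \<le> n" for c m
      by (rule G_le[OF that])
    have *: "(\<Sum>j\<le>n. (of_nat (Suc j) * fps_nth (g (Suc j)) n - fps_nth (g j * g 1) n) * a ^ j) = 0" for a
    proof -
      \<comment> \<open>The difference \<open>G(a + b) - G(a) G(b)\<close> in degree \<open>n\<close>, as a polynomial in \<open>b\<close>; its linear coefficient is compared.\<close>
      define p where "p = (\<Sum>k\<le>n. Polynomial.smult (fps_nth (g k) n) ([:a, 1:] ^ k)) -
          (\<Sum>k\<le>n. Polynomial.monom (\<Sum>j\<le>n. fps_nth (G a) j * fps_nth (g k) (n - j)) k)"
      have "poly p b = 0" for b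
      proof -
        have "poly p b = fps_nth (G (a + b)) n - (\<Sum>k\<le>n. (\<Sum>j\<le>n. fps_nth (G a) j * fps_nth (g k) (n - j)) * b ^ k)"
          by (simp add: p_def poly_sum poly_monom G)
        also have "(\<Sum>k\<le>n. (\<Sum>j\<le>n. fps_nth (G a) j * fps_nth (g k) (n - j)) * b ^ k) =
            (\<Sum>j\<le>n. fps_nth (G a) j * (\<Sum>k\<le>n. fps_nth (g k) (n - j) * b ^ k))"
          unfolding sum_distrib_right sum_distrib_left by (subst sum.swap) (simp add: mult_ac)
        also have "\<dots> = fps_nth (G a * G b) n"
          by (simp add: fps_mult_nth atLeast0AtMost G_n)
        finally show ?thesis by (simp add: mult)
      qed
      then have "p = 0" by (intro poly_ext) simp
      have "poly.coeff ([:a, 1:] ^ k) 1 = of_nat k * a ^ (k - 1)" for k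
        by (cases k) (simp_all add: coeff_linear_poly_power del: power_Suc)
      then have coeff: "poly.coeff p 1 = (\<Sum>k\<le>n. fps_nth (g k) n * (of_nat k * a ^ (k - 1))) -
          (\<Sum>j\<le>n. fps_nth (G a) j * fps_nth (g 1) (n - j))"
        using True by (simp add: p_def Polynomial.coeff_sum)
      have "(\<Sum>k\<le>n. fps_nth (g k) n * (of_nat k * a ^ (k - 1))) =
          (\<Sum>k\<le>Suc n. fps_nth (g k) n * (of_nat k * a ^ (k - 1)))"
        by (simp add: g)
      also have "\<dots> = (\<Sum>j\<le>n. of_nat (Suc j) * fps_nth (g (Suc j)) n * a ^ j)"
        by (subst sum.atMost_Suc_shift) (simp add: mult_ac)
      finally have left: "(\<Sum>k\<le>n. fps_nth (g k) n * (of_nat k * a ^ (k - 1))) =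
          (\<Sum>j\<le>n. of_nat (Suc j) * fps_nth (g (Suc j)) n * a ^ j)" .
      have "(\<Sum>j\<le>n. fps_nth (G a) j * fps_nth (g 1) (n - j)) =
          (\<Sum>j\<le>n. \<Sum>k\<le>n. fps_nth (g k) j * a ^ k * fps_nth (g 1) (n - j))"
        by (simp add: G_n sum_distrib_right)
      also have "\<dots> = (\<Sum>k\<le>n. fps_nth (g k * g 1) n * a ^ k)"
        by (subst sum.swap) (simp add: fps_mult_nth atLeast0AtMost sum_distrib_left mult_ac)
      finally have right: "(\<Sum>j\<le>n. fps_nth (G a) j * fps_nth (g 1) (n - j)) =
          (\<Sum>k\<le>n. fps_nth (g k * g 1) n * a ^ k)" .
      have "(\<Sum>j\<le>n. (of_nat (Suc j) * fps_nth (g (Suc j)) n - fps_nth (g j * g 1) n) * a ^ j) = poly.coeff p 1"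
        unfolding coeff left right by (simp only: left_diff_distrib sum_subtractf)
      then show ?thesis using \<open>p = 0\<close> by simp
    qed
    show ?thesis
      using poly_fun_zero_imp_coeffs_zero[where n = n and k = k and c = "\<lambda>j. of_nat (Suc j) * fps_nth (g (Suc j)) n - fps_nth (g j * g 1) n"] * True
      by (simp add: fps_of_nat[symmetric] del: of_nat_Suc)
  next
    case False
    then have "n < k \<or> n = 0" by auto
    then have "fps_nth (g k * g 1) n = 0"
      by (auto simp: fps_mult_nth g intro!: sum.neutral)
    moreover have "fps_nth (g (Suc k)) n = 0" using False by (intro g) auto
    ultimately show ?thesis by (simp add: fps_of_nat[symmetric] del: of_nat_Suc)
  qed
  have pow: "of_nat (fact k) * g k = g 1 ^ k" for k
  proof (induction k)
    case (Suc k)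
    have "of_nat (Suc k) * g (Suc k) = g k * g 1" by (rule fps_ext) (rule coeff)
    moreover have "of_nat (fact (Suc k)) * g (Suc k) = of_nat (fact k) * (of_nat (Suc k) * g (Suc k))"
      by (simp only: fact_Suc of_nat_mult of_nat_id mult_ac)
    ultimately have "of_nat (fact (Suc k)) * g (Suc k) = of_nat (fact k) * g k * g 1"
      by (simp only: mult.assoc)
    then show ?case by (simp only: Suc.IH power_Suc2)
  qed (simp add: g0)
  show ?thesis
  proof (rule fps_ext)
    fix n
    have "fps_nth (g 1 ^ k) n = fact k * fps_nth (g k) n" for k
      using arg_cong[OF pow[of k], of "\<lambda>f. fps_nth f n"]
      by (simp add: fps_of_nat[symmetric])
    then show "fps_nth (G 1) n = fps_nth (fps_expo (g 1)) n"
      by (simp add: G fps_expo_nth)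
  qed
qed

lemma dual_pair_1: 
  assumes "u \<in> Sym scale 1" "\<omega> \<in> dual scale"
  shows "\<omega> (Hilbert_Choice.inv (tpow scale 1) u) = dual_pair 1 \<omega> u"
proof -
  obtain v where "u = tpow scale 1 v" using assms(1) Sym_1 by auto
  then show ?thesis using dual_pair_tpow[OF assms(2), of 1 v] by (simp only: inv_f_f[OF inj_tpow_1] power_one_right)
qed

text \<open>Along the line \<open>c \<mapsto> c \<omega>\<close> the generating function satisfies the hypotheses of \<open>multiplicative_imp_expo\<close>. So it is the
exponential of its part of degree one in \<open>\<omega>\<close>, and that part is given by \<open>Q\<^bsub>1n\<^esub>\<close>, whose values lie in the
first symmetric power, a copy of \<open>V\<close>.\<close>

lemma umbral_imp_sheffer:
  assumes "S \<in> umbral_ops scale"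
  shows "\<exists>B\<in>F1 scale. sheffer_generated scale S (series_one scale) B"
proof -
  have S: "S \<in> poly_seq_ops scale" "S \<in> poly_maps"
    and one: "\<And>\<omega> v. \<omega> \<in> dual scale \<Longrightarrow> fps_nth (ev (generating_series scale S \<omega>) v) 0 = 1"
    and mult: "\<And>\<omega> \<theta> v. \<omega> \<in> dual scale \<Longrightarrow> \<theta> \<in> dual scale \<Longrightarrow>
      ev (generating_series scale S (\<omega> + \<theta>)) v =
      ev (generating_series scale S \<omega>) v * ev (generating_series scale S \<theta>) v"
    using assms poly_seq_ops_maps unfolding umbral_ops_iff_multiplicative by blast+
  obtain Q where Q: "\<And>k n. k \<le> n \<Longrightarrow> Q k n \<in> lin_maps fun_scale (Sym scale n) fun_scale (Sym scale k)"
    and bij: "\<And>n. bij_betw (Q n n) (Sym scale n) (Sym scale n)"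
    and SQ: "\<And>n f \<omega>. f \<in> Sym scale n \<Longrightarrow> \<omega> \<in> dual scale \<Longrightarrow>
      S (monom_poly scale n f) \<omega> = (\<Sum>k\<le>n. dual_pair k \<omega> (Q k n f))"
    using S(1) unfolding poly_seq_ops_def by blast
  define \<iota> where "\<iota> = Hilbert_Choice.inv (tpow scale 1)"
  have \<iota>: "\<omega> (\<iota> u) = dual_pair 1 \<omega> u" if "u \<in> Sym scale 1" "\<omega> \<in> dual scale" for u \<omega>
    unfolding \<iota>_def by (rule dual_pair_1[OF that])
  have \<iota>_add: "\<iota> (s + t) = \<iota> s + \<iota> t" if "s \<in> Sym scale 1" "t \<in> Sym scale 1" for s t
  proof (rule dual_separates)
    fix \<omega> assume "\<omega> \<in> dual scale"
    then show "\<omega> (\<iota> (s + t)) = \<omega> (\<iota> s + \<iota> t)"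
      using \<iota>[OF Sym_add[OF that]] \<iota>[OF that(1)] \<iota>[OF that(2)] by (simp add: dual_iff dual_pair_add)
  qed
  have \<iota>_scale: "\<iota> (fun_scale c t) = scale c (\<iota> t)" if "t \<in> Sym scale 1" for c t
  proof (rule dual_separates)
    fix \<omega> assume "\<omega> \<in> dual scale"
    then show "\<omega> (\<iota> (fun_scale c t)) = \<omega> (scale c (\<iota> t))"
      using \<iota>[OF Sym_scale[OF that]] \<iota>[OF that] by (simp add: dual_iff dual_pair_scale)
  qed
  \<comment> \<open>There is no \<open>Q\<^bsub>kn\<^esub>\<close> with \<open>k > n\<close>, so degree zero is set to \<open>0\<close>, the value that \<open>B(0) = 0\<close> demands.\<close>
  define B where "B = (\<lambda>n. \<lambda>t\<in>Sym scale n. if n = 0 then 0 else scale (1 / fact n) (\<iota> (Q 1 n t)))"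
  have B: "B \<in> tseries scale scale"
  proof -
    have "B n \<in> lin_maps fun_scale (Sym scale n) scale UNIV" for n
    proof (cases "n = 0")
      case False
      then have Q1: "Q 1 n \<in> lin_maps fun_scale (Sym scale n) fun_scale (Sym scale 1)" by (intro Q) simp
      show ?thesis
        unfolding B_def
        by (rule lin_maps_restrictI)
          (simp_all only: False if_False UNIV_I lin_maps_add[OF Q1] lin_maps_scale[OF Q1]
            lin_maps_in[OF Q1] \<iota>_add \<iota>_scale scale_right_distrib scale_left_commute)
    qed (auto simp: B_def intro: lin_maps_restrictI)
    then show ?thesis by (simp add: tseries_def)
  qed
  have "B \<in> F1 scale"
  proof -
    have "bij_betw (tpow scale 1) UNIV (Sym scale 1)"
      using inj_tpow_1 Sym_1 by (simp add: bij_betw_def)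
    then have "bij_betw \<iota> (Sym scale 1) UNIV" unfolding \<iota>_def by (rule bij_betw_inv_into)
    then have "bij_betw (\<iota> \<circ> Q 1 1) (Sym scale 1) UNIV" by (rule bij_betw_trans[OF bij])
    moreover have "bij_betw (B 1) (Sym scale 1) UNIV \<longleftrightarrow> bij_betw (\<iota> \<circ> Q 1 1) (Sym scale 1) UNIV"
      by (rule bij_betw_cong) (simp add: B_def)
    ultimately have "bij_betw (B 1) (Sym scale 1) UNIV" by simp
    moreover have "series_at_0 scale B = 0"
      using tpow_in_Sym[of 0 0] by (simp add: series_at_0_def B_def tpow_def)
    ultimately show ?thesis using B by (simp add: F1_def)
  qed
  moreover have "sheffer_generated scale S (series_one scale) B"
    unfolding sheffer_generated_iff[OF S(2) series_one_tseries B]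
  proof (intro ballI allI)
    fix \<omega> v assume \<omega>: "\<omega> \<in> dual scale"
    \<comment> \<open>The part of the generating function of degree \<open>k\<close> in \<open>\<omega>\<close>.\<close>
    define g where "g = (\<lambda>k. Abs_fps (\<lambda>n. if k \<le> n then dual_pair k \<omega> (Q k n (tpow scale n v)) / fact n else 0))"
    define G where "G = (\<lambda>c. ev (generating_series scale S (fun_scale c \<omega>)) v)"
    have "G 1 = fps_expo (g 1)"
    proof (rule multiplicative_imp_expo)
      show "fps_nth (g k) n = 0" if "n < k" for k n using that by (simp add: g_def)
      show "fps_nth (G c) n = (\<Sum>k\<le>n. fps_nth (g k) n * c ^ k)" for c n
      proof -
        have "fps_nth (G c) n = (\<Sum>k\<le>n. dual_pair k (fun_scale c \<omega>) (Q k n (tpow scale n v))) / fact n"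
          by (simp add: G_def generating_series_tpow SQ dual_scale \<omega>)
        also have "\<dots> = (\<Sum>k\<le>n. fps_nth (g k) n * c ^ k)"
          unfolding sum_divide_distrib
          by (intro sum.cong)
            (simp_all add: g_def dual_pair_fun_scale[OF \<omega> lin_maps_in[OF Q tpow_in_Sym]] mult.commute)
        finally show ?thesis .
      qed
      have "fun_scale (a + b) \<omega> = fun_scale a \<omega> + fun_scale b \<omega>" for a b
        by (simp add: fun_eq_iff fun_apply algebra_simps)
      then show "G (a + b) = G a * G b" for a b
        by (simp add: G_def mult dual_scale \<omega>)
      show "fps_nth (G 0) 0 = 1" unfolding G_def by (rule one[OF dual_scale[OF \<omega>]])
    qed
    moreover have "fun_scale 1 \<omega> = \<omega>" by (simp add: fun_eq_iff fun_apply)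
    moreover have "g 1 = ev (series_dual_pair scale \<omega> B) v"
    proof (rule fps_ext)
      fix n
      show "fps_nth (g 1) n = fps_nth (ev (series_dual_pair scale \<omega> B) v) n"
      proof (cases "n = 0")
        case True
        have "\<omega> 0 = 0" using \<omega> by (simp add: dual_iff) (metis add_cancel_right_right)
        then show ?thesis using True by (simp add: g_def B_def)
      next
        case False
        then have Q1: "Q 1 n (tpow scale n v) \<in> Sym scale 1" by (intro lin_maps_in[OF Q tpow_in_Sym]) simp
        have "\<omega> (scale (1 / fact n) (\<iota> (Q 1 n (tpow scale n v)))) = dual_pair 1 \<omega> (Q 1 n (tpow scale n v)) / fact n"
          using \<iota>[OF Q1 \<omega>] \<omega> by (simp add: dual_iff)
        then show ?thesis using False by (simp add: g_def B_def)
      qed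
    qed
    ultimately show "ev (generating_series scale S \<omega>) v =
        fps_expo (ev (series_dual_pair scale \<omega> B) v) * ev (series_one scale) v"
      by (simp add: G_def ev_series_one)
  qed
  ultimately show ?thesis by blast
qed

lemma sheffer_one_imp_umbral:
  assumes "S \<in> poly_seq_ops scale" "B \<in> F1 scale" "sheffer_generated scale S (series_one scale) B"
  shows "S \<in> umbral_ops scale"
proof -
  let ?c = "\<lambda>\<omega>. ev (series_dual_pair scale \<omega> B)"
  have G: "ev (generating_series scale S \<omega>) v = fps_expo (?c \<omega> v)" if "\<omega> \<in> dual scale" for \<omega> v
    using assms(3) that
    unfolding sheffer_generated_iff[OF poly_seq_ops_maps[OF assms(1)] series_one_tseries F1D[OF assms(2)]]
    by (simp add: ev_series_one)
  have "?c (\<omega> + \<theta>) v = ?c \<omega> v + ?c \<theta> v" for \<omega> \<theta> v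
    by (rule fps_ext) (simp add: fun_apply)
  then show ?thesis
    unfolding umbral_ops_iff_multiplicative
    using assms(1) by (simp add: G dual_add fps_expo_add ev_dual_pair_nth_0[OF assms(2)] del: ev_nth)
qed

section \<open>The Sheffer group\<close>

abbreviation "id_op \<equiv> \<lambda>p\<in>Polys scale. p"

text \<open>A linear operator with a Sheffer generating function is automatically triangular with bijective diagonal, since it
coincides with the operator constructed from the same pair. This is how compositions are seen to be Sheffer operators.\<close>

lemma Sheffer_opsI:
  assumes "S \<in> poly_maps" "A \<in> F0 scale" "B \<in> F1 scale" "sheffer_generated scale S A B"
  shows "S \<in> Sheffer_ops scale"
proof -
  obtain S' where S': "S' \<in> poly_seq_ops scale" "sheffer_generated scale S' A B"
    using sheffer_operator_exists[OF assms(2,3)] by blast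
  then have "S = S'"
    using sheffer_generated_determines[OF assms(1) poly_seq_ops_maps assms(4)] by blast
  then show ?thesis using S' assms(2,3) by (auto simp: Sheffer_ops_def)
qed

lemma riordan_map_eq:
  assumes "S \<in> poly_maps" "A \<in> F0 scale" "B \<in> F1 scale" "sheffer_generated scale S A B"
  shows "riordan_map scale S = (A, B)"
  unfolding riordan_map_def
  using assms sheffer_generated_unique[OF assms(1)] by (intro the_equality) auto

lemma Sheffer_opsE:
  assumes "S \<in> Sheffer_ops scale"
  obtains A B where "S \<in> poly_maps" "A \<in> F0 scale" "B \<in> F1 scale" "sheffer_generated scale S A B"
    "riordan_map scale S = (A, B)"
proof -
  obtain A B where *: "S \<in> poly_maps" "A \<in> F0 scale" "B \<in> F1 scale" "sheffer_generated scale S A B"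
    using assms poly_seq_ops_maps by (auto simp: Sheffer_ops_def)
  from that[OF * riordan_map_eq[OF *]] show thesis .
qed

lemma bij_betw_riordan_map: "bij_betw (riordan_map scale) (Sheffer_ops scale) (F0 scale \<times> F1 scale)"
proof (rule bij_betw_imageI)
  show "inj_on (riordan_map scale) (Sheffer_ops scale)"
  proof (rule inj_onI)
    fix S T assume S: "S \<in> Sheffer_ops scale" and T: "T \<in> Sheffer_ops scale"
      and eq: "riordan_map scale S = riordan_map scale T"
    from S show "S = T"
    proof (rule Sheffer_opsE)
      fix A B assume AB: "S \<in> poly_maps" "sheffer_generated scale S A B" "riordan_map scale S = (A, B)"
      from T show "S = T"
        by (rule Sheffer_opsE) (use AB eq in \<open>auto intro: sheffer_generated_determines\<close>)
    qed
  qed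
  show "riordan_map scale ` Sheffer_ops scale = F0 scale \<times> F1 scale"
  proof (intro equalityI subsetI)
    fix x assume "x \<in> riordan_map scale ` Sheffer_ops scale"
    then show "x \<in> F0 scale \<times> F1 scale" by (auto elim: Sheffer_opsE)
  next
    fix x assume "x \<in> F0 scale \<times> F1 scale"
    then obtain A B where x: "x = (A, B)" "A \<in> F0 scale" "B \<in> F1 scale" by auto
    then obtain S where S: "S \<in> poly_maps" "sheffer_generated scale S A B"
      using sheffer_operator_exists poly_seq_ops_maps by metis
    with x show "x \<in> riordan_map scale ` Sheffer_ops scale"
      using Sheffer_opsI[OF S(1) x(2,3) S(2)] riordan_map_eq[OF S(1) x(2,3) S(2)] by (metis image_eqI)
  qed
qed

lemma Sheffer_ops_compose:
  assumes "S \<in> Sheffer_ops scale" "T \<in> Sheffer_ops scale"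
    and "riordan_map scale S = (A1, B1)" "riordan_map scale T = (A2, B2)"
  shows "compose (Polys scale) S T \<in> Sheffer_ops scale"
    and "riordan_map scale (compose (Polys scale) S T) =
      (series_mult scale (series_comp scale A1 B2) A2, series_comp scale B1 B2)"
proof -
  have S: "S \<in> poly_maps" "sheffer_generated scale S A1 B1" "A1 \<in> F0 scale" "B1 \<in> F1 scale"
    using assms(1,3) by (auto elim: Sheffer_opsE)
  have T: "T \<in> poly_maps" "sheffer_generated scale T A2 B2" "A2 \<in> F0 scale" "B2 \<in> F1 scale"
    using assms(2,4) by (auto elim: Sheffer_opsE)
  note * = poly_maps_compose[OF S(1) T(1)] series_mult_F0[OF series_comp_F0[OF S(3) T(4)] T(3)]
    series_comp_F1[OF S(4) T(4)] sheffer_generated_compose[OF S T]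
  show "compose (Polys scale) S T \<in> Sheffer_ops scale" by (rule Sheffer_opsI[OF *])
  show "riordan_map scale (compose (Polys scale) S T) =
      (series_mult scale (series_comp scale A1 B2) A2, series_comp scale B1 B2)"
    by (rule riordan_map_eq[OF *])
qed

lemma id_op_Sheffer: "id_op \<in> Sheffer_ops scale"
  and riordan_map_one: "riordan_map scale id_op = (series_one scale, series_id scale)"
  by (rule Sheffer_opsI riordan_map_eq; rule poly_maps_id series_one_F0 series_id_F1 sheffer_generated_id)+

lemma riordan_map_inj:
  "S \<in> Sheffer_ops scale \<Longrightarrow> T \<in> Sheffer_ops scale \<Longrightarrow> riordan_map scale S = riordan_map scale T \<Longrightarrow> S = T"
  using bij_betw_riordan_map by (auto simp: bij_betw_def dest: inj_onD)

lemma riordan_map_surj: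
  assumes "A \<in> F0 scale" "B \<in> F1 scale"
  obtains S where "S \<in> Sheffer_ops scale" "riordan_map scale S = (A, B)"
  using assms bij_betw_riordan_map unfolding bij_betw_def
  by (metis (no_types, lifting) SigmaI imageE)

lemma riordan_map_in:
  assumes "S \<in> Sheffer_ops scale" "riordan_map scale S = (A, B)"
  shows "A \<in> F0 scale" "B \<in> F1 scale"
  using assms by (auto elim: Sheffer_opsE)

lemma sheffer_group_simps [simp]:
  "carrier (sheffer_group scale) = Sheffer_ops scale"
  "S \<otimes>\<^bsub>sheffer_group scale\<^esub> T = compose (Polys scale) S T"
  "\<one>\<^bsub>sheffer_group scale\<^esub> = id_op"
  by (simp_all add: sheffer_group_def)

lemma riordan_group_simps [simp]:
  "carrier (riordan_group scale) = F0 scale \<times> F1 scale"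
  "(A1, B1) \<otimes>\<^bsub>riordan_group scale\<^esub> (A2, B2) =
    (series_mult scale (series_comp scale A1 B2) A2, series_comp scale B1 B2)"
  "\<one>\<^bsub>riordan_group scale\<^esub> = (series_one scale, series_id scale)"
  by (simp_all add: riordan_group_def)

lemma F0_comp_solve_left:
  assumes "C \<in> F0 scale" "B \<in> F1 scale"
  shows "\<exists>A\<in>F0 scale. series_comp scale A B = C"
proof -
  obtain A where A: "A \<in> tseries scale (*)" "series_comp scale A B = C"
    using series_comp_solve_left[OF vector_space_times F0D[OF assms(1)] assms(2)] by blast
  then have "A 0 = C 0" by (auto simp: series_comp_def)
  then have "A \<in> F0 scale" using assms(1) A(1) by (simp add: F0_def series_at_0_def)
  then show ?thesis using A(2) by blast
qed

text \<open>Left inverses suffice: choose \<open>B'\<close> with \<open>B'(B(v)) = v\<close> and \<open>A'\<close> such that \<open>A'(B(v))\<close> is the multiplicative inverse of \<open>A(v)\<close>. The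
operator of \<open>(A', B')\<close> composed with the given one has the pair of the identity.\<close>

lemma group_sheffer: "group (sheffer_group scale)"
proof (rule groupI; unfold sheffer_group_simps)
  show "compose (Polys scale) S T \<in> Sheffer_ops scale"
    if "S \<in> Sheffer_ops scale" "T \<in> Sheffer_ops scale" for S T
    using Sheffer_ops_compose(1)[OF that] by (metis surj_pair)
  show "id_op \<in> Sheffer_ops scale" by (rule id_op_Sheffer)
  have maps: "S \<in> Polys scale \<rightarrow>\<^sub>E Polys scale" if "S \<in> Sheffer_ops scale" for S
    using that by (auto elim!: Sheffer_opsE simp: lin_maps_def)
  then show "compose (Polys scale) (compose (Polys scale) S T) U =
      compose (Polys scale) S (compose (Polys scale) T U)"
    if "S \<in> Sheffer_ops scale" "T \<in> Sheffer_ops scale" "U \<in> Sheffer_ops scale" for S T U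
    using that by (intro compose_assoc[symmetric]) (auto simp: PiE_def)
  show "compose (Polys scale) id_op S = S" if "S \<in> Sheffer_ops scale" for S
    using maps[OF that] by (intro Id_compose) (auto simp: PiE_def)
  show "\<exists>T\<in>Sheffer_ops scale. compose (Polys scale) T S = id_op" if S: "S \<in> Sheffer_ops scale" for S
  proof -
    obtain A B where AB: "riordan_map scale S = (A, B)" by fastforce
    note AB' = riordan_map_in[OF S AB]
    obtain B' where B': "B' \<in> F1 scale" "series_comp scale B' B = series_id scale"
      using F1_left_inverse[OF AB'(2)] by blast
    obtain C where C: "C \<in> tseries scale (*)" "series_mult scale C A = series_one scale"
      using F0_inverse[OF AB'(1)] by blast
    have C0: "C \<in> F0 scale" using F0_if_mult_F0[OF C(1) F0D[OF AB'(1)]] C(2) series_one_F0 by simp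
    obtain A' where A': "A' \<in> F0 scale" "series_comp scale A' B = C"
      using F0_comp_solve_left[OF C0 AB'(2)] by blast
    obtain T where T: "T \<in> Sheffer_ops scale" "riordan_map scale T = (A', B')"
      by (rule riordan_map_surj[OF A'(1) B'(1)])
    have "compose (Polys scale) T S = id_op"
      by (rule riordan_map_inj[OF Sheffer_ops_compose(1)[OF T(1) S T(2) AB] id_op_Sheffer])
        (simp add: Sheffer_ops_compose(2)[OF T(1) S T(2) AB] A' B' C riordan_map_one)
    with T(1) show ?thesis by blast
  qed
qed

lemma riordan_map_iso: "riordan_map scale \<in> iso (sheffer_group scale) (riordan_group scale)"
proof -
  have "riordan_map scale (compose (Polys scale) S T) =
      riordan_map scale S \<otimes>\<^bsub>riordan_group scale\<^esub> riordan_map scale T"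
    if "S \<in> Sheffer_ops scale" "T \<in> Sheffer_ops scale" for S T
    using Sheffer_ops_compose(2)[OF that] by (cases "riordan_map scale S"; cases "riordan_map scale T") simp
  then show ?thesis
    using bij_betw_riordan_map by (auto simp: iso_def hom_def bij_betw_def)
qed

text \<open>The Riordan group is the image of the Sheffer group under a homomorphism.\<close>

lemma group_riordan: "group (riordan_group scale)"
proof -
  interpret S: group "sheffer_group scale" by (rule group_sheffer)
  have "riordan_map scale \<in> hom (sheffer_group scale) (riordan_group scale)"
    using riordan_map_iso by (simp add: iso_def)
  from S.hom_imp_img_group[OF this] show ?thesis
    using bij_betw_riordan_map
    by (simp add: bij_betw_def riordan_map_one riordan_group_def)
qed

section \<open>Appell and umbral operators\<close>

lemma Appell_ops_iff:
  "S \<in> Appell_ops scale \<longleftrightarrow> S \<in> Sheffer_ops scale \<and> snd (riordan_map scale S) = series_id scale"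
  (is "_ \<longleftrightarrow> ?R")
proof
  assume S: "S \<in> Appell_ops scale"
  then obtain A where A: "A \<in> F0 scale" "sheffer_generated scale S A (series_id scale)"
    and "S \<in> Sheffer_ops scale" by (auto simp: Appell_ops_def)
  then show ?R using riordan_map_eq[OF _ A(1) series_id_F1 A(2)] by (auto elim: Sheffer_opsE)
next
  assume ?R
  then show "S \<in> Appell_ops scale" by (auto elim!: Sheffer_opsE simp: Appell_ops_def)
qed

lemma umbral_ops_iff:
  "S \<in> umbral_ops scale \<longleftrightarrow> S \<in> Sheffer_ops scale \<and> fst (riordan_map scale S) = series_one scale"
  (is "_ \<longleftrightarrow> ?R")
proof
  assume S: "S \<in> umbral_ops scale"
  then have S': "S \<in> poly_seq_ops scale" by (simp add: umbral_ops_def)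
  obtain B where B: "B \<in> F1 scale" "sheffer_generated scale S (series_one scale) B"
    using umbral_imp_sheffer[OF S] by blast
  then show ?R
    using Sheffer_opsI[OF poly_seq_ops_maps[OF S'] series_one_F0 B]
      riordan_map_eq[OF poly_seq_ops_maps[OF S'] series_one_F0 B] by simp
next
  assume R: ?R
  then have "S \<in> poly_seq_ops scale" by (simp add: Sheffer_ops_def)
  with R show "S \<in> umbral_ops scale"
    by (auto elim!: Sheffer_opsE intro: sheffer_one_imp_umbral)
qed

lemma Appell_opsE:
  assumes "S \<in> Appell_ops scale"
  obtains A where "riordan_map scale S = (A, series_id scale)" "S \<in> Sheffer_ops scale"
  using assms that by (cases "riordan_map scale S") (auto simp: Appell_ops_iff)

lemma umbral_opsE:
  assumes "S \<in> umbral_ops scale"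
  obtains B where "riordan_map scale S = (series_one scale, B)" "S \<in> Sheffer_ops scale"
  using assms that by (cases "riordan_map scale S") (auto simp: umbral_ops_iff)

lemma series_mult_one: "A \<in> tseries scale (*) \<Longrightarrow> series_mult scale (series_one scale) A = A"
  "A \<in> tseries scale (*) \<Longrightarrow> series_mult scale A (series_one scale) = A"
  by (rule ev_eqI; simp add: series_mult_tseries series_one_tseries ev_series_mult ev_series_one)+

lemma series_one_comp:
  assumes "B \<in> tseries scale scale"
  shows "series_comp scale (series_one scale) B = series_one scale"
  by (rule ev_eqI)
    (simp_all add: series_comp_tseries vector_space_times series_one_tseries assms ev_series_comp
      compose_curve_one ev_series_one)

text \<open>These are the unit laws of the Riordan group, read in the second component.\<close>

lemma series_id_comp: "B \<in> F1 scale \<Longrightarrow> series_comp scale (series_id scale) B = B"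
  and series_comp_id: "B \<in> F1 scale \<Longrightarrow> series_comp scale B (series_id scale) = B"
proof -
  interpret R: group "riordan_group scale" by (rule group_riordan)
  assume B: "B \<in> F1 scale"
  show "series_comp scale (series_id scale) B = B" "series_comp scale B (series_id scale) = B"
    using R.l_one[of "(series_one scale, B)"] R.r_one[of "(series_one scale, B)"] B series_one_F0
    by simp_all
qed

lemma riordan_map_inv:
  assumes "S \<in> Sheffer_ops scale" "riordan_map scale S = (A, B)"
    and "riordan_map scale (inv\<^bsub>sheffer_group scale\<^esub> S) = (A', B')"
  shows "series_mult scale (series_comp scale A B') A' = series_one scale"
    and "series_comp scale B B' = series_id scale"
    and "inv\<^bsub>sheffer_group scale\<^esub> S \<in> Sheffer_ops scale"
proof -
  interpret S: group "sheffer_group scale" by (rule group_sheffer)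
  show inv: "inv\<^bsub>sheffer_group scale\<^esub> S \<in> Sheffer_ops scale"
    using S.inv_closed[of S] assms(1) by simp
  have "compose (Polys scale) S (inv\<^bsub>sheffer_group scale\<^esub> S) = id_op"
    using S.r_inv[of S] assms(1) by simp
  then show "series_mult scale (series_comp scale A B') A' = series_one scale"
    and "series_comp scale B B' = series_id scale"
    using Sheffer_ops_compose(2)[OF assms(1) inv assms(2,3)] riordan_map_one by simp_all
qed

text \<open>The second component of the Riordan product ignores the first components, so Appell operators are the
elements whose second component is the unit. A conjugate then has second component \<open>B(B'(v)) = v\<close>.\<close>

lemma Appell_normal: "Appell_ops scale \<lhd> sheffer_group scale"
proof -
  interpret S: group "sheffer_group scale" by (rule group_sheffer)
  have "subgroup (Appell_ops scale) (sheffer_group scale)"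
  proof (rule S.subgroupI)
    show "Appell_ops scale \<subseteq> carrier (sheffer_group scale)" by (auto simp: Appell_ops_iff)
    show "Appell_ops scale \<noteq> {}"
      using id_op_Sheffer riordan_map_one Appell_ops_iff by fastforce
    show "inv\<^bsub>sheffer_group scale\<^esub> S \<in> Appell_ops scale" if *: "S \<in> Appell_ops scale" for S
    proof -
      obtain A where AB: "riordan_map scale S = (A, series_id scale)" and S: "S \<in> Sheffer_ops scale"
        using * by (rule Appell_opsE)
      obtain A' B' where inv: "riordan_map scale (inv\<^bsub>sheffer_group scale\<^esub> S) = (A', B')"
        by fastforce
      note i = riordan_map_inv[OF S AB inv]
      show ?thesis
        using i(2,3) riordan_map_in[OF i(3) inv] inv by (simp add: Appell_ops_iff series_id_comp)
    qed
    show "S \<otimes>\<^bsub>sheffer_group scale\<^esub> T \<in> Appell_ops scale"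
      if ST: "S \<in> Appell_ops scale" "T \<in> Appell_ops scale" for S T
    proof -
      obtain A1 A2 where "riordan_map scale S = (A1, series_id scale)" "S \<in> Sheffer_ops scale"
        "riordan_map scale T = (A2, series_id scale)" "T \<in> Sheffer_ops scale"
        using ST by (elim Appell_opsE) (rule that)
      then show ?thesis
        using Sheffer_ops_compose by (simp add: Appell_ops_iff series_id_comp series_id_F1)
    qed
  qed
  moreover have "S \<otimes>\<^bsub>sheffer_group scale\<^esub> T \<otimes>\<^bsub>sheffer_group scale\<^esub> inv\<^bsub>sheffer_group scale\<^esub> S \<in> Appell_ops scale"
    if S: "S \<in> carrier (sheffer_group scale)" and T: "T \<in> Appell_ops scale" for S T
  proof -
    obtain A B A' B' where AB: "riordan_map scale S = (A, B)" "S \<in> Sheffer_ops scale"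
      and inv: "riordan_map scale (inv\<^bsub>sheffer_group scale\<^esub> S) = (A', B')"
      using S by (cases "riordan_map scale S"; cases "riordan_map scale (inv\<^bsub>sheffer_group scale\<^esub> S)") simp
    obtain A1 where T: "riordan_map scale T = (A1, series_id scale)" "T \<in> Sheffer_ops scale"
      using T by (rule Appell_opsE)
    note i = riordan_map_inv[OF AB(2,1) inv]
    note ST = Sheffer_ops_compose[OF AB(2) T(2) AB(1) T(1)]
    note STS = Sheffer_ops_compose[OF ST(1) i(3) ST(2) inv]
    show ?thesis
      using STS i(2) riordan_map_in[OF AB(2,1)] by (simp add: Appell_ops_iff series_comp_id)
  qed
  ultimately show ?thesis by (simp add: S.normal_inv_iff)
qed

lemma umbral_subgroup: "subgroup (umbral_ops scale) (sheffer_group scale)"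
proof -
  interpret S: group "sheffer_group scale" by (rule group_sheffer)
  show ?thesis
  proof (rule S.subgroupI)
    show "umbral_ops scale \<subseteq> carrier (sheffer_group scale)" by (auto simp: umbral_ops_iff)
    show "umbral_ops scale \<noteq> {}"
      using id_op_Sheffer riordan_map_one umbral_ops_iff by fastforce
    show "inv\<^bsub>sheffer_group scale\<^esub> S \<in> umbral_ops scale" if *: "S \<in> umbral_ops scale" for S
    proof -
      obtain B where AB: "riordan_map scale S = (series_one scale, B)" and S: "S \<in> Sheffer_ops scale"
        using * by (rule umbral_opsE)
      obtain A' B' where inv: "riordan_map scale (inv\<^bsub>sheffer_group scale\<^esub> S) = (A', B')"
        by fastforce
      note i = riordan_map_inv[OF S AB inv]
      note r = riordan_map_in[OF i(3) inv]
      show ?thesis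
        using i(1,3) inv by (simp add: umbral_ops_iff series_one_comp[OF F1D[OF r(2)]] series_mult_one F0D[OF r(1)])
    qed
    show "S \<otimes>\<^bsub>sheffer_group scale\<^esub> T \<in> umbral_ops scale"
      if ST: "S \<in> umbral_ops scale" "T \<in> umbral_ops scale" for S T
    proof -
      obtain B1 B2 where *: "riordan_map scale S = (series_one scale, B1)" "S \<in> Sheffer_ops scale"
        "riordan_map scale T = (series_one scale, B2)" "T \<in> Sheffer_ops scale"
        using ST by (elim umbral_opsE) (rule that)
      then have "B2 \<in> F1 scale" using riordan_map_in by blast
      then show ?thesis
        using Sheffer_ops_compose[OF *(2,4,1,3)]
        by (simp add: umbral_ops_iff series_one_comp F1D series_mult_one series_one_tseries)
    qed
  qed
qed

text \<open>The factorization is \<open>(A, B) = (A', v) (1, B)\<close> with \<open>A'(B(v)) = A(v)\<close>.\<close>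

lemma Appell_umbral_semidirect:
  "internal_semidirect_product (sheffer_group scale) (Appell_ops scale) (umbral_ops scale)"
  unfolding internal_semidirect_product_def
proof (intro conjI group_sheffer Appell_normal umbral_subgroup)
  have "S = id_op" if "S \<in> Appell_ops scale" "S \<in> umbral_ops scale" for S
  proof (rule riordan_map_inj[OF _ id_op_Sheffer])
    show "S \<in> Sheffer_ops scale" "riordan_map scale S = riordan_map scale id_op"
      using that by (auto simp: Appell_ops_iff umbral_ops_iff riordan_map_one prod_eq_iff)
  qed
  then show "Appell_ops scale \<inter> umbral_ops scale = {\<one>\<^bsub>sheffer_group scale\<^esub>}"
    using id_op_Sheffer riordan_map_one by (auto simp: Appell_ops_iff umbral_ops_iff)
  show "Appell_ops scale <#>\<^bsub>sheffer_group scale\<^esub> umbral_ops scale = carrier (sheffer_group scale)"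
  proof (intro equalityI subsetI)
    fix S assume "S \<in> Appell_ops scale <#>\<^bsub>sheffer_group scale\<^esub> umbral_ops scale"
    then show "S \<in> carrier (sheffer_group scale)"
      using Sheffer_ops_compose(1) by (auto simp: set_mult_def Appell_ops_iff umbral_ops_iff) (metis surj_pair)
  next
    fix S assume "S \<in> carrier (sheffer_group scale)"
    then have S: "S \<in> Sheffer_ops scale" by simp
    obtain A B where AB: "riordan_map scale S = (A, B)" by fastforce
    note AB' = riordan_map_in[OF S AB]
    obtain A0 where A0: "A0 \<in> F0 scale" "series_comp scale A0 B = A"
      using F0_comp_solve_left[OF AB'] by blast
    obtain T where T: "T \<in> Sheffer_ops scale" "riordan_map scale T = (A0, series_id scale)"
      by (rule riordan_map_surj[OF A0(1) series_id_F1])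
    obtain U where U: "U \<in> Sheffer_ops scale" "riordan_map scale U = (series_one scale, B)"
      by (rule riordan_map_surj[OF series_one_F0 AB'(2)])
    note TU = Sheffer_ops_compose[OF T(1) U(1) T(2) U(2)]
    have "S = compose (Polys scale) T U"
      by (rule riordan_map_inj[OF S TU(1)])
        (simp add: AB TU(2) A0(2) series_mult_one F0D[OF AB'(1)] series_id_comp AB'(2))
    moreover have "T \<in> Appell_ops scale" "U \<in> umbral_ops scale"
      using T U by (simp_all add: Appell_ops_iff umbral_ops_iff)
    ultimately show "S \<in> Appell_ops scale <#>\<^bsub>sheffer_group scale\<^esub> umbral_ops scale"
      unfolding set_mult_def sheffer_group_simps by blast
  qed
qed

end

theorem theorem7p1:
  fixes scale :: "'f::real_or_complex \<Rightarrow> 'v::ab_group_add \<Rightarrow> 'v"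
  assumes "vector_space scale"
  shows "group (sheffer_group scale)
      \<and> Appell_ops scale \<lhd> sheffer_group scale
      \<and> subgroup (umbral_ops scale) (sheffer_group scale)
      \<and> internal_semidirect_product (sheffer_group scale) (Appell_ops scale) (umbral_ops scale)
      \<and> group (riordan_group scale)
      \<and> (\<forall>S \<in> Sheffer_ops scale. \<exists>!AB.
            AB \<in> F0 scale \<times> F1 scale \<and> sheffer_generated scale S (fst AB) (snd AB))
      \<and> bij_betw (riordan_map scale) (Sheffer_ops scale) (F0 scale \<times> F1 scale)
      \<and> riordan_map scale \<in> iso (sheffer_group scale) (riordan_group scale)"
proof -
  interpret vector_space scale by fact
  interpret symmetric_powers scale ..
  have "\<exists>!AB. AB \<in> F0 scale \<times> F1 scale \<and> sheffer_generated scale S (fst AB) (snd AB)"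
    if S: "S \<in> Sheffer_ops scale" for S
  proof -
    obtain A B where *: "S \<in> poly_maps" "A \<in> F0 scale" "B \<in> F1 scale" "sheffer_generated scale S A B"
      using S by (rule Sheffer_opsE)
    then show ?thesis
      using sheffer_generated_unique[OF *(1)] by (intro ex1I[of _ "(A, B)"]) auto
  qed
  then show ?thesis
    using group_sheffer Appell_normal umbral_subgroup Appell_umbral_semidirect group_riordan
      bij_betw_riordan_map riordan_map_iso by blast
qed

end
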